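(* Let $p_1\equiv p_2\equiv 1\pmod 4$ be primes, $k=\mathbb{Q}(\sqrt{2p_1p_2},i)$, and let $\mathbb{K}$ be an unramified quadratic extension of $k$ which is abelian over $\mathbb{Q}$. Then (1) $\ker J_{\mathbb{K}}\subset Am_s(k/\mathbb{Q}(i))$; (2) $Am_s(k/\mathbb{Q}(i))\subseteq \ker J_{k^{( * )}}$.
   Context: $i=\sqrt{-1}$. $\mathbf{C}_k$ is the ideal class group of $k$. For a finite extension $L/k$, $J_L:\mathbf{C}_k\to\mathbf{C}_L$ is the homomorphism induced by extending ideals of $k$ to $L$; $\ker J_L$ is the capitulation kernel. $Am_s(k/\mathbb{Q}(i))$ denotes the subgroup of $\mathbf{C}_k$ generated by the strongly ambiguous classes of $k/\mathbb{Q}(i)$, i.e. ideal classes of $k$ containing at least one ideal invariant under the nontrivial automorphism of $k/\mathbb{Q}(i)$. $k^{( * )}$ denotes the absolute genus field of $k$ (the maximal unramified extension of $k$ that is abelian over $\mathbb{Q}$); here $k^{( * )}=\mathbb{Q}(\sqrt2,\sqrt{p_1},\sqrt{p_2},i)$, and the unramified quadratic extensions of $k$ abelian over $\mathbb{Q}$ are $k(\sqrt{p_1})$, $k(\sqrt{p_2})$, $k(\sqrt2)$. *)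

theory Defs
  imports Complex_Main "HOL-Computational_Algebra.Polynomial" "HOL-Algebra.Generated_Groups"
begin

text \<open>Number fields are modelled as subfields of the complex numbers.\<close>

definition nf_subfield :: "complex set \<Rightarrow> bool" where
  "nf_subfield F \<longleftrightarrow> 0 \<in> F \<and> 1 \<in> F \<and> (\<forall>x\<in>F. \<forall>y\<in>F. x + y \<in> F \<and> x * y \<in> F)
     \<and> (\<forall>x\<in>F. - x \<in> F \<and> inverse x \<in> F)"

definition gen_field :: "complex set \<Rightarrow> complex set" where
  "gen_field S = \<Inter> {F. nf_subfield F \<and> S \<subseteq> F}"

definition alg_integer :: "complex \<Rightarrow> bool" where
  "alg_integer x \<longleftrightarrow> (\<exists>p :: int poly. lead_coeff p = 1 \<and> poly (map_poly of_int p) x = 0)"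

definition ring_of_integers :: "complex set \<Rightarrow> complex set" where
  "ring_of_integers K = {x \<in> K. alg_integer x}"

definition nf_ideal :: "complex set \<Rightarrow> complex set \<Rightarrow> bool" where
  "nf_ideal R I \<longleftrightarrow> I \<subseteq> R \<and> 0 \<in> I \<and> (\<forall>x\<in>I. \<forall>y\<in>I. x + y \<in> I)
     \<and> (\<forall>r\<in>R. \<forall>x\<in>I. r * x \<in> I)"

definition ideal_gen :: "complex set \<Rightarrow> complex set \<Rightarrow> complex set" where
  "ideal_gen R S = \<Inter> {I. nf_ideal R I \<and> S \<subseteq> I}"

definition ideal_mult :: "complex set \<Rightarrow> complex set \<Rightarrow> complex set \<Rightarrow> complex set" where
  "ideal_mult R I J = ideal_gen R {a * b | a b. a \<in> I \<and> b \<in> J}"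

definition nz_ideals :: "complex set \<Rightarrow> complex set set" where
  "nz_ideals R = {I. nf_ideal R I \<and> I \<noteq> {0}}"

definition nf_prime :: "complex set \<Rightarrow> complex set \<Rightarrow> bool" where
  "nf_prime R P \<longleftrightarrow> nf_ideal R P \<and> P \<noteq> {0} \<and> P \<noteq> R
     \<and> (\<forall>a\<in>R. \<forall>b\<in>R. a * b \<in> P \<longrightarrow> a \<in> P \<or> b \<in> P)"

definition ideal_equiv :: "complex set \<Rightarrow> complex set \<Rightarrow> complex set \<Rightarrow> bool" where
  "ideal_equiv R I J \<longleftrightarrow> (\<exists>a\<in>R - {0}. \<exists>b\<in>R - {0}. (\<lambda>x. a * x) ` I = (\<lambda>x. b * x) ` J)"

definition ideal_class :: "complex set \<Rightarrow> complex set \<Rightarrow> complex set set" where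
  "ideal_class R I = {J \<in> nz_ideals R. ideal_equiv R I J}"

definition class_group :: "complex set \<Rightarrow> complex set set monoid" where
  "class_group R = \<lparr> carrier = ideal_class R ` nz_ideals R,
      mult = (\<lambda>X Y. ideal_class R (ideal_mult R (SOME I. I \<in> X) (SOME J. J \<in> Y))),
      one = ideal_class R R \<rparr>"

definition ideal_ext :: "complex set \<Rightarrow> complex set \<Rightarrow> complex set" where
  "ideal_ext OL I = ideal_gen OL I"

definition ext_class :: "complex set \<Rightarrow> complex set \<Rightarrow> complex set set \<Rightarrow> complex set set" where
  "ext_class Ok OL X = ideal_class OL (ideal_ext OL (SOME I. I \<in> X))"

definition capitulation_kernel :: "complex set \<Rightarrow> complex set \<Rightarrow> complex set set set" where
  "capitulation_kernel Ok OL =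
     {X \<in> carrier (class_group Ok). ext_class Ok OL X = \<one>\<^bsub>class_group OL\<^esub>}"

definition field_auts :: "complex set \<Rightarrow> (complex \<Rightarrow> complex) set" where
  "field_auts K = {\<sigma>. bij_betw \<sigma> K K \<and>
     (\<forall>x\<in>K. \<forall>y\<in>K. \<sigma> (x + y) = \<sigma> x + \<sigma> y \<and> \<sigma> (x * y) = \<sigma> x * \<sigma> y)}"

definition rel_auts :: "complex set \<Rightarrow> complex set \<Rightarrow> (complex \<Rightarrow> complex) set" where
  "rel_auts K F = {\<sigma> \<in> field_auts K. \<forall>x\<in>F. \<sigma> x = x}"

definition strongly_ambiguous_classes :: "complex set \<Rightarrow> complex set \<Rightarrow> complex set set set" where
  "strongly_ambiguous_classes k F =
     {ideal_class (ring_of_integers k) I | I. I \<in> nz_ideals (ring_of_integers k)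
        \<and> (\<forall>\<sigma>\<in>rel_auts k F. \<sigma> ` I = I)}"

definition Am_s :: "complex set \<Rightarrow> complex set \<Rightarrow> complex set set set" where
  "Am_s k F = generate (class_group (ring_of_integers k)) (strongly_ambiguous_classes k F)"

definition quadratic_ext :: "complex set \<Rightarrow> complex set \<Rightarrow> bool" where
  "quadratic_ext k K \<longleftrightarrow> nf_subfield K \<and> k \<subseteq> K \<and>
     (\<exists>\<alpha>\<in>K. \<alpha> \<notin> k \<and> K = {a + b * \<alpha> | a b. a \<in> k \<and> b \<in> k})"

text \<open>Unramified at all finite primes: no prime \<open>P\<close> of \<open>k\<close> has \<open>Q\<^sup>2 | P O_K\<close> for a prime \<open>Q\<close>
  of \<open>K\<close> (divisibility = containment in Dedekind domains). Here \<open>k\<close> is totally complex, so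
  there is no ramification at infinite places.\<close>
definition unramified :: "complex set \<Rightarrow> complex set \<Rightarrow> bool" where
  "unramified k K \<longleftrightarrow>
     (\<forall>P Q. nf_prime (ring_of_integers k) P \<longrightarrow> nf_prime (ring_of_integers K) Q \<longrightarrow>
        \<not> ideal_ext (ring_of_integers K) P \<subseteq> ideal_mult (ring_of_integers K) Q Q)"

text \<open>\<open>K\<close> (of finite degree) is abelian over \<open>\<rat>\<close>: normal (every embedding into \<open>\<complex>\<close> maps \<open>K\<close>
  onto \<open>K\<close>) with commuting automorphisms.\<close>
definition abelian_over_Q :: "complex set \<Rightarrow> bool" where
  "abelian_over_Q K \<longleftrightarrow>
     (\<forall>\<sigma>::complex \<Rightarrow> complex. (\<sigma> 1 = 1 \<and> (\<forall>x\<in>K. \<forall>y\<in>K. \<sigma> (x + y) = \<sigma> x + \<sigma> y \<and> \<sigma> (x * y) = \<sigma> x * \<sigma> y))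
        \<longrightarrow> \<sigma> ` K = K)
   \<and> (\<forall>\<sigma>\<in>field_auts K. \<forall>\<tau>\<in>field_auts K. \<forall>x\<in>K. \<sigma> (\<tau> x) = \<tau> (\<sigma> x))"

end

theory Submission
  imports Defs "Jordan_Normal_Form.Char_Poly" "HOL-Analysis.Kronecker_Approximation_Theorem"
    "HOL-Computational_Algebra.Nth_Powers"
begin

text \<open>Let \<open>\<sigma>\<close> generate the Galois group of \<open>k/\<rat>(\<i>)\<close>. Every ideal \<open>I\<close> of \<open>k\<close> satisfies
  \<open>I \<sigma>(I) = (g)\<close> with \<open>g \<in> \<int>[\<i>]\<close>.

  (1) If \<open>I\<close> becomes \<open>(\<beta>)\<close> in \<open>K\<close>, then \<open>I = a \<sigma>(I)\<close> for \<open>a = N\<^bsub>K/k\<^esub>(\<beta>) / g\<close>, and \<open>a \<sigma>(a)\<close> is a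
  power of \<open>\<i>\<close>. If it is \<open>\<plusminus>1\<close>, Hilbert 90 gives an invariant ideal in the class of \<open>I\<close>. For
  \<open>p\<^sub>1 \<noteq> p\<^sub>2\<close>, ramification and commutativity of the Galois group force \<open>K = k(\<surd>m)\<close> with
  \<open>m \<in> {p\<^sub>1, p\<^sub>2, p\<^sub>1p\<^sub>2}\<close>; then \<open>a \<sigma>(a)\<close> is the norm to \<open>\<rat>(\<i>)\<close> of the unit
  \<open>N\<^bsub>K/L\<^esub>(\<beta>) / g\<close> of \<open>L = \<rat>(\<i>, \<surd>m)\<close>, and no such unit has norm \<open>\<plusminus>\<i>\<close>. For \<open>p\<^sub>1 = p\<^sub>2\<close> the field
  \<open>k\<close> contains a primitive 8th root of unity, whose norm is \<open>\<plusminus>\<i>\<close>, so \<open>a\<close> can be adjusted.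

  (2) An ambiguous ideal satisfies \<open>I\<^sup>2 = (g)\<close> with \<open>g\<close> a square times a divisor of a power of
  \<open>2 p\<^sub>1 p\<^sub>2\<close>. Each Gaussian prime over \<open>2\<close>, \<open>p\<^sub>1\<close>, \<open>p\<^sub>2\<close> is a unit times a square in the genus field:
  \<open>(1 + \<zeta>\<^sub>8)\<^sup>2 = (1 + \<i>)(1 + \<surd>2)\<close>, and if \<open>T\<^sup>2 + 1 = p U\<^sup>2\<close> and \<open>\<epsilon> = T + U\<surd>p\<close>, then
  \<open>((1 + \<i>\<epsilon>) / (1 + \<i>))\<^sup>2 = \<i>\<epsilon>(T - \<i>)\<close>, where \<open>T - \<i>\<close> is a Gaussian prime over \<open>p\<close> times a
  square.\<close>

section \<open>Algebraic integers\<close>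

hide_const (open) Finite_Cartesian_Product.mat Finite_Cartesian_Product.vec
no_notation Finite_Cartesian_Product.vec_nth (infixl "$" 90)

text \<open>The obstacle in (1) is the power of \<i> left over as a \<sigma>(a). A Gaussian unit
  multiplied into a changes this norm only by a square, so the value -1 can be repaired over any k,
  while \<plusminus>\<i> must either be excluded by the arithmetic of K or be compensated by a unit
  of k with such a norm. The case of equal primes is a genuine exception: there D = 2 p1^2 is not
  exactly divisible by p1, which is what rules out K cyclic over the Gaussian field.

  Ramification is analysed at odd primes only. The prime 2 is avoided because k(sqrt n) =
  k(sqrt(D/n)) and one of n, D/n is odd; every divisor of p1 p2 is 1 mod 4, the congruence on which
  the unit argument rests.

  Neither unique factorisation of ideals nor the group axioms of the class group are established.
  The element g with I \<sigma>(I) = (g) replaces inverse ideals, cancellation modulo Q^2 replaces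
  localisation at Q, and for the generated subgroup products of classes and inverses of involutions
  suffice.\<close>

lemma alg_integer_iff: "alg_integer x \<longleftrightarrow> algebraic_int x"
  unfolding alg_integer_def algebraic_int_altdef_ipoly by blast

definition int_span :: "complex set \<Rightarrow> complex set" where
  "int_span B = {(\<Sum>b\<in>B. of_int (c b) * b) | c :: complex \<Rightarrow> int. True}"

lemma int_spanI: "x = (\<Sum>b\<in>B. of_int (c b) * b) \<Longrightarrow> x \<in> int_span B"
  unfolding int_span_def by blast

lemma int_span_add:
  assumes "x \<in> int_span B" "y \<in> int_span B" shows "x + y \<in> int_span B"
proof -
  obtain c d where "x = (\<Sum>b\<in>B. of_int (c b) * b)" "y = (\<Sum>b\<in>B. of_int (d b) * b)"
    using assms unfolding int_span_def by auto
  then have "x + y = (\<Sum>b\<in>B. of_int ((\<lambda>b. c b + d b) b) * b)"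
    by (simp add: sum.distrib distrib_right)
  then show ?thesis by (rule int_spanI)
qed

lemma int_span_scale:
  assumes "x \<in> int_span B" shows "of_int n * x \<in> int_span B"
proof -
  obtain c where "x = (\<Sum>b\<in>B. of_int (c b) * b)"
    using assms unfolding int_span_def by auto
  then have "of_int n * x = (\<Sum>b\<in>B. of_int ((\<lambda>b. n * c b) b) * b)"
    by (simp add: sum_distrib_left mult.assoc)
  then show ?thesis by (rule int_spanI)
qed

lemma int_span_base:
  assumes "finite B" "x \<in> B" shows "x \<in> int_span B"
proof -
  define c :: "complex \<Rightarrow> int" where "c = (\<lambda>b. if b = x then 1 else 0)"
  have "(\<Sum>b\<in>B. of_int (c b) * b) = (\<Sum>b\<in>B. if b = x then b else 0)"
    by (rule sum.cong) (simp_all add: c_def)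
  also have "\<dots> = x" using assms by simp
  finally show ?thesis unfolding int_span_def by blast
qed

lemma int_span_sum:
  assumes "finite A" "\<And>a. a \<in> A \<Longrightarrow> f a \<in> int_span B"
  shows "(\<Sum>a\<in>A. of_int (c a) * f a) \<in> int_span B"
  using assms
proof (induction A rule: finite_induct)
  case empty
  have "0 \<in> int_span B" unfolding int_span_def by (rule CollectI, rule exI[of _ "\<lambda>_. 0"]) simp
  then show ?case by simp
next
  case (insert x F)
  then show ?case by (simp add: int_span_add int_span_scale)
qed

lemma int_span_closed:
  assumes "finite B" "\<And>b. b \<in> B \<Longrightarrow> z * b \<in> int_span B" "x \<in> int_span B"
  shows "z * x \<in> int_span B"
proof -
  obtain c where "x = (\<Sum>b\<in>B. of_int (c b) * b)"
    using assms unfolding int_span_def by auto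
  then have "z * x = (\<Sum>b\<in>B. of_int (c b) * (z * b))"
    by (simp add: sum_distrib_left mult_ac)
  then show ?thesis using int_span_sum[OF assms(1), of "\<lambda>b. z * b" B c] assms(2) by simp
qed

text \<open>The determinant trick: multiplication by \<open>z\<close> is given by an integer matrix, whose
  characteristic polynomial annihilates \<open>z\<close>.\<close>

lemma algebraic_int_if_int_span_stable:
  assumes fin: "finite B" and nz: "b0 \<in> B" "b0 \<noteq> 0"
    and st: "\<And>b. b \<in> B \<Longrightarrow> z * b \<in> int_span B"
  shows "algebraic_int z"
proof -
  define n where "n = card B"
  obtain e where e: "bij_betw e {0..<n} B"
    using ex_bij_betw_nat_finite[OF fin] unfolding n_def by blast
  have "\<forall>b\<in>B. \<exists>c :: complex \<Rightarrow> int. z * b = (\<Sum>b'\<in>B. of_int (c b') * b')"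
    using st unfolding int_span_def by blast
  then obtain C :: "complex \<Rightarrow> complex \<Rightarrow> int"
    where C: "\<And>b. b \<in> B \<Longrightarrow> z * b = (\<Sum>b'\<in>B. of_int (C b b') * b')"
    by metis
  define A :: "int mat" where "A = mat n n (\<lambda>(i,j). C (e i) (e j))"
  have A: "A \<in> carrier_mat n n" by (simp add: A_def)
  define M :: "complex mat" where "M = map_mat of_int A"
  have M: "M \<in> carrier_mat n n" using A by (simp add: M_def)
  define v where "v = vec n e"
  have v: "v \<in> carrier_vec n" by (simp add: v_def)
  obtain i0 where i0: "i0 < n" "e i0 = b0"
    using e nz(1) unfolding bij_betw_def by (metis atLeastLessThan_iff imageE)
  have vn: "v \<noteq> 0\<^sub>v n"
  proof
    assume "v = 0\<^sub>v n"
    then have "v $ i0 = 0" using i0 by simp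
    then show False using i0 nz by (simp add: v_def)
  qed
  have "M *\<^sub>v v = z \<cdot>\<^sub>v v"
  proof (rule eq_vecI)
    fix i assume "i < dim_vec (z \<cdot>\<^sub>v v)"
    then have i: "i < n" by (simp add: v_def)
    have eB: "e i \<in> B" using e i unfolding bij_betw_def by auto
    have "(M *\<^sub>v v) $ i = (\<Sum>j = 0..<n. of_int (C (e i) (e j)) * e j)"
      using i by (simp add: M_def A_def v_def scalar_prod_def)
    also have "\<dots> = (\<Sum>b'\<in>B. of_int (C (e i) b') * b')"
      by (rule sum.reindex_bij_betw[OF e])
    also have "\<dots> = z * e i" using C[OF eB] by simp
    finally show "(M *\<^sub>v v) $ i = (z \<cdot>\<^sub>v v) $ i" using i by (simp add: v_def)
  qed (use M in \<open>auto simp: v_def\<close>)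
  then have "eigenvalue M z"
    using v vn M unfolding eigenvalue_def eigenvector_def by (auto intro!: exI[of _ v])
  then have "poly (char_poly M) z = 0"
    using eigenvalue_root_char_poly[OF M] by simp
  moreover have "char_poly M = map_poly of_int (char_poly A)"
    unfolding M_def by (rule of_int_hom.char_poly_hom[OF A])
  moreover have "lead_coeff (char_poly A) = 1"
    using degree_monic_char_poly[OF A] by simp
  ultimately show ?thesis unfolding algebraic_int_altdef_ipoly by metis
qed

text \<open>The monic relation expresses x^(degree p) through lower powers, so exponent
  \<open>degree p\<close> is reached although only smaller ones are assumed in \<open>B\<close>. The
  factor y stays fixed, so that the lemma applies to one variable of a monomial in two.\<close>

lemma int_span_power:
  assumes p: "lead_coeff p = 1" "poly (map_poly of_int p) (x::complex) = 0"
    and fin: "finite B"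
    and B: "\<And>i. i < degree p \<Longrightarrow> y * x ^ i \<in> B"
  shows "i \<le> degree p \<Longrightarrow> y * x ^ i \<in> int_span B"
proof (cases "i < degree p")
  case True
  then show ?thesis using B fin int_span_base by blast
next
  case False
  assume "i \<le> degree p"
  then have i: "i = degree p" using False by simp
  have "poly (map_poly of_int p) x = (\<Sum>i\<le>degree p. of_int (coeff p i) * x ^ i)"
    by (subst poly_altdef) (simp add: degree_map_poly coeff_map_poly)
  also have "\<dots> = x ^ degree p + (\<Sum>i<degree p. of_int (coeff p i) * x ^ i)"
    using p(1) by (simp add: lessThan_Suc_atMost[symmetric])
  finally have "x ^ degree p = - (\<Sum>i<degree p. of_int (coeff p i) * x ^ i)"
    using p(2) by (simp add: add_eq_0_iff)
  then have "y * x ^ i = (\<Sum>i<degree p. of_int (- coeff p i) * (y * x ^ i))"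
    by (simp add: i sum_distrib_left sum_negf mult_ac)
  also have "\<dots> \<in> int_span B"
    using B fin by (intro int_span_sum) (auto intro: int_span_base)
  finally show ?thesis .
qed

text \<open>The monomials x^i y^j with exponents below the two degrees generate a module stable
  under x and under y, hence under x + y and x y; the determinant trick then applies.\<close>

lemma algebraic_int_add_mult:
  fixes x y :: complex
  assumes "algebraic_int x" "algebraic_int y"
  shows "algebraic_int (x + y) \<and> algebraic_int (x * y)"
proof -
  obtain p q where p: "poly (map_poly of_int p) x = 0" "lead_coeff p = (1::int)"
    and q: "poly (map_poly of_int q) y = 0" "lead_coeff q = (1::int)"
    using assms unfolding algebraic_int_altdef_ipoly by blast
  \<comment> \<open>Positive degrees put x^0 y^0 = 1 among the monomials, the nonzero element that
    the determinant trick asks for.\<close>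
  have pos: "0 < degree p" "0 < degree q"
  proof -
    have "0 < degree r" if "poly (map_poly of_int r) z = 0" "lead_coeff r = 1" for r and z :: complex
    proof (rule ccontr)
      assume "\<not> 0 < degree r"
      then obtain c where "r = [:c:]" by (auto elim: degree_eq_zeroE)
      then have "r = 1" using that(2) by (simp add: one_pCons)
      then show False using that(1) by simp
    qed
    then show "0 < degree p" "0 < degree q" using p q by auto
  qed
  define B where "B = (\<lambda>(i,j). x ^ i * y ^ j) ` ({..<degree p} \<times> {..<degree q})"
  have fin: "finite B" unfolding B_def by simp
  have one: "1 \<in> B" unfolding B_def using pos by (force intro!: image_eqI[of _ _ "(0,0)"])
  have xs: "x * b \<in> int_span B" if bB: "b \<in> B" for b
  proof -
    obtain i j where ij: "i < degree p" "j < degree q" "b = x ^ i * y ^ j"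
      using bB unfolding B_def by auto
    have "y ^ j * x ^ Suc i \<in> int_span B"
      by (rule int_span_power[OF p(2,1) fin]) (use ij in \<open>auto simp: B_def mult_ac\<close>)
    then show ?thesis using ij by (simp add: mult_ac)
  qed
  have ys: "y * b \<in> int_span B" if bB: "b \<in> B" for b
  proof -
    obtain i j where ij: "i < degree p" "j < degree q" "b = x ^ i * y ^ j"
      using bB unfolding B_def by auto
    have "x ^ i * y ^ Suc j \<in> int_span B"
      by (rule int_span_power[OF q(2,1) fin]) (use ij in \<open>auto simp: B_def\<close>)
    then show ?thesis using ij by (simp add: mult_ac)
  qed
  have "algebraic_int (x + y)"
    by (rule algebraic_int_if_int_span_stable[OF fin one])
       (auto simp: distrib_right intro: int_span_add xs ys)
  moreover have "algebraic_int (x * y)"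
  proof (rule algebraic_int_if_int_span_stable[OF fin one])
    fix b assume "b \<in> B"
    then have "x * (y * b) \<in> int_span B"
      using int_span_closed[OF fin xs ys] by blast
    then show "x * y * b \<in> int_span B" by (simp add: mult.assoc)
  qed simp
  ultimately show ?thesis by blast
qed

lemmas alg_int_add = algebraic_int_add_mult[THEN conjunct1]
lemmas alg_int_mult = algebraic_int_add_mult[THEN conjunct2]

lemma alg_int_diff: "algebraic_int x \<Longrightarrow> algebraic_int y \<Longrightarrow> algebraic_int (x - y)" for x y :: complex
  using alg_int_add[of x "- y"] by simp

lemma alg_int_sqrt:
  assumes "algebraic_int (x^2)" shows "algebraic_int (x :: complex)"
proof -
  have "algebraic_int y" if "y ^ 2 = x ^ 2" for y
    using algebraic_int_root[of "x^2" "monom 1 2" y] assms that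
    by (auto simp: poly_monom degree_monom_eq)
  then show ?thesis by blast
qed

section \<open>Fields and embeddings\<close>

lemma nf_subfieldD:
  assumes "nf_subfield F"
  shows "0 \<in> F" "1 \<in> F" "x \<in> F \<Longrightarrow> y \<in> F \<Longrightarrow> x + y \<in> F" "x \<in> F \<Longrightarrow> y \<in> F \<Longrightarrow> x * y \<in> F"
    "x \<in> F \<Longrightarrow> - x \<in> F" "x \<in> F \<Longrightarrow> inverse x \<in> F" "x \<in> F \<Longrightarrow> y \<in> F \<Longrightarrow> x - y \<in> F"
    "x \<in> F \<Longrightarrow> y \<in> F \<Longrightarrow> x / y \<in> F"
  using assms unfolding nf_subfield_def diff_conv_add_uminus divide_inverse by blast+

lemma nf_subfield_of_nat: "nf_subfield F \<Longrightarrow> of_nat n \<in> F"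
  by (induction n) (auto intro: nf_subfieldD)

lemma nf_subfield_of_int: "nf_subfield F \<Longrightarrow> of_int n \<in> F"
  by (cases n rule: int_cases2) (auto intro: nf_subfieldD nf_subfield_of_nat)

lemma nf_subfield_numeral: "nf_subfield F \<Longrightarrow> numeral n \<in> F"
  using nf_subfield_of_nat[of F "numeral n"] by simp

lemma nf_subfield_power: "nf_subfield F \<Longrightarrow> x \<in> F \<Longrightarrow> x ^ n \<in> F"
  by (induction n) (auto intro: nf_subfieldD)

lemmas nfs = nf_subfieldD nf_subfield_of_nat nf_subfield_of_int nf_subfield_numeral nf_subfield_power

text \<open>Matches the condition on embeddings in \<open>abelian_over_Q\<close>: t is a total
  function constrained on F only, and t 1 = 1 excludes the zero map.\<close>

definition fhom :: "complex set \<Rightarrow> (complex \<Rightarrow> complex) \<Rightarrow> bool" where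
  "fhom F t \<longleftrightarrow> t 1 = 1 \<and> (\<forall>x\<in>F. \<forall>y\<in>F. t (x + y) = t x + t y \<and> t (x * y) = t x * t y)"

lemma fhom_cnj: "fhom F cnj" by (simp add: fhom_def)

lemma fhom_id: "fhom F (\<lambda>x. x)" by (simp add: fhom_def)

locale fhom_on =
  fixes F t assumes F: "nf_subfield F" and hom: "fhom F t"
begin

lemma one: "t 1 = 1" using hom by (simp add: fhom_def)
lemma add: "x \<in> F \<Longrightarrow> y \<in> F \<Longrightarrow> t (x + y) = t x + t y" using hom by (simp add: fhom_def)
lemma mult: "x \<in> F \<Longrightarrow> y \<in> F \<Longrightarrow> t (x * y) = t x * t y" using hom by (simp add: fhom_def)
lemma zero: "t 0 = 0" using add[of 0 0] F nfs by simp
lemma minus: "x \<in> F \<Longrightarrow> t (- x) = - t x"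
  using add[of x "-x"] nfs(5)[OF F] zero by (simp add: eq_neg_iff_add_eq_0 add.commute)
lemma diff: "x \<in> F \<Longrightarrow> y \<in> F \<Longrightarrow> t (x - y) = t x - t y"
  using add[of x "-y"] nfs(5)[OF F] minus by simp
lemma inv: "x \<in> F \<Longrightarrow> t (inverse x) = inverse (t x)"
proof (cases "x = 0")
  case False
  assume "x \<in> F"
  then have "t x * t (inverse x) = 1" using mult[of x "inverse x"] one False F nfs by simp
  then show ?thesis by (metis inverse_unique)
qed (simp add: zero)
lemma divide: "x \<in> F \<Longrightarrow> y \<in> F \<Longrightarrow> t (x / y) = t x / t y"
  using mult[of x "inverse y"] inv nfs(6)[OF F] by (simp add: divide_inverse)
lemma eq0: "x \<in> F \<Longrightarrow> t x = 0 \<longleftrightarrow> x = 0"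
proof
  assume x: "x \<in> F" "t x = 0"
  show "x = 0"
  proof (rule ccontr)
    assume "x \<noteq> 0"
    then have "t 1 = t x * t (inverse x)" using x mult[of x "inverse x"] nfs(6)[OF F] by simp
    then show False using one x by simp
  qed
qed (simp add: zero)
lemma inj: "x \<in> F \<Longrightarrow> y \<in> F \<Longrightarrow> t x = t y \<Longrightarrow> x = y"
  using eq0[of "x - y"] diff nfs(7)[OF F] by simp
lemma of_nat: "t (of_nat n) = of_nat n"
  by (induction n) (auto simp: zero one add F nfs)
lemma of_int: "t (of_int n) = of_int n"
  by (cases n rule: int_cases2) (auto simp: of_nat minus F nfs)
lemma numeral: "t (numeral n) = numeral n" using of_nat[of "numeral n"] by simp
lemma power: "x \<in> F \<Longrightarrow> t (x ^ n) = t x ^ n"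
  by (induction n) (auto simp: one mult F nfs)
lemma poly: "x \<in> F \<Longrightarrow> t (poly (map_poly of_int p) x) = poly (map_poly of_int p) (t x)"
proof (induction p)
  case (pCons a p)
  have "poly (map_poly of_int q) x \<in> F" for q
    using pCons.prems F by (induction q) (auto simp: map_poly_pCons nfs)
  then show ?case using pCons F by (simp add: map_poly_pCons add mult of_int nfs)
qed (simp add: zero)
lemma alg_int: "x \<in> F \<Longrightarrow> algebraic_int x \<Longrightarrow> algebraic_int (t x)"
  unfolding algebraic_int_altdef_ipoly using poly zero by metis

end

section \<open>Adjoining a square root: extension of embeddings, conjugation, Hilbert 90\<close>

definition adj :: "complex set \<Rightarrow> complex \<Rightarrow> complex set" where
  "adj F a = {u + v * a | u v. u \<in> F \<and> v \<in> F}"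

lemma adjI: "u \<in> F \<Longrightarrow> v \<in> F \<Longrightarrow> u + v * a \<in> adj F a" unfolding adj_def by blast
lemma adjE: "x \<in> adj F a \<Longrightarrow> (\<And>u v. u \<in> F \<Longrightarrow> v \<in> F \<Longrightarrow> x = u + v * a \<Longrightarrow> P) \<Longrightarrow> P"
  unfolding adj_def by blast

lemma adj_base: "nf_subfield F \<Longrightarrow> F \<subseteq> adj F a"
  using adjI[of _ F 0 a] by (auto simp: nfs)

lemma adj_gen: "nf_subfield F \<Longrightarrow> a \<in> adj F a"
  using adjI[of 0 F 1 a] by (auto simp: nfs)

lemma adj_subset: "nf_subfield E \<Longrightarrow> F \<subseteq> E \<Longrightarrow> a \<in> E \<Longrightarrow> adj F a \<subseteq> E"
  unfolding adj_def by (auto intro!: nfs)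

lemma adj_unique:
  assumes "nf_subfield F" "a \<notin> F" "u \<in> F" "v \<in> F" "u' \<in> F" "v' \<in> F" "u + v * a = u' + v' * a"
  shows "u = u' \<and> v = v'"
proof (cases "v = v'")
  case False
  have "(v - v') * a = u' - u" using assms(7) by (simp add: algebra_simps)
  then have "a = (u' - u) / (v - v')" using False by (simp add: field_simps)
  then have "a \<in> F" using assms by (metis nfs(7,8))
  then show ?thesis using assms by blast
qed (use assms in auto)

lemma adj_subfield:
  assumes F: "nf_subfield F" and a: "a ^ 2 \<in> F"
  shows "nf_subfield (adj F a)"
proof (cases "a \<in> F")
  case True
  then have "adj F a = F" using adj_subset[OF F order_refl] adj_base[OF F] by blast
  then show ?thesis using F by simp
next
  case aF: False
  show ?thesis unfolding nf_subfield_def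
  proof (intro conjI ballI)
    show "0 \<in> adj F a" "1 \<in> adj F a" using adj_base[OF F] F nfs by blast+
    fix x assume "x \<in> adj F a"
    then obtain u v where x: "u \<in> F" "v \<in> F" "x = u + v * a" by (rule adjE)
    have "- x = (- u) + (- v) * a" using x by simp
    then show "- x \<in> adj F a" using adjI x F nfs by metis
    show "inverse x \<in> adj F a"
    proof (cases "x = 0")
      case True then show ?thesis using \<open>0 \<in> adj F a\<close> by simp
    next
      case False
      define n where "n = u ^ 2 - v ^ 2 * a ^ 2"
      have nF: "n \<in> F" unfolding n_def using nfs(4)[OF F nf_subfield_power[OF F x(2), of 2] a]
          nf_subfield_power[OF F x(1), of 2] nfs(7)[OF F] by blast
      have n: "n = x * (u - v * a)" unfolding n_def x by (simp add: algebra_simps power2_eq_square)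
      have "u - v * a \<noteq> 0"
      proof
        assume "u - v * a = 0"
        then have "u + (- v) * a = 0 + 0 * a" by simp
        then have "u = 0 \<and> - v = 0" using adj_unique[OF F aF] x F nfs by metis
        then show False using False x by simp
      qed
      then have "inverse x = (u - v * a) / n" unfolding n using False by (simp add: field_simps)
      also have "\<dots> = u / n + (- v / n) * a" by (simp add: diff_divide_distrib)
      finally show ?thesis using adjI[of "u / n" F "- v / n"] nF x F nfs by metis
    qed
    fix y assume "y \<in> adj F a"
    then obtain u' v' where y: "u' \<in> F" "v' \<in> F" "y = u' + v' * a" by (rule adjE)
    have "x + y = (u + u') + (v + v') * a" using x y by (simp add: algebra_simps)
    then show "x + y \<in> adj F a" using adjI x y F nfs by metis
    have "x * y = (u * u' + v * v' * a ^ 2) + (u * v' + v * u') * a"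
      using x y by (simp add: algebra_simps power2_eq_square)
    moreover have "u * u' + v * v' * a ^ 2 \<in> F" "u * v' + v * u' \<in> F"
      using x y a F by (auto intro!: nfs)
    ultimately show "x * y \<in> adj F a" using adjI by metis
  qed
qed

text \<open>The only relation that a satisfies over F comes from X^2 - a^2, so a may be sent to any
  square root b of s (a^2). The target is the whole of the complex numbers; b need not lie in
  \<open>adj F a\<close>.\<close>

lemma fhom_extend:
  assumes F: "nf_subfield F" and s: "fhom F s" and a: "a ^ 2 \<in> F" "a \<notin> F" and b: "b ^ 2 = s (a ^ 2)"
  obtains t where "fhom (adj F a) t" "\<And>x. x \<in> F \<Longrightarrow> t x = s x" "t a = b"
    "\<And>u v. u \<in> F \<Longrightarrow> v \<in> F \<Longrightarrow> t (u + v * a) = s u + s v * b"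
proof -
  interpret s: fhom_on F s using F s by unfold_locales
  define t where "t x = (THE y. \<exists>u\<in>F. \<exists>v\<in>F. x = u + v * a \<and> y = s u + s v * b)" for x
  have t: "t (u + v * a) = s u + s v * b" if "u \<in> F" "v \<in> F" for u v
    unfolding t_def
  proof (rule the_equality)
    fix y assume "\<exists>u'\<in>F. \<exists>v'\<in>F. u + v * a = u' + v' * a \<and> y = s u' + s v' * b"
    then show "y = s u + s v * b" using adj_unique[OF F a(2)] that by metis
  qed (use that in blast)
  have base: "t x = s x" if "x \<in> F" for x
    using t[of x 0] that F nfs s.zero by simp
  have "fhom (adj F a) t" unfolding fhom_def
  proof (intro conjI ballI)
    show "t 1 = 1" using base F nfs s.one by simp
    fix x y assume "x \<in> adj F a" "y \<in> adj F a"
    then obtain u v u' v' where x: "u \<in> F" "v \<in> F" "x = u + v * a"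
      and y: "u' \<in> F" "v' \<in> F" "y = u' + v' * a" by (metis adjE)
    have "x + y = (u + u') + (v + v') * a" using x y by (simp add: algebra_simps)
    moreover have "u + u' \<in> F" "v + v' \<in> F" using x y F nfs by auto
    ultimately have "t (x + y) = s (u + u') + s (v + v') * b" using t by simp
    then show "t (x + y) = t x + t y" unfolding x(3) y(3) t[OF x(1,2)] t[OF y(1,2)]
      using x y by (simp add: s.add algebra_simps)
    have "x * y = (u * u' + v * v' * a ^ 2) + (u * v' + v * u') * a"
      using x y by (simp add: algebra_simps power2_eq_square)
    moreover have "u * u' + v * v' * a ^ 2 \<in> F" "u * v' + v * u' \<in> F"
      using x y a F by (auto intro!: nfs)
    ultimately have "t (x * y) = s (u * u' + v * v' * a ^ 2) + s (u * v' + v * u') * b" using t by simp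
    also have "\<dots> = s u * s u' + s v * s v' * b ^ 2 + (s u * s v' + s v * s u') * b"
      using x y a F by (simp add: s.add s.mult nfs b)
    also have "\<dots> = t x * t y" unfolding x(3) y(3) t[OF x(1,2)] t[OF y(1,2)]
      by (simp add: algebra_simps power2_eq_square)
    finally show "t (x * y) = t x * t y" .
  qed
  moreover have "t a = b" using t[of 0 1] F nfs s.zero s.one by simp
  ultimately show ?thesis using that base t by blast
qed

lemma quad_conj:
  assumes F: "nf_subfield F" and a: "a ^ 2 \<in> F" "a \<notin> F"
  obtains t where "fhom (adj F a) t" "\<And>x. x \<in> F \<Longrightarrow> t x = x" "t a = - a"
    "\<And>u v. u \<in> F \<Longrightarrow> v \<in> F \<Longrightarrow> t (u + v * a) = u - v * a"
    "\<And>x. x \<in> adj F a \<Longrightarrow> t x \<in> adj F a"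
    "\<And>x. x \<in> adj F a \<Longrightarrow> t (t x) = x"
proof -
  obtain t where t: "fhom (adj F a) t" "\<And>x. x \<in> F \<Longrightarrow> t x = x" "t a = - a"
    and t2: "\<And>u v. u \<in> F \<Longrightarrow> v \<in> F \<Longrightarrow> t (u + v * a) = u + v * (- a)"
    using fhom_extend[OF F fhom_id a, of "- a"] by auto
  have "t x \<in> adj F a \<and> t (t x) = x" if xA: "x \<in> adj F a" for x
  proof -
    obtain u v where x: "u \<in> F" "v \<in> F" "x = u + v * a" using adjE[OF xA] by blast
    then have "t x = u + (- v) * a" using t2 by simp
    then show ?thesis using x adjI[of u F "- v" a] t2[of u "- v"] F nfs(5) by simp
  qed
  then show ?thesis using that t t2 by simp
qed

lemma quad_ext_complete_square:
  assumes F: "nf_subfield F" and K: "nf_subfield K" "F \<subseteq> K" "\<alpha> \<in> K" "\<alpha> \<notin> F"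
    "K = {a + b * \<alpha> | a b. a \<in> F \<and> b \<in> F}"
  obtains \<theta> where "\<theta> \<notin> F" "\<theta> ^ 2 \<in> F" "K = adj F \<theta>"
proof -
  have "\<alpha> ^ 2 \<in> K" using K(1,3) by (rule nf_subfield_power)
  then obtain B A where AB: "\<alpha> ^ 2 = B + A * \<alpha>" "A \<in> F" "B \<in> F" using K(5) by auto
  \<comment> \<open>\<alpha> is a root of X^2 - A X - B, so this is 2 \<alpha> minus its trace, a
    square root of the discriminant.\<close>
  define \<theta> where "\<theta> = 2 * \<alpha> - A"
  have "\<theta> ^ 2 = 4 * \<alpha> ^ 2 - 4 * A * \<alpha> + A ^ 2"
    by (simp add: \<theta>_def power2_eq_square algebra_simps)
  then have sq: "\<theta> ^ 2 = 4 * B + A ^ 2" using AB by (simp add: algebra_simps)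
  have al: "\<alpha> = (\<theta> + A) / 2" by (simp add: \<theta>_def)
  have "\<theta> \<notin> F"
  proof
    assume "\<theta> \<in> F"
    then have "\<alpha> \<in> F" unfolding al using AB F by (intro nfs) auto
    then show False using K by simp
  qed
  moreover have t2: "\<theta> ^ 2 \<in> F" unfolding sq using AB F by (auto intro!: nfs)
  moreover have "K = adj F \<theta>"
  proof
    have "A \<in> K" using AB K(2) by blast
    then have "\<theta> \<in> K" unfolding \<theta>_def using nfs(7)[OF K(1) nfs(4)[OF K(1) nf_subfield_numeral[OF K(1)] K(3)]] by blast
    then show "adj F \<theta> \<subseteq> K" using adj_subset K by blast
    have A: "nf_subfield (adj F \<theta>)" using adj_subfield F t2 by blast
    have FA: "F \<subseteq> adj F \<theta>" using adj_base F by blast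
    have "\<alpha> \<in> adj F \<theta>" unfolding al using A FA AB adj_gen[OF F] by (intro nfs) auto
    then show "K \<subseteq> adj F \<theta>" using adj_subset[OF A FA, of \<alpha>] K(5) unfolding adj_def[of F \<alpha>] by simp
  qed
  ultimately show ?thesis using that by blast
qed

text \<open>The resolvent 1 + r works because r t(1 + r) = r + 1. It vanishes only for r = -1, where
  a itself serves since t a = - a.\<close>

lemma quad_hilbert90:
  assumes F: "nf_subfield F" and a: "a ^ 2 \<in> F" "a \<notin> F"
    and t: "fhom (adj F a) t" "\<And>x. x \<in> adj F a \<Longrightarrow> t (t x) = x" "t a = - a"
    and r: "r \<in> adj F a" "r * t r = 1"
  obtains x where "x \<in> adj F a" "x \<noteq> 0" "r * t x = x"
proof (cases "r = -1")
  case True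
  have "a \<noteq> 0" using a F nfs by blast
  then show ?thesis using that[of a] t adj_gen[OF F, of a] True by simp
next
  case False
  have A: "nf_subfield (adj F a)" using adj_subfield[OF F a(1)] .
  interpret A: fhom_on "adj F a" t using A t(1) by unfold_locales
  have A1: "1 \<in> adj F a" "1 + r \<in> adj F a" using r A by (auto intro!: nfs)
  moreover have "1 + r \<noteq> 0" using False by (simp add: add_eq_0_iff)
  moreover have "r * t (1 + r) = 1 + r"
    using r(2) A.add[OF A1(1) r(1)] A.one by (simp add: algebra_simps)
  ultimately show ?thesis using that by blast
qed

section \<open>Gaussian integers\<close>

definition QI :: "complex set" where "QI = {z. Re z \<in> \<rat> \<and> Im z \<in> \<rat>}"
definition ZI :: "complex set" where "ZI = {z. Re z \<in> \<int> \<and> Im z \<in> \<int>}"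

lemma QI_subfield: "nf_subfield QI"
  unfolding nf_subfield_def QI_def by (auto simp: Re_divide Im_divide inverse_complex.sel)

lemma QI_rat: "x \<in> \<rat> \<Longrightarrow> of_real x \<in> QI" by (simp add: QI_def)
lemma QI_ii: "\<i> \<in> QI" by (simp add: QI_def)
lemma QI_cnj: "x \<in> QI \<Longrightarrow> cnj x \<in> QI" by (simp add: QI_def)

lemma gen_field_subfield: "nf_subfield (gen_field S)"
  unfolding gen_field_def nf_subfield_def by (auto simp: nf_subfield_def)

lemma gen_field_base: "S \<subseteq> gen_field S" unfolding gen_field_def by blast

lemma gen_field_ii: "gen_field {\<i>} = QI"
proof
  show "gen_field {\<i>} \<subseteq> QI" unfolding gen_field_def using QI_subfield QI_ii by blast
  show "QI \<subseteq> gen_field {\<i>}" unfolding gen_field_def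
  proof safe
    fix z F assume z: "z \<in> QI" and F: "nf_subfield F" "{\<i>} \<subseteq> F"
    have re: "complex_of_real r \<in> F" if rQ: "r \<in> \<rat>" for r
    proof -
      obtain a b where "r = of_int a / of_int b" using rQ by (auto elim!: Rats_cases')
      then show ?thesis using F by (auto intro!: nfs)
    qed
    have "z = of_real (Re z) + \<i> * of_real (Im z)" by (simp add: complex_eq_iff)
    moreover have "\<dots> \<in> F" using re[of "Re z"] re[of "Im z"] z F unfolding QI_def by (auto intro!: nfs)
    ultimately show "z \<in> F" by simp
  qed
qed

lemma gen_field_sqrt_ii:
  assumes "s ^ 2 \<in> QI"
  shows "gen_field {s, \<i>} = adj QI s"
proof
  show "gen_field {s, \<i>} \<subseteq> adj QI s" unfolding gen_field_def
    using adj_subfield[OF QI_subfield assms] adj_gen[OF QI_subfield, of s] adj_base[OF QI_subfield, of s] QI_ii by blast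
  have "QI \<subseteq> gen_field {s, \<i>}" unfolding gen_field_ii[symmetric] gen_field_def by blast
  then show "adj QI s \<subseteq> gen_field {s, \<i>}" using adj_subset[OF gen_field_subfield] gen_field_base[of "{s, \<i>}"] by blast
qed

lemma ZI_ring: "0 \<in> ZI" "1 \<in> ZI" "x \<in> ZI \<Longrightarrow> y \<in> ZI \<Longrightarrow> x + y \<in> ZI" "x \<in> ZI \<Longrightarrow> y \<in> ZI \<Longrightarrow> x * y \<in> ZI"
  "x \<in> ZI \<Longrightarrow> - x \<in> ZI" "x \<in> ZI \<Longrightarrow> y \<in> ZI \<Longrightarrow> x - y \<in> ZI" "of_int n \<in> ZI" "of_nat m \<in> ZI" "numeral k \<in> ZI"
  "\<i> \<in> ZI" "x \<in> ZI \<Longrightarrow> cnj x \<in> ZI"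
  by (auto simp: ZI_def)

lemma ZI_power: "x \<in> ZI \<Longrightarrow> x ^ n \<in> ZI"
  by (induction n) (auto intro: ZI_ring)

lemmas zis = ZI_ring ZI_power

lemma ZI_QI: "ZI \<subseteq> QI" unfolding ZI_def QI_def using Ints_subset_Rats by blast

lemma ZI_alg_int: assumes "x \<in> ZI" shows "algebraic_int x"
proof -
  obtain m n where "Re x = of_int m" "Im x = of_int n" using assms unfolding ZI_def Ints_def by auto
  then have "x = of_int m + \<i> * of_int n" by (simp add: complex_eq_iff)
  moreover have "algebraic_int (of_int j :: complex)" for j by (rule int_imp_algebraic_int) simp
  ultimately show ?thesis using alg_int_add alg_int_mult algebraic_int_ii by blast
qed

lemma int_square_mod_4: "(a::int)^2 mod 4 = (if even a then 0 else 1)"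
proof (cases "even a")
  case True
  then obtain c where "a = 2 * c" by blast
  then have "a^2 = 4 * c^2" by (simp add: power2_eq_square)
  then show ?thesis using True by simp
next
  case False
  then obtain c where "a = 2 * c + 1" by (rule oddE)
  then have "a^2 = 4 * (c^2 + c) + 1" by (simp add: power2_eq_square algebra_simps)
  then show ?thesis using False by presburger
qed

lemma even_if_sum_squares_4:
  fixes a b :: int assumes "4 dvd a ^ 2 + b ^ 2" shows "even a \<and> even b"
  using assms int_square_mod_4[of a] int_square_mod_4[of b] by presburger

text \<open>Twice the real part, twice the imaginary part and the norm are rational algebraic
  integers a, b, n. From a^2 + b^2 = 4 n both a and b are even.\<close>

lemma alg_int_QI: assumes "algebraic_int x" "x \<in> QI" shows "x \<in> ZI"
proof -
  have c: "algebraic_int (cnj x)" using assms by simp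
  have rr: "r \<in> \<int>" if "algebraic_int (complex_of_real r)" "r \<in> \<rat>" for r
    using rational_algebraic_int_is_int[of r] that by simp
  have "x + cnj x = of_real (2 * Re x)" "x * cnj x = of_real (Re x ^ 2 + Im x ^ 2)"
    "\<i> * (cnj x - x) = of_real (2 * Im x)"
    by (auto simp: complex_eq_iff power2_eq_square)
  moreover have "algebraic_int (x + cnj x)" "algebraic_int (x * cnj x)" "algebraic_int (\<i> * (cnj x - x))"
    using assms c by (auto intro!: alg_int_add alg_int_mult alg_int_diff)
  ultimately have "2 * Re x \<in> \<int>" "Re x ^ 2 + Im x ^ 2 \<in> \<int>" "2 * Im x \<in> \<int>"
    using assms(2) rr unfolding QI_def by (metis (no_types, lifting) Rats_add Rats_mult Rats_power Rats_number_of mem_Collect_eq)+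
  then obtain a b n where ab: "2 * Re x = of_int a" "2 * Im x = of_int b" "Re x ^ 2 + Im x ^ 2 = of_int n"
    by (auto elim!: Ints_cases)
  have "(of_int (a ^ 2 + b ^ 2) :: real) = (2 * Re x) ^ 2 + (2 * Im x) ^ 2" unfolding ab by simp
  also have "\<dots> = 4 * (Re x ^ 2 + Im x ^ 2)" by (simp add: power2_eq_square)
  also have "\<dots> = of_int (4 * n)" unfolding ab by simp
  finally have "a ^ 2 + b ^ 2 = 4 * n" unfolding of_int_eq_iff .
  then have "even a \<and> even b" using even_if_sum_squares_4 by (metis dvd_triv_left)
  then obtain a' b' where "a = 2 * a'" "b = 2 * b'" by blast
  then have "Re x = of_int a'" "Im x = of_int b'" using ab by auto
  then show ?thesis by (simp add: ZI_def)
qed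

text \<open>Transitivity of integrality for one quadratic step over the Gaussian integers: the
  integer span of 1, \<i>, x, \<i> x is stable under x.\<close>

lemma alg_int_quadratic:
  assumes "p \<in> ZI" "q \<in> ZI" "x ^ 2 - p * x + q = 0" shows "algebraic_int x"
proof -
  define B where "B = {1, \<i>, x, \<i> * x}"
  have fin: "finite B" by (simp add: B_def)
  have e: "z * b \<in> int_span B" if z: "z \<in> ZI" and b: "b \<in> {1, x}" for z b
  proof -
    obtain m n where "Re z = of_int m" "Im z = of_int n" using z unfolding ZI_def Ints_def by auto
    then have "z = of_int m + \<i> * of_int n" by (simp add: complex_eq_iff)
    then have "z * b = of_int m * b + of_int n * (\<i> * b)" by (simp add: algebra_simps)
    moreover have "b \<in> B" "\<i> * b \<in> B" using b by (auto simp: B_def)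
    ultimately show ?thesis
      using int_span_add int_span_scale int_span_base[OF fin] by metis
  qed
  have sq: "x * x = p * x + (- q) * 1" using assms(3) by (simp add: power2_eq_square algebra_simps)
  have "x * b \<in> int_span B" if "b \<in> B" for b
  proof -
    have x1: "x * 1 \<in> int_span B" "x * \<i> \<in> int_span B" using e[of 1 x] e[of \<i> x] zis by (auto simp: mult.commute)
    have xx: "x * x \<in> int_span B" unfolding sq
      using assms zis by (intro int_span_add e) auto
    have "x * (\<i> * x) = \<i> * (x * x)" by simp
    also have "\<dots> = (\<i> * p) * x + (- \<i> * q) * 1" unfolding sq by (simp add: algebra_simps)
    finally have iq: "x * (\<i> * x) = (\<i> * p) * x + (- \<i> * q) * 1" .
    have ix: "x * (\<i> * x) \<in> int_span B" unfolding iq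
      using assms zis by (intro int_span_add e) auto
    from x1 xx ix show ?thesis using that unfolding B_def by blast
  qed
  then show ?thesis by (intro algebraic_int_if_int_span_stable[OF fin, of 1]) (auto simp: B_def)
qed

lemma ZI_norm_int: "x \<in> ZI \<Longrightarrow> \<exists>n::nat. (cmod x)^2 = of_nat n"
proof -
  assume "x \<in> ZI"
  then obtain m n where "Re x = of_int m" "Im x = of_int n" unfolding ZI_def Ints_def by auto
  then have "(cmod x)^2 = of_nat (nat (m^2 + n^2))" by (simp add: cmod_power2)
  then show ?thesis by blast
qed

text \<open>A natural number, so that elements of least norm exist and divisibility in the naturals
  applies. On \<open>ZI\<close> the squared modulus is already an integer and the floor changes
  nothing.\<close>

definition gnorm :: "complex \<Rightarrow> nat" where "gnorm x = nat \<lfloor>(cmod x)^2\<rfloor>"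

lemma gnorm: "x \<in> ZI \<Longrightarrow> of_nat (gnorm x) = (cmod x)^2"
  using ZI_norm_int unfolding gnorm_def by fastforce

lemma gnorm_cnj: "x \<in> ZI \<Longrightarrow> of_nat (gnorm x) = x * cnj x"
  using gnorm[of x] complex_norm_square[of x] by (metis of_real_of_nat_eq)

lemma gnorm_mult: "x \<in> ZI \<Longrightarrow> y \<in> ZI \<Longrightarrow> gnorm (x * y) = gnorm x * gnorm y"
  using gnorm[of x] gnorm[of y] gnorm[of "x * y"] zis(4)[of x y]
  by (metis norm_mult power_mult_distrib of_nat_mult of_nat_eq_iff)

lemma gnorm_0: "x \<in> ZI \<Longrightarrow> gnorm x = 0 \<longleftrightarrow> x = 0"
  using gnorm[of x] by (metis norm_eq_zero of_nat_eq_0_iff power_eq_0_iff zero_power2 norm_zero)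

text \<open>Euclidean division by rounding both coordinates of the quotient.\<close>
lemma ZI_division:
  assumes "x \<in> ZI" "y \<in> ZI" "y \<noteq> 0"
  obtains q where "q \<in> ZI" "gnorm (x - q * y) < gnorm y"
proof -
  define z where "z = x / y"
  define q where "q = Complex (of_int (round (Re z))) (of_int (round (Im z)))"
  have q: "q \<in> ZI" by (simp add: q_def ZI_def)
  have "\<bar>Re (z - q)\<bar> \<le> 1/2" "\<bar>Im (z - q)\<bar> \<le> 1/2"
    unfolding q_def using of_int_round_abs_le[of "Re z"] of_int_round_abs_le[of "Im z"]
    by (auto simp: abs_minus_commute)
  then have "(Re (z - q))^2 \<le> (1/2)^2" "(Im (z - q))^2 \<le> (1/2)^2"
    by (metis abs_ge_zero power2_abs power_mono)+
  then have "(Re (z - q))^2 + (Im (z - q))^2 < 1" by (simp add: power2_eq_square)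
  then have "(cmod (z - q))^2 < 1" unfolding cmod_power2 .
  moreover have "x - q * y = (z - q) * y" using assms by (simp add: z_def algebra_simps)
  ultimately have "(cmod (x - q * y))^2 < (cmod y)^2"
    using assms by (simp add: norm_mult power_mult_distrib)
  then have "real (gnorm (x - q * y)) < real (gnorm y)"
    using gnorm assms q zis by simp
  then show ?thesis using that q by simp
qed

lemma ZI_principal:
  assumes G: "G \<subseteq> ZI" "0 \<in> G" "\<And>x y. x \<in> G \<Longrightarrow> y \<in> G \<Longrightarrow> x + y \<in> G" "\<And>r x. r \<in> ZI \<Longrightarrow> x \<in> G \<Longrightarrow> r * x \<in> G"
  obtains g where "g \<in> G" "\<And>x. x \<in> G \<Longrightarrow> \<exists>q\<in>ZI. x = q * g"
proof (cases "G = {0}")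
  case True then show ?thesis using that[of 0] zis by auto
next
  case False
  then obtain g0 where "g0 \<in> G - {0}" using G by blast
  then obtain g where g: "g \<in> G - {0}" "\<And>y. y \<in> G - {0} \<Longrightarrow> gnorm g \<le> gnorm y"
    using ex_has_least_nat[of "\<lambda>x. x \<in> G - {0}" g0 gnorm] by blast
  have "\<exists>q\<in>ZI. x = q * g" if x: "x \<in> G" for x
  proof -
    obtain q where q: "q \<in> ZI" "gnorm (x - q * g) < gnorm g"
      using ZI_division[of x g] x g G by blast
    have "(- q) * g \<in> G" using G(4) g q zis(5) by blast
    then have "x + (- q) * g \<in> G" using G(3) x by blast
    then have "x - q * g \<in> G" by simp
    then have "x - q * g = 0" using g(2)[of "x - q * g"] q by force
    then show ?thesis using q by auto
  qed
  then show ?thesis using that g by blast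
qed

lemma ZI_gcd:
  assumes "x \<in> ZI" "y \<in> ZI"
  obtains d u v where "d \<in> ZI" "u \<in> ZI" "v \<in> ZI" "d = u * x + v * y" "\<exists>q\<in>ZI. x = q * d" "\<exists>q\<in>ZI. y = q * d"
proof -
  define G where "G = {u * x + v * y | u v. u \<in> ZI \<and> v \<in> ZI}"
  have GI: "u * x + v * y \<in> G" if "u \<in> ZI" "v \<in> ZI" for u v using that unfolding G_def by blast
  have "\<exists>g. g \<in> G \<and> (\<forall>x. x \<in> G \<longrightarrow> (\<exists>q\<in>ZI. x = q * g))"
  proof (rule ZI_principal[of G])
    show "G \<subseteq> ZI" unfolding G_def using assms by (auto intro!: zis)
    show "0 \<in> G" using GI[of 0 0] zis by simp
    fix a b assume "a \<in> G" "b \<in> G"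
    then obtain u v u' v' where "a = u * x + v * y" "b = u' * x + v' * y" "u \<in> ZI" "v \<in> ZI" "u' \<in> ZI" "v' \<in> ZI"
      unfolding G_def by blast
    then show "a + b \<in> G" using GI[of "u + u'" "v + v'"] zis by (simp add: algebra_simps)
  next
    fix r a assume "r \<in> ZI" "a \<in> G"
    then obtain u v where "a = u * x + v * y" "u \<in> ZI" "v \<in> ZI" unfolding G_def by blast
    then show "r * a \<in> G" using GI[of "r * u" "r * v"] zis \<open>r \<in> ZI\<close> by (simp add: algebra_simps)
  qed blast
  then obtain g where g: "g \<in> G" "\<And>x. x \<in> G \<Longrightarrow> \<exists>q\<in>ZI. x = q * g" by blast
  have "x \<in> G" "y \<in> G" using GI[of 1 0] GI[of 0 1] zis by auto
  then have q: "\<exists>q\<in>ZI. x = q * g" "\<exists>q\<in>ZI. y = q * g" using g(2) by auto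
  obtain u v where uv: "g = u * x + v * y" "u \<in> ZI" "v \<in> ZI" using g(1) unfolding G_def by blast
  then have "g \<in> ZI" using assms by (auto intro!: zis)
  then show ?thesis using that uv q by blast
qed

section \<open>Ideals and ideal classes\<close>

definition subring_C :: "complex set \<Rightarrow> bool" where
  "subring_C R \<longleftrightarrow> 0 \<in> R \<and> 1 \<in> R \<and> (\<forall>x\<in>R. \<forall>y\<in>R. x + y \<in> R \<and> x * y \<in> R) \<and> (\<forall>x\<in>R. - x \<in> R)"

lemma subring_CD:
  assumes "subring_C R"
  shows "0 \<in> R" "1 \<in> R" "x \<in> R \<Longrightarrow> y \<in> R \<Longrightarrow> x + y \<in> R" "x \<in> R \<Longrightarrow> y \<in> R \<Longrightarrow> x * y \<in> R"
    "x \<in> R \<Longrightarrow> - x \<in> R" "x \<in> R \<Longrightarrow> y \<in> R \<Longrightarrow> x - y \<in> R"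
  using assms unfolding subring_C_def diff_conv_add_uminus by blast+

lemma ring_of_integers_iff: "x \<in> ring_of_integers F \<longleftrightarrow> x \<in> F \<and> algebraic_int x"
  by (simp add: ring_of_integers_def alg_integer_iff)

lemma ring_of_integers_subring: "nf_subfield F \<Longrightarrow> subring_C (ring_of_integers F)"
  unfolding subring_C_def
  by (auto simp: ring_of_integers_iff intro!: nfs alg_int_add alg_int_mult)

lemma nf_idealD:
  assumes "nf_ideal R I"
  shows "I \<subseteq> R" "0 \<in> I" "x \<in> I \<Longrightarrow> y \<in> I \<Longrightarrow> x + y \<in> I" "r \<in> R \<Longrightarrow> x \<in> I \<Longrightarrow> r * x \<in> I"
    "r \<in> R \<Longrightarrow> x \<in> I \<Longrightarrow> x * r \<in> I"
  using assms unfolding nf_ideal_def by (auto simp: mult.commute)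

lemma nf_ideal_minus: "subring_C R \<Longrightarrow> nf_ideal R I \<Longrightarrow> x \<in> I \<Longrightarrow> - x \<in> I"
  using nf_idealD(4)[of R I "-1" x] subring_CD[of R] by simp

lemma nf_ideal_diff: "subring_C R \<Longrightarrow> nf_ideal R I \<Longrightarrow> x \<in> I \<Longrightarrow> y \<in> I \<Longrightarrow> x - y \<in> I"
  using nf_idealD(3)[of R I x "-y"] nf_ideal_minus[of R I y] by simp

lemma nf_ideal_R: "subring_C R \<Longrightarrow> nf_ideal R R"
  unfolding nf_ideal_def subring_C_def by blast

lemma nf_ideal_one: "nf_ideal R I \<Longrightarrow> 1 \<in> I \<Longrightarrow> I = R"
  using nf_idealD(1)[of R I] nf_idealD(4)[of R I _ 1] by auto

lemma nf_ideal_prin: "subring_C R \<Longrightarrow> c \<in> R \<Longrightarrow> nf_ideal R ((\<lambda>x. c * x) ` R)"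
  unfolding nf_ideal_def
proof (intro conjI ballI)
  assume R: "subring_C R" "c \<in> R"
  show "(*) c ` R \<subseteq> R" "0 \<in> (*) c ` R" using subring_CD[OF R(1)] R(2) by (auto intro: image_eqI[of _ _ 0])
  fix x assume "x \<in> (*) c ` R"
  then obtain x' where x: "x = c * x'" "x' \<in> R" by blast
  { fix y assume "y \<in> (*) c ` R"
    then obtain y' where y: "y = c * y'" "y' \<in> R" by blast
    show "x + y \<in> (*) c ` R" using x y subring_CD[OF R(1)] by (auto intro!: image_eqI[of _ _ "x' + y'"] simp: algebra_simps) }
  { fix r assume "r \<in> R"
    then show "r * x \<in> (*) c ` R" using x subring_CD[OF R(1)] by (auto intro!: image_eqI[of _ _ "r * x'"]) }
qed

lemma ideal_gen_ideal: "subring_C R \<Longrightarrow> S \<subseteq> R \<Longrightarrow> nf_ideal R (ideal_gen R S)"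
  unfolding ideal_gen_def nf_ideal_def[of R "\<Inter> _"]
  using nf_ideal_R[of R] by (auto simp: nf_idealD)

lemma ideal_gen_base: "S \<subseteq> ideal_gen R S"
  unfolding ideal_gen_def by blast

lemma ideal_gen_least: "nf_ideal R J \<Longrightarrow> S \<subseteq> J \<Longrightarrow> ideal_gen R S \<subseteq> J"
  unfolding ideal_gen_def by blast

text \<open>The elements of R with property P form an ideal containing S. This induction spares
  writing elements of generated ideals as finite sums.\<close>

lemma ideal_gen_induct:
  assumes "x \<in> ideal_gen R S" "S \<subseteq> R" "subring_C R"
    "P 0" "\<And>a. a \<in> S \<Longrightarrow> P a" "\<And>x y. P x \<Longrightarrow> P y \<Longrightarrow> P (x + y)" "\<And>r x. r \<in> R \<Longrightarrow> P x \<Longrightarrow> P (r * x)"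
  shows "P x"
proof -
  have "nf_ideal R {x \<in> R. P x}" unfolding nf_ideal_def
    using assms(4,6,7) subring_CD[OF assms(3)] by simp
  then have "ideal_gen R S \<subseteq> {x \<in> R. P x}" by (rule ideal_gen_least) (use assms(2,5) in blast)
  then show ?thesis using assms(1) by blast
qed

lemma ideal_mult_base: "a \<in> I \<Longrightarrow> b \<in> J \<Longrightarrow> a * b \<in> ideal_mult R I J"
  unfolding ideal_mult_def by (rule subsetD[OF ideal_gen_base]) blast

lemma ideal_mult_subR: "subring_C R \<Longrightarrow> I \<subseteq> R \<Longrightarrow> J \<subseteq> R \<Longrightarrow> {a * b |a b. a \<in> I \<and> b \<in> J} \<subseteq> R"
  by (auto dest: subring_CD(4))

lemma ideal_mult_ideal: "subring_C R \<Longrightarrow> I \<subseteq> R \<Longrightarrow> J \<subseteq> R \<Longrightarrow> nf_ideal R (ideal_mult R I J)"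
  unfolding ideal_mult_def using ideal_gen_ideal ideal_mult_subR by blast

lemma ideal_mult_induct:
  assumes "x \<in> ideal_mult R I J" "I \<subseteq> R" "J \<subseteq> R" "subring_C R"
    "P 0" "\<And>a b. a \<in> I \<Longrightarrow> b \<in> J \<Longrightarrow> P (a * b)" "\<And>x y. P x \<Longrightarrow> P y \<Longrightarrow> P (x + y)"
    "\<And>r x. r \<in> R \<Longrightarrow> P x \<Longrightarrow> P (r * x)"
  shows "P x"
  using assms(1) unfolding ideal_mult_def
  by (rule ideal_gen_induct[of _ _ _ P]) (use assms ideal_mult_subR in auto)

lemma ideal_mult_least:
  assumes "subring_C R" "I \<subseteq> R" "J \<subseteq> R" "nf_ideal R K" "\<And>a b. a \<in> I \<Longrightarrow> b \<in> J \<Longrightarrow> a * b \<in> K"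
  shows "ideal_mult R I J \<subseteq> K"
  using ideal_mult_induct[of _ R I J "\<lambda>x. x \<in> K"] assms nf_idealD[of R K] by blast

lemma ideal_mult_comm: "ideal_mult R I J = ideal_mult R J I"
proof -
  have "{a * b |a b. a \<in> I \<and> b \<in> J} = {a * b |a b. a \<in> J \<and> b \<in> I}" by (metis mult.commute)
  then show ?thesis unfolding ideal_mult_def by simp
qed

lemma ideal_mult_R:
  assumes "subring_C R" "nf_ideal R I" shows "ideal_mult R I R = I"
proof
  show "ideal_mult R I R \<subseteq> I"
    using assms nf_idealD[OF assms(2)] by (intro ideal_mult_least[OF assms(1) _ _ assms(2)]) auto
  show "I \<subseteq> ideal_mult R I R"
    using ideal_mult_base[of _ I 1 R R] subring_CD[OF assms(1)] by auto
qed

lemma ideal_mult_assoc_le: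
  assumes "subring_C R" "I \<subseteq> R" "J \<subseteq> R" "K \<subseteq> R"
  shows "ideal_mult R (ideal_mult R I J) K \<subseteq> ideal_mult R I (ideal_mult R J K)"
proof -
  have JK: "nf_ideal R (ideal_mult R J K)" and IJ: "nf_ideal R (ideal_mult R I J)"
    using assms ideal_mult_ideal by blast+
  have T: "nf_ideal R (ideal_mult R I (ideal_mult R J K))"
    using assms ideal_mult_ideal nf_idealD(1)[OF JK] by blast
  have "x * c \<in> ideal_mult R I (ideal_mult R J K)" if c: "c \<in> K" and x: "x \<in> ideal_mult R I J" for x c
    using x
  proof (rule ideal_mult_induct[where P = "\<lambda>x. x * c \<in> ideal_mult R I (ideal_mult R J K)"])
    fix a b assume "a \<in> I" "b \<in> J"
    then have "a * (b * c) \<in> ideal_mult R I (ideal_mult R J K)" using c ideal_mult_base[of a I] ideal_mult_base[of b J c K R] by simp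
    then show "a * b * c \<in> ideal_mult R I (ideal_mult R J K)" by (simp add: mult.assoc)
  qed (use assms nf_idealD[OF T] in \<open>auto simp: distrib_right mult.assoc\<close>)
  then show ?thesis by (intro ideal_mult_least[OF assms(1) nf_idealD(1)[OF IJ] assms(4) T])
qed

lemma ideal_mult_assoc:
  assumes "subring_C R" "I \<subseteq> R" "J \<subseteq> R" "K \<subseteq> R"
  shows "ideal_mult R (ideal_mult R I J) K = ideal_mult R I (ideal_mult R J K)"
proof
  show "ideal_mult R I (ideal_mult R J K) \<subseteq> ideal_mult R (ideal_mult R I J) K"
    using ideal_mult_assoc_le[OF assms(1,4,3,2)] ideal_mult_comm[of R K J] ideal_mult_comm[of R J I]
      ideal_mult_comm[of R "ideal_mult R J K" I] ideal_mult_comm[of R K "ideal_mult R I J"] by simp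
qed (rule ideal_mult_assoc_le[OF assms])

lemma ideal_mult_nz:
  assumes "subring_C R" "I \<in> nz_ideals R" "J \<in> nz_ideals R"
  shows "ideal_mult R I J \<in> nz_ideals R"
proof -
  have I: "nf_ideal R I" "I \<noteq> {0}" and J: "nf_ideal R J" "J \<noteq> {0}" using assms by (auto simp: nz_ideals_def)
  obtain a b where "a \<in> I" "a \<noteq> 0" "b \<in> J" "b \<noteq> 0" using I J nf_idealD(2) by blast
  then have "a * b \<in> ideal_mult R I J" "a * b \<noteq> 0" using ideal_mult_base by auto
  then have "ideal_mult R I J \<noteq> {0}" by blast
  then show ?thesis using ideal_mult_ideal[OF assms(1)] I J nf_idealD(1) by (simp add: nz_ideals_def)
qed

lemma R_nz: "subring_C R \<Longrightarrow> R \<in> nz_ideals R"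
  using subring_CD(2)[of R] nf_ideal_R[of R] unfolding nz_ideals_def by auto

section \<open>Equivalence of ideals and multiplication of ideal classes\<close>

lemma ideal_equivI:
  assumes "a \<in> R" "a \<noteq> 0" "b \<in> R" "b \<noteq> 0" "(\<lambda>x. a * x) ` I = (\<lambda>x. b * x) ` J"
  shows "ideal_equiv R I J"
  using assms unfolding ideal_equiv_def by blast

lemma ideal_equivE:
  assumes "ideal_equiv R I J"
  obtains a b where "a \<in> R" "a \<noteq> 0" "b \<in> R" "b \<noteq> 0" "(\<lambda>x. a * x) ` I = (\<lambda>x. b * x) ` J"
  using assms unfolding ideal_equiv_def by (elim bexE DiffE) simp

lemma ideal_equiv_refl: "subring_C R \<Longrightarrow> ideal_equiv R I I"
  using ideal_equivI[of 1 R 1 I I] subring_CD(2)[of R] by simp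

lemma ideal_equiv_sym: "ideal_equiv R I J \<Longrightarrow> ideal_equiv R J I"
  unfolding ideal_equiv_def by metis

lemma ideal_equiv_trans:
  assumes R: "subring_C R" and "ideal_equiv R I J" "ideal_equiv R J K" shows "ideal_equiv R I K"
proof -
  obtain a b where a: "a \<in> R" "a \<noteq> 0" "b \<in> R" "b \<noteq> 0" "(\<lambda>x. a * x) ` I = (\<lambda>x. b * x) ` J"
    using assms(2) by (rule ideal_equivE)
  obtain c d where c: "c \<in> R" "c \<noteq> 0" "d \<in> R" "d \<noteq> 0" "(\<lambda>x. c * x) ` J = (\<lambda>x. d * x) ` K"
    using assms(3) by (rule ideal_equivE)
  have "(\<lambda>x. c * a * x) ` I = (\<lambda>x. c * x) ` (\<lambda>x. a * x) ` I" by (simp add: image_image mult.assoc)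
  also have "\<dots> = (\<lambda>x. b * x) ` (\<lambda>x. c * x) ` J" unfolding a(5) by (simp add: image_image mult_ac)
  also have "\<dots> = (\<lambda>x. b * d * x) ` K" unfolding c(5) by (simp add: image_image mult_ac)
  finally show ?thesis using a c subring_CD(4)[OF R] by (intro ideal_equivI[of "c * a" R "b * d"]) auto
qed

lemma ideal_class_eqI:
  "subring_C R \<Longrightarrow> ideal_equiv R I J \<Longrightarrow> ideal_class R I = ideal_class R J"
  unfolding ideal_class_def using ideal_equiv_trans ideal_equiv_sym by blast

lemma ideal_class_eqD:
  "subring_C R \<Longrightarrow> J \<in> nz_ideals R \<Longrightarrow> ideal_class R I = ideal_class R J \<Longrightarrow> ideal_equiv R I J"
  unfolding ideal_class_def using ideal_equiv_refl by blast

text \<open>\<open>class_group\<close> and \<open>ext_class\<close> work on representatives picked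
  by \<open>SOME\<close>; these facts allow the picked ideal to be exchanged for a given
  one.\<close>

lemma some_ideal_class:
  assumes "subring_C R" "I \<in> nz_ideals R"
  shows "(SOME J. J \<in> ideal_class R I) \<in> nz_ideals R" "ideal_equiv R I (SOME J. J \<in> ideal_class R I)"
    "ideal_class R (SOME J. J \<in> ideal_class R I) = ideal_class R I"
proof -
  have "I \<in> ideal_class R I" using assms ideal_equiv_refl by (simp add: ideal_class_def)
  then have "(SOME J. J \<in> ideal_class R I) \<in> ideal_class R I" by (rule someI)
  then show 1: "(SOME J. J \<in> ideal_class R I) \<in> nz_ideals R" "ideal_equiv R I (SOME J. J \<in> ideal_class R I)"
    by (auto simp: ideal_class_def)
  then show "ideal_class R (SOME J. J \<in> ideal_class R I) = ideal_class R I"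
    using ideal_class_eqI[OF assms(1)] by metis
qed

lemma ideal_mult_equiv_le:
  assumes R: "subring_C R" and sub: "I \<subseteq> R" "J \<subseteq> R" "I' \<subseteq> R" "J' \<subseteq> R"
    and 1: "(\<lambda>x. a * x) ` I = (\<lambda>x. b * x) ` I'" and 2: "(\<lambda>x. c * x) ` J = (\<lambda>x. d * x) ` J'"
  shows "(\<lambda>x. a * c * x) ` ideal_mult R I J \<subseteq> (\<lambda>x. b * d * x) ` ideal_mult R I' J'"
proof
  let ?T = "ideal_mult R I' J'"
  have T: "nf_ideal R ?T" using ideal_mult_ideal R sub by blast
  fix y assume "y \<in> (\<lambda>x. a * c * x) ` ideal_mult R I J"
  then obtain x where x: "y = a * c * x" "x \<in> ideal_mult R I J" by blast
  have "\<exists>t\<in>?T. a * c * x = b * d * t"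
    using x(2)
  proof (rule ideal_mult_induct[where P = "\<lambda>x. \<exists>t\<in>?T. a * c * x = b * d * t"])
    show "\<exists>t\<in>?T. a * c * 0 = b * d * t" using nf_idealD(2)[OF T] by (intro bexI[of _ 0]) auto
  next
    fix u v assume "u \<in> I" "v \<in> J"
    then have "a * u \<in> (\<lambda>x. b * x) ` I'" "c * v \<in> (\<lambda>x. d * x) ` J'"
      unfolding 1[symmetric] 2[symmetric] by blast+
    then obtain u' v' where "a * u = b * u'" "u' \<in> I'" "c * v = d * v'" "v' \<in> J'" by blast
    then have "u' * v' \<in> ?T" "(a * u) * (c * v) = (b * u') * (d * v')" using ideal_mult_base by auto
    then show "\<exists>t\<in>?T. a * c * (u * v) = b * d * t" by (intro bexI[of _ "u' * v'"]) (auto simp: mult_ac)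
  next
    fix x y assume "\<exists>t\<in>?T. a * c * x = b * d * t" "\<exists>t\<in>?T. a * c * y = b * d * t"
    then obtain s t where "s \<in> ?T" "t \<in> ?T" "a * c * x = b * d * s" "a * c * y = b * d * t" by blast
    then show "\<exists>t\<in>?T. a * c * (x + y) = b * d * t"
      using nf_idealD(3)[OF T] by (intro bexI[of _ "s + t"]) (auto simp: distrib_left)
  next
    fix r x assume "r \<in> R" "\<exists>t\<in>?T. a * c * x = b * d * t"
    then obtain t where "t \<in> ?T" "a * c * x = b * d * t" by blast
    moreover have "r * t \<in> ?T" using calculation nf_idealD(4)[OF T] \<open>r \<in> R\<close> by blast
    moreover have "a * c * (r * x) = b * d * (r * t)" using calculation(2) by (simp add: mult.left_commute)
    ultimately show "\<exists>t\<in>?T. a * c * (r * x) = b * d * t" by blast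
  qed (use R sub in auto)
  then show "y \<in> (\<lambda>x. b * d * x) ` ?T" using x by blast
qed

lemma ideal_mult_equiv:
  assumes R: "subring_C R" and sub: "I \<subseteq> R" "J \<subseteq> R" "I' \<subseteq> R" "J' \<subseteq> R"
    and "ideal_equiv R I I'" "ideal_equiv R J J'"
  shows "ideal_equiv R (ideal_mult R I J) (ideal_mult R I' J')"
proof -
  obtain a b where a: "a \<in> R" "a \<noteq> 0" "b \<in> R" "b \<noteq> 0" "(\<lambda>x. a * x) ` I = (\<lambda>x. b * x) ` I'"
    using assms(6) by (rule ideal_equivE)
  obtain c d where c: "c \<in> R" "c \<noteq> 0" "d \<in> R" "d \<noteq> 0" "(\<lambda>x. c * x) ` J = (\<lambda>x. d * x) ` J'"
    using assms(7) by (rule ideal_equivE)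
  then have "(\<lambda>x. a * c * x) ` ideal_mult R I J = (\<lambda>x. b * d * x) ` ideal_mult R I' J'"
    using ideal_mult_equiv_le[OF R sub a(5) c(5)]
      ideal_mult_equiv_le[OF R sub(3,4,1,2) a(5)[symmetric] c(5)[symmetric]] by blast
  then show ?thesis using a c subring_CD(4)[OF R] by (intro ideal_equivI[of "a * c" R "b * d"]) auto
qed

lemma class_group_mult:
  assumes R: "subring_C R" and I: "I \<in> nz_ideals R" and J: "J \<in> nz_ideals R"
  shows "ideal_class R I \<otimes>\<^bsub>class_group R\<^esub> ideal_class R J = ideal_class R (ideal_mult R I J)"
proof -
  have "ideal_equiv R (ideal_mult R I J)
      (ideal_mult R (SOME I'. I' \<in> ideal_class R I) (SOME J'. J' \<in> ideal_class R J))"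
    using some_ideal_class[OF R I] some_ideal_class[OF R J] I J
    by (intro ideal_mult_equiv[OF R]) (auto simp: nz_ideals_def dest: nf_idealD(1))
  then show ?thesis unfolding class_group_def using ideal_class_eqI[OF R] by simp
qed

lemma ideal_equiv_R_iff:
  assumes R: "subring_C R" and I: "nf_ideal R I"
  shows "ideal_equiv R I R \<longleftrightarrow> (\<exists>c\<in>R - {0}. I = (\<lambda>x. c * x) ` R)"
proof
  assume "ideal_equiv R I R"
  then obtain a b where ab: "a \<in> R - {0}" "b \<in> R - {0}" "(\<lambda>x. a * x) ` I = (\<lambda>x. b * x) ` R"
    by (auto elim: ideal_equivE)
  \<comment> \<open>The generator is the element i of I that a carries to b; cancelling a from a I =
    a i R gives I = i R.\<close>
  have "b * 1 \<in> (\<lambda>x. b * x) ` R" using subring_CD(2)[OF R] by blast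
  then obtain i where i: "i \<in> I" "b = a * i" using ab(3) by (metis imageE mult.right_neutral)
  have "I = (\<lambda>x. i * x) ` R"
  proof -
    have "(\<lambda>x. a * x) ` I = (\<lambda>x. a * x) ` (\<lambda>x. i * x) ` R"
      unfolding ab(3) i(2) by (simp add: image_image mult.assoc)
    then show ?thesis using ab(1) by (subst (asm) inj_image_eq_iff) (auto intro: injI)
  qed
  then show "\<exists>c\<in>R - {0}. I = (\<lambda>x. c * x) ` R" using i ab(2) nf_idealD(1)[OF I] by auto
next
  assume "\<exists>c\<in>R - {0}. I = (\<lambda>x. c * x) ` R"
  then obtain c where "c \<in> R - {0}" "I = (\<lambda>x. c * x) ` R" by blast
  then show "ideal_equiv R I R" using subring_CD(2)[OF R] by (intro ideal_equivI[of 1 R c]) auto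
qed

lemma ideal_class_one_iff:
  assumes "subring_C R" "nf_ideal R I"
  shows "ideal_class R I = ideal_class R R \<longleftrightarrow> (\<exists>c\<in>R - {0}. I = (\<lambda>x. c * x) ` R)"
  using ideal_equiv_R_iff[OF assms] ideal_class_eqI[OF assms(1)] ideal_class_eqD[OF assms(1) R_nz[OF assms(1)]]
  by blast

text \<open>If \<open>X\<^sup>2 = 1\<close> then the inverse of \<open>X\<close>, defined by \<open>THE\<close>, is \<open>X\<close> itself.\<close>
lemma class_group_inv_involution:
  assumes R: "subring_C R" and I: "I \<in> nz_ideals R"
    and sq: "ideal_class R (ideal_mult R I I) = ideal_class R R"
  shows "inv\<^bsub>class_group R\<^esub> (ideal_class R I) = ideal_class R I"
  unfolding m_inv_def
proof (rule the_equality)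
  note mm = class_group_mult[OF R]
  have one: "\<one>\<^bsub>class_group R\<^esub> = ideal_class R R" by (simp add: class_group_def)
  have sq': "ideal_class R I \<otimes>\<^bsub>class_group R\<^esub> ideal_class R I = ideal_class R R"
    using mm[OF I I] sq by simp
  show "ideal_class R I \<in> carrier (class_group R) \<and>
    ideal_class R I \<otimes>\<^bsub>class_group R\<^esub> ideal_class R I = \<one>\<^bsub>class_group R\<^esub> \<and>
    ideal_class R I \<otimes>\<^bsub>class_group R\<^esub> ideal_class R I = \<one>\<^bsub>class_group R\<^esub>"
    using sq' one I by (auto simp: class_group_def)
  fix Y assume Y: "Y \<in> carrier (class_group R) \<and>
    ideal_class R I \<otimes>\<^bsub>class_group R\<^esub> Y = \<one>\<^bsub>class_group R\<^esub> \<and>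
    Y \<otimes>\<^bsub>class_group R\<^esub> ideal_class R I = \<one>\<^bsub>class_group R\<^esub>"
  then obtain J where J: "J \<in> nz_ideals R" "Y = ideal_class R J" by (auto simp: class_group_def)
  have IR: "I \<subseteq> R" "J \<subseteq> R" "nf_ideal R I" "nf_ideal R J" using I J nf_idealD(1) by (auto simp: nz_ideals_def)
  have "Y = ideal_class R (ideal_mult R J R)" using ideal_mult_R[OF R IR(4)] J by simp
  also have "\<dots> = ideal_class R J \<otimes>\<^bsub>class_group R\<^esub> ideal_class R (ideal_mult R I I)"
    using mm[OF J(1) R_nz[OF R]] sq by simp
  also have "\<dots> = ideal_class R (ideal_mult R (ideal_mult R J I) I)"
    using mm[OF J(1) ideal_mult_nz[OF R I I]] ideal_mult_assoc[OF R] IR by simp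
  also have "\<dots> = ideal_class R (ideal_mult R J I) \<otimes>\<^bsub>class_group R\<^esub> ideal_class R I"
    using mm[OF ideal_mult_nz[OF R J(1) I] I] by simp
  also have "\<dots> = ideal_class R R \<otimes>\<^bsub>class_group R\<^esub> ideal_class R I"
    using Y J mm[OF J(1) I] one by simp
  also have "\<dots> = ideal_class R I"
    using mm[OF R_nz[OF R] I] ideal_mult_comm[of R R I] ideal_mult_R[OF R IR(3)] by simp
  finally show "Y = ideal_class R I" .
qed

section \<open>Quadratic extensions of the Gaussian field: content, ambiguous ideals, capitulating
  ideals\<close>

lemma ZI_unit:
  assumes "u \<in> ZI" "1 / u \<in> ZI" "u \<noteq> 0" shows "u \<in> {1, -1, \<i>, -\<i>}"
proof -
  have "gnorm u * gnorm (1 / u) = gnorm 1" using gnorm_mult[OF assms(1,2)] assms(3) by simp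
  moreover have "gnorm 1 = 1" by (simp add: gnorm_def)
  ultimately have "gnorm u = 1" by simp
  then have n: "(cmod u)^2 = 1" using gnorm[OF assms(1)] by simp
  obtain m n where mn: "Re u = of_int m" "Im u = of_int n" using assms(1) unfolding ZI_def Ints_def by auto
  have "(of_int (m^2 + n^2) :: real) = of_int 1" using n mn by (simp add: cmod_power2)
  then have "m^2 + n^2 = 1" unfolding of_int_eq_iff .
  moreover have "m^2 \<ge> 0" "n^2 \<ge> 0" by simp_all
  ultimately have "m^2 = 0 \<and> n^2 = 1 \<or> m^2 = 1 \<and> n^2 = 0" by linarith
  then have "m = 0 \<and> (n = 1 \<or> n = -1) \<or> n = 0 \<and> (m = 1 \<or> m = -1)" by (auto simp: power2_eq_1_iff)
  then show ?thesis using mn by (auto simp: complex_eq_iff)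
qed

text \<open>Interpreted twice: for k itself, and for the subfield generated by \<i> and sqrt m
  inside K when relative norms of units are studied. D may contain squares, which covers k with
  equal primes.\<close>

locale gquad =
  fixes D :: nat and s :: complex and sg :: "complex \<Rightarrow> complex"
  assumes s2: "s ^ 2 = of_nat D" and sQ: "s \<notin> QI"
    and sg_hom: "fhom (adj QI s) sg" and sg_fix: "\<And>x. x \<in> QI \<Longrightarrow> sg x = x" and sg_s: "sg s = - s"
    and sg_in: "\<And>x. x \<in> adj QI s \<Longrightarrow> sg x \<in> adj QI s" and sg_sg: "\<And>x. x \<in> adj QI s \<Longrightarrow> sg (sg x) = x"
begin

abbreviation "k \<equiv> adj QI s"
abbreviation "Ok \<equiv> ring_of_integers k"

lemma s2QI: "s ^ 2 \<in> QI" unfolding s2 using nf_subfield_of_nat[OF QI_subfield] .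

lemma k: "nf_subfield k" using adj_subfield[OF QI_subfield s2QI] .

sublocale sg: fhom_on k sg using k sg_hom by unfold_locales

lemma QIk: "QI \<subseteq> k" using adj_base[OF QI_subfield] .
lemma sk: "s \<in> k" using adj_gen[OF QI_subfield] .
lemma ZIk: "x \<in> ZI \<Longrightarrow> x \<in> k" using QIk ZI_QI by blast
lemma s0: "s \<noteq> 0" using sQ nfs(1)[OF QI_subfield] by blast
lemma D0: "D \<noteq> 0" using s0 s2 by (metis of_nat_0 power_eq_0_iff)

lemma O_ring: "subring_C Ok" using ring_of_integers_subring[OF k] .
lemma O_iff: "x \<in> Ok \<longleftrightarrow> x \<in> k \<and> algebraic_int x" using ring_of_integers_iff .
lemma ZIO: "x \<in> ZI \<Longrightarrow> x \<in> Ok" using ZIk ZI_alg_int O_iff by blast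
lemma O_QI: "x \<in> Ok \<Longrightarrow> x \<in> QI \<Longrightarrow> x \<in> ZI" using O_iff alg_int_QI by blast
lemma sO: "s \<in> Ok"
  using sk alg_int_sqrt[of s] s2 ZI_alg_int[of "of_nat D"] zis O_iff by simp
lemma sg_O: "x \<in> Ok \<Longrightarrow> sg x \<in> Ok" using sg.alg_int sg_in O_iff by blast

text \<open>The third expression isolates the coordinate of s without dividing: 2 D x = D (x + sg x)
  + s ((x - sg x) s) recovers x from two Gaussian numbers, up to the factor 2 D.\<close>

lemma tr_norm_QI: assumes "x \<in> k" shows "x + sg x \<in> QI" "x * sg x \<in> QI" "(x - sg x) * s \<in> QI"
proof -
  obtain u v where x: "u \<in> QI" "v \<in> QI" "x = u + v * s" using assms by (rule adjE)
  have sx: "sg x = u - v * s" unfolding x using x QIk sk sg_fix sg_s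
    by (subst sg.add) (auto simp: sg.mult intro!: nfs(4)[OF k])
  have "x + sg x = 2 * u" "x * sg x = u * u - v * v * s^2" "(x - sg x) * s = 2 * v * s^2"
    unfolding sx using x(3) by (auto simp: algebra_simps power2_eq_square)
  moreover have "2 * u \<in> QI" "u * u - v * v * s^2 \<in> QI" "2 * v * s^2 \<in> QI"
    using x(1,2) QI_subfield unfolding s2 by (auto intro!: nfs)
  ultimately show "x + sg x \<in> QI" "x * sg x \<in> QI" "(x - sg x) * s \<in> QI" by simp_all
qed

lemma tr_norm_ZI: assumes "x \<in> Ok" shows "x + sg x \<in> ZI" "x * sg x \<in> ZI" "(x - sg x) * s \<in> ZI"
proof -
  have "x + sg x \<in> Ok" "x * sg x \<in> Ok" "(x - sg x) * s \<in> Ok"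
    using assms sg_O[OF assms] sO subring_CD[OF O_ring] by auto
  then show "x + sg x \<in> ZI" "x * sg x \<in> ZI" "(x - sg x) * s \<in> ZI"
    using O_QI tr_norm_QI assms O_iff by auto
qed

lemma sg_ideal: assumes "nf_ideal Ok I" shows "nf_ideal Ok (sg ` I)"
proof -
  note I = nf_idealD[OF assms]
  have Ik: "x \<in> I \<Longrightarrow> x \<in> k" for x using I(1) O_iff by blast
  show ?thesis unfolding nf_ideal_def
  proof (intro conjI ballI)
    show "sg ` I \<subseteq> Ok" using I(1) sg_O by blast
    show "0 \<in> sg ` I" using I(2) sg.zero by (metis imageI)
    fix x assume "x \<in> sg ` I" then obtain x' where x: "x = sg x'" "x' \<in> I" by blast
    { fix y assume "y \<in> sg ` I" then obtain y' where y: "y = sg y'" "y' \<in> I" by blast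
      have "x + y = sg (x' + y')" using x y Ik sg.add by simp
      then show "x + y \<in> sg ` I" using x y I(3) by blast }
    fix r assume r: "r \<in> Ok"
    have "r * x = sg (sg r * x')" using x r Ik sg.mult sg_in sg_sg O_iff by simp
    then show "r * x \<in> sg ` I" using x I(4)[OF sg_O[OF r]] by blast
  qed
qed

text \<open>The content of \<open>I\<close>: the norms from \<open>I\<close> generate an ideal \<open>(g)\<close> of \<open>\<int>[\<i>]\<close>, and
  \<open>x \<sigma>(y) / g\<close> is a root of a monic quadratic polynomial over \<open>\<int>[\<i>]\<close>. Hence
  \<open>I \<sigma>(I) = g Ok\<close>, and every ideal of \<open>Ok\<close> is invertible.\<close>
lemma ideal_norm:
  assumes I: "nf_ideal Ok I" "I \<noteq> {0}"
  obtains g where "g \<in> ZI" "g \<noteq> 0" "g \<in> ideal_mult Ok I (sg ` I)"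
    "\<And>x y. x \<in> I \<Longrightarrow> y \<in> I \<Longrightarrow> x * sg y / g \<in> Ok"
proof -
  let ?M = "ideal_mult Ok I (sg ` I)"
  note II = nf_idealD[OF I(1)]
  have Ik: "x \<in> k" "x \<in> Ok" if "x \<in> I" for x using that II(1) O_iff by blast+
  have M: "nf_ideal Ok ?M" using ideal_mult_ideal[OF O_ring] II(1) nf_idealD(1)[OF sg_ideal[OF I(1)]] by blast
  note MM = nf_idealD[OF M]
  have "\<exists>g. g \<in> ?M \<inter> ZI \<and> (\<forall>x. x \<in> ?M \<inter> ZI \<longrightarrow> (\<exists>q\<in>ZI. x = q * g))"
  proof (rule ZI_principal[of "?M \<inter> ZI"])
    show "0 \<in> ?M \<inter> ZI" using MM(2) zis by blast
  qed (use MM zis ZIO in auto)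
  then obtain g where g: "g \<in> ?M" "g \<in> ZI" "\<And>x. x \<in> ?M \<Longrightarrow> x \<in> ZI \<Longrightarrow> \<exists>q\<in>ZI. x = q * g" by blast
  have xy: "x * sg y \<in> ?M" if "x \<in> I" "y \<in> I" for x y using that by (intro ideal_mult_base) auto
  have nrm: "\<exists>q\<in>ZI. x * sg x = q * g" if "x \<in> I" for x
    using g(3) xy[OF that that] tr_norm_ZI(2)[OF Ik(2)[OF that]] by blast
  obtain x0 where x0: "x0 \<in> I" "x0 \<noteq> 0" using I II(2) by blast
  have g0: "g \<noteq> 0"
  proof
    assume "g = 0"
    then have "x0 * sg x0 = 0" using nrm[OF x0(1)] by auto
    then show False using x0 sg.eq0[of x0] Ik by auto
  qed
  have "x * sg y / g \<in> Ok" if xI: "x \<in> I" and yI: "y \<in> I" for x y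
  proof -
    define z where "z = x * sg y"
    have sz: "sg z = y * sg x" unfolding z_def
      using sg.mult[OF Ik(1)[OF xI] sg_in[OF Ik(1)[OF yI]]] sg_sg[OF Ik(1)[OF yI]] by simp
    have "z + sg z \<in> ?M" using xy[OF xI yI] xy[OF yI xI] MM(3) unfolding sz unfolding z_def by blast
    moreover have zO: "z \<in> Ok" unfolding z_def using Ik xI yI sg_O subring_CD(4)[OF O_ring] by blast
    ultimately obtain p where p: "p \<in> ZI" "z + sg z = p * g" using g(3) tr_norm_ZI(1) by blast
    obtain q1 where q1: "q1 \<in> ZI" "x * sg x = q1 * g" using nrm xI by blast
    obtain q2 where q2: "q2 \<in> ZI" "y * sg y = q2 * g" using nrm yI by blast
    have "z * sg z = (q1 * g) * (q2 * g)" unfolding sz unfolding q1(2)[symmetric] q2(2)[symmetric] z_def by simp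
    then have "(z / g)^2 - p * (z / g) + q1 * q2 = (z^2 - (p * g) * z + z * sg z) / g^2"
      using g0 by (simp add: field_simps power2_eq_square)
    also have "\<dots> = 0" unfolding p(2)[symmetric] by (simp add: algebra_simps power2_eq_square)
    finally have "algebraic_int (z / g)" using alg_int_quadratic p(1) q1(1) q2(1) zis(4) by blast
    moreover have "z / g \<in> k" using zO g(2) ZIk O_iff nfs(8)[OF k] by blast
    ultimately show ?thesis using O_iff z_def by blast
  qed
  then show ?thesis using that g g0 by blast
qed

text \<open>Members of \<open>rel_auts\<close> are unconstrained off k, hence the pointwise form. It
  reduces invariance under all of them to invariance under \<open>sg\<close>.\<close>

lemma aut_fixing_QI:
  assumes "t \<in> rel_auts k QI" shows "(\<forall>x\<in>k. t x = x) \<or> (\<forall>x\<in>k. t x = sg x)"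
proof -
  have t: "\<And>x y. x \<in> k \<Longrightarrow> y \<in> k \<Longrightarrow> t (x + y) = t x + t y" "\<And>x y. x \<in> k \<Longrightarrow> y \<in> k \<Longrightarrow> t (x * y) = t x * t y"
    "\<And>x. x \<in> QI \<Longrightarrow> t x = x"
    using assms unfolding rel_auts_def field_auts_def by auto
  have "t s * t s = of_nat D"
    using t(2)[OF sk sk] t(3)[OF s2QI] s2 by (simp add: power2_eq_square)
  then have "(t s - s) * (t s + s) = 0" using s2 by (simp add: algebra_simps power2_eq_square)
  then have ts: "t s = s \<or> t s = - s" by (auto simp: eq_neg_iff_add_eq_0)
  have tx: "t (u + v * s) = u + v * t s" if "u \<in> QI" "v \<in> QI" for u v
  proof -
    have "u \<in> k" "v \<in> k" "v * s \<in> k" using that QIk sk nfs(4)[OF k] by blast+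
    then show ?thesis using t(1)[of u "v * s"] t(2)[of v s] t(3) that sk by simp
  qed
  have sx: "sg (u + v * s) = u - v * s" if "u \<in> QI" "v \<in> QI" for u v
  proof -
    have "u \<in> k" "v \<in> k" "v * s \<in> k" using that QIk sk nfs(4)[OF k] by blast+
    then show ?thesis using sg.add[of u "v * s"] sg.mult[of v s] sg_fix that sk sg_s by simp
  qed
  from ts show ?thesis
  proof
    assume "t s = s"
    then have "\<forall>x\<in>k. t x = x" using tx by (auto elim!: adjE)
    then show ?thesis ..
  next
    assume "t s = - s"
    then have "\<forall>x\<in>k. t x = sg x" using tx sx by (auto elim!: adjE)
    then show ?thesis ..
  qed
qed

lemma sg_rel_aut: "sg \<in> rel_auts k QI"
proof -
  have "bij_betw sg k k" by (rule bij_betwI[of _ _ _ sg]) (use sg_in sg_sg in auto)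
  then show ?thesis unfolding rel_auts_def field_auts_def using sg.add sg.mult sg_fix by auto
qed

lemma denominator:
  assumes "x \<in> k" obtains c where "c \<in> ZI" "c \<noteq> 0" "c * x \<in> Ok"
proof -
  have rat: "\<exists>n. n \<noteq> 0 \<and> of_int n * u \<in> ZI" if u: "u \<in> QI" for u
  proof -
    obtain a b c d where ab: "Re u = of_int a / of_int b" "b > 0" "Im u = of_int c / of_int d" "d > 0"
      using u unfolding QI_def by (auto elim!: Rats_cases')
    have "Re (of_int (b * d) * u) = of_int (a * d)" "Im (of_int (b * d) * u) = of_int (c * b)"
      using ab by (auto simp: field_simps)
    then have "of_int (b * d) * u \<in> ZI" unfolding ZI_def mem_Collect_eq by (metis Ints_of_int)
    then show ?thesis using ab by (intro exI[of _ "b * d"]) auto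
  qed
  obtain u v where x: "u \<in> QI" "v \<in> QI" "x = u + v * s" using assms by (rule adjE)
  obtain m where m: "m \<noteq> 0" "of_int m * u \<in> ZI" using rat[OF x(1)] by blast
  obtain n where n: "n \<noteq> 0" "of_int n * v \<in> ZI" using rat[OF x(2)] by blast
  note mn = m n
  have "of_int (m * n) * x = of_int n * (of_int m * u) + of_int m * (of_int n * v) * s"
    using x by (simp add: algebra_simps)
  moreover have "of_int n * (of_int m * u) \<in> Ok" "of_int m * (of_int n * v) \<in> Ok" using mn zis ZIO by auto
  ultimately have "of_int (m * n) * x \<in> Ok" using sO subring_CD[OF O_ring] by simp
  then show ?thesis using that[of "of_int (m * n)"] mn zis by simp
qed

text \<open>Hilbert 90 gives x with a sg(x) = x. Then d = c / x satisfies sg(d) = a d, so sg(d I) =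
  d (a sg(I)) = d I, and the Gaussian factor c makes d, hence d I, integral.\<close>

lemma strongly_ambiguousI:
  assumes I: "nf_ideal Ok I" "I \<noteq> {0}" and a: "a \<in> k" "(\<lambda>x. a * sg x) ` I = I" and n: "a * sg a = 1"
  shows "ideal_class Ok I \<in> strongly_ambiguous_classes k QI"
proof -
  note II = nf_idealD[OF I(1)]
  have Ik: "x \<in> k" "x \<in> Ok" if "x \<in> I" for x using that II(1) O_iff by blast+
  obtain x where x: "x \<in> k" "x \<noteq> 0" "a * sg x = x"
    using quad_hilbert90[OF QI_subfield s2QI sQ sg_hom sg_sg sg_s a(1) n] by blast
  obtain c where c: "c \<in> ZI" "c \<noteq> 0" "c * inverse x \<in> Ok" using denominator nfs(6)[OF k x(1)] by blast
  define d where "d = c * inverse x"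
  have d: "d \<in> Ok" "d \<noteq> 0" "d \<in> k" using c x O_iff unfolding d_def by auto
  have "sg d = c * inverse (sg x)" unfolding d_def
    using c x ZIk nfs(6)[OF k x(1)] sg.mult sg.inv sg_fix ZI_QI by (metis subsetD)
  moreover have "inverse (sg x) = a * inverse x" using x(2,3)
    by (metis inverse_mult_distrib inverse_nonzero_iff_nonzero mult.left_commute mult.right_neutral mult_zero_left right_inverse nonzero_imp_inverse_nonzero)
  ultimately have sd: "sg d = a * d" unfolding d_def by simp
  define J where "J = (\<lambda>x. d * x) ` I"
  have "sg ` J = (\<lambda>x. d * (a * sg x)) ` I"
    unfolding J_def image_image using sd d Ik by (intro image_cong) (auto simp: sg.mult mult_ac)
  also have "\<dots> = (\<lambda>x. d * x) ` (\<lambda>x. a * sg x) ` I" by (simp add: image_image)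
  finally have sJ: "sg ` J = J" unfolding a(2) J_def .
  have JO: "J \<subseteq> Ok" unfolding J_def using d II(1) subring_CD(4)[OF O_ring] by blast
  have J: "nf_ideal Ok J" unfolding nf_ideal_def
  proof (intro conjI ballI JO)
    show "0 \<in> J" unfolding J_def using II(2) by force
    fix x assume "x \<in> J" then obtain x' where x: "x = d * x'" "x' \<in> I" unfolding J_def by blast
    { fix y assume "y \<in> J" then obtain y' where y: "y = d * y'" "y' \<in> I" unfolding J_def by blast
      show "x + y \<in> J" unfolding J_def using x y II(3) by (intro image_eqI[of _ _ "x' + y'"]) (auto simp: algebra_simps) }
    fix r assume r: "r \<in> Ok"
    then show "r * x \<in> J" unfolding J_def using x II(4) by (intro image_eqI[of _ _ "r * x'"]) auto
  qed
  obtain x0 where "x0 \<in> I" "x0 \<noteq> 0" using I(2) II(2) by blast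
  then have "d * x0 \<in> J" "d * x0 \<noteq> 0" using d unfolding J_def by auto
  then have "J \<noteq> {0}" by blast
  then have Jnz: "J \<in> nz_ideals Ok" using J by (simp add: nz_ideals_def)
  have "ideal_equiv Ok I J"
    using d subring_CD(2)[OF O_ring] unfolding J_def by (intro ideal_equivI[of d _ 1]) auto
  then have "ideal_class Ok I = ideal_class Ok J" using ideal_class_eqI[OF O_ring] by blast
  moreover have "t ` J = J" if t: "t \<in> rel_auts k QI" for t
  proof -
    have "t ` J = J \<or> t ` J = sg ` J"
      using aut_fixing_QI[OF t] JO O_iff by (auto simp: image_iff subset_iff) 
    then show ?thesis using sJ by blast
  qed
  ultimately show ?thesis using Jnz unfolding strongly_ambiguous_classes_def by blast
qed

text \<open>Applying the twist twice multiplies by n = a sg(a), so n I = I. Since g lies in I sg(I)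
  while every x sg(y) / g is integral, both n and 1/n are integral, and a Gaussian number with this
  property is a power of \<i>.\<close>

lemma twisted_invariant_norm:
  assumes I: "nf_ideal Ok I" "I \<noteq> {0}" and a: "a \<in> k" "(\<lambda>x. a * sg x) ` I = I"
  shows "a * sg a \<in> {1, -1, \<i>, -\<i>}"
proof -
  obtain g where g: "g \<in> ZI" "g \<noteq> 0" "g \<in> ideal_mult Ok I (sg ` I)" "\<And>x y. x \<in> I \<Longrightarrow> y \<in> I \<Longrightarrow> x * sg y / g \<in> Ok"
    using ideal_norm[OF I] by blast
  note II = nf_idealD[OF I(1)]
  have Ik: "x \<in> k" "x \<in> Ok" if "x \<in> I" for x using that II(1) O_iff by blast+
  define n where "n = a * sg a"
  have nQ: "n \<in> QI" unfolding n_def using tr_norm_QI a by blast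
  have ax: "a * sg x \<in> I" if "x \<in> I" for x using a(2) that by blast
  have aa: "a * sg (a * sg x) = n * x" if "x \<in> I" for x
    using Ik[OF that] a sg.mult sg_in sg_sg unfolding n_def by simp
  have nI: "n * x \<in> I" if "x \<in> I" for x using ax[OF ax[OF that]] aa[OF that] by simp
  have n': "\<exists>x'\<in>I. x = n * x'" if xI: "x \<in> I" for x
  proof -
    obtain x1 where x1: "x1 \<in> I" "x = a * sg x1" using a(2) xI by blast
    obtain x2 where x2: "x2 \<in> I" "x1 = a * sg x2" using a(2) x1 by blast
    show ?thesis using x1 x2 aa by auto
  qed
  obtain x0 where x0: "x0 \<in> I" "x0 \<noteq> 0" using I II(2) by blast
  have n0: "n \<noteq> 0" using n'[OF x0(1)] x0 by auto
  have sub: "I \<subseteq> Ok" "sg ` I \<subseteq> Ok" using II(1) sg_O by blast+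
  have "n * g / g \<in> Ok"
    using g(3)
  proof (rule ideal_mult_induct[where P = "\<lambda>z. n * z / g \<in> Ok"])
    fix x y assume "x \<in> I" "y \<in> sg ` I"
    then obtain y' where "y' \<in> I" "y = sg y'" by blast
    then show "n * (x * y) / g \<in> Ok" using g(4)[OF nI] \<open>x \<in> I\<close> by (simp add: mult.assoc)
  qed (use sub O_ring subring_CD[OF O_ring] in \<open>auto simp: algebra_simps add_divide_distrib simp flip: times_divide_eq_right\<close>)
  then have "n \<in> ZI" using g(2) nQ O_QI by simp
  have "g / n / g \<in> Ok"
    using g(3)
  proof (rule ideal_mult_induct[where P = "\<lambda>z. z / n / g \<in> Ok"])
    fix x y assume "x \<in> I" "y \<in> sg ` I"
    then obtain y' where "y' \<in> I" "y = sg y'" by blast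
    obtain x' where "x' \<in> I" "x = n * x'" using n' \<open>x \<in> I\<close> by blast
    then show "x * y / n / g \<in> Ok" using g(4)[of x' y'] \<open>y = sg y'\<close> \<open>y' \<in> I\<close> n0 by simp
  qed (use sub O_ring subring_CD[OF O_ring] in \<open>auto simp: add_divide_distrib simp flip: times_divide_eq_right\<close>)
  then have "1 / n \<in> Ok" using g(2) by simp
  then have "1 / n \<in> ZI" using nQ O_QI nfs(8)[OF QI_subfield] nfs(2)[OF QI_subfield] by blast
  then show ?thesis using ZI_unit[OF \<open>n \<in> ZI\<close>] n0 unfolding n_def by blast
qed

text \<open>\<i> is a unit fixed by \<open>sg\<close>, so replacing a by \<i> a keeps I = a sg(I)
  and multiplies the norm of a by \<i>^2 = -1.\<close>

lemma strongly_ambiguousI':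
  assumes I: "nf_ideal Ok I" "I \<noteq> {0}" and a: "a \<in> k" "(\<lambda>x. a * sg x) ` I = I" and n: "a * sg a \<in> {1, -1}"
  shows "ideal_class Ok I \<in> strongly_ambiguous_classes k QI"
proof (cases "a * sg a = 1")
  case True
  then show ?thesis using strongly_ambiguousI[OF I a] by blast
next
  case False
  then have n: "a * sg a = -1" using n by blast
  have iO: "\<i> \<in> Ok" "-\<i> \<in> Ok" using ZIO zis by auto
  have "(\<lambda>x. \<i> * a * sg x) ` I = (\<lambda>x. \<i> * x) ` (\<lambda>x. a * sg x) ` I" by (simp add: image_image mult.assoc)
  also have "\<dots> = (\<lambda>x. \<i> * x) ` I" unfolding a(2) ..
  also have "\<dots> = I"
  proof
    show "(*) \<i> ` I \<subseteq> I" using iO nf_idealD(4)[OF I(1)] by blast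
    show "I \<subseteq> (*) \<i> ` I"
    proof
      fix x assume "x \<in> I"
      then have "- \<i> * x \<in> I" using iO nf_idealD(4)[OF I(1)] by blast
      then show "x \<in> (*) \<i> ` I" by (intro image_eqI[of _ _ "- \<i> * x"]) auto
    qed
  qed
  finally have "(\<lambda>x. \<i> * a * sg x) ` I = I" .
  moreover have ik: "\<i> \<in> k" using QIk QI_ii by blast
  then have "\<i> * a \<in> k" using a nfs(4)[OF k] by blast
  moreover have "\<i> * a * sg (\<i> * a) = 1" using sg.mult[OF ik a(1)] sg_fix[OF QI_ii] n
    by (metis i_squared mult.commute mult.left_commute mult.right_neutral mult_minus_left mult_minus_right minus_minus)
  ultimately show ?thesis using strongly_ambiguousI[OF I] by blast
qed

text \<open>Taking norms to k in I O_K = (\<beta>) suggests I^2 = (b) with b = \<beta> tau(\<beta>);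
  together with I sg(I) = (g) this gives I = (b/g) sg(I). Both inclusions are checked on elements,
  with g in I sg(I) taking the place of an inverse ideal.\<close>

lemma capitulating_ideal:
  assumes I: "nf_ideal Ok I" "I \<noteq> {0}" and g: "g \<in> ZI" "g \<noteq> 0" "g \<in> ideal_mult Ok I (sg ` I)"
      "\<And>x y. x \<in> I \<Longrightarrow> y \<in> I \<Longrightarrow> x * sg y / g \<in> Ok"
    and K: "nf_subfield K" "k \<subseteq> K"
    and tau: "fhom K tau" "\<And>x. x \<in> K \<Longrightarrow> tau x \<in> K" "\<And>x. x \<in> k \<Longrightarrow> tau x = x" "\<And>x. x \<in> K \<Longrightarrow> x * tau x \<in> k"
    and \<beta>: "\<beta> \<in> ring_of_integers K" "\<beta> \<noteq> 0" "ideal_gen (ring_of_integers K) I = (\<lambda>x. \<beta> * x) ` ring_of_integers K"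
  shows "(\<lambda>x. (\<beta> * tau \<beta> / g) * sg x) ` I = I" "\<And>x. x \<in> I \<Longrightarrow> algebraic_int (\<beta> * sg x / g)"
proof -
  let ?R = "ring_of_integers K"
  interpret tau: fhom_on K tau using K(1) tau(1) by unfold_locales
  have R: "subring_C ?R" using ring_of_integers_subring[OF K(1)] .
  note II = nf_idealD[OF I(1)]
  have Ik: "x \<in> k" "x \<in> Ok" if "x \<in> I" for x using that II(1) O_iff by blast+
  have IR: "I \<subseteq> ?R" using II(1) K(2) O_iff ring_of_integers_iff by blast
  have \<beta>K: "\<beta> \<in> K" "algebraic_int \<beta>" using \<beta> ring_of_integers_iff by auto
  define b where "b = \<beta> * tau \<beta>"
  have b0: "b \<noteq> 0" unfolding b_def using \<beta> \<beta>K tau.eq0 by simp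
  have bk: "b \<in> k" unfolding b_def using tau(4) \<beta>K by blast
  have div: "x / \<beta> \<in> K \<and> algebraic_int (x / \<beta>)" if "x \<in> I" for x
  proof -
    have "x \<in> (\<lambda>x. \<beta> * x) ` ?R" using that ideal_gen_base \<beta>(3) by blast
    then obtain y where "y \<in> ?R" "x = \<beta> * y" by blast
    then show ?thesis using \<beta>(2) ring_of_integers_iff by simp
  qed
  have \<beta>gen: "\<beta> \<in> ideal_gen ?R I" unfolding \<beta>(3) using subring_CD(2)[OF R] by (intro image_eqI[of _ _ 1]) auto
  have sub: "I \<subseteq> Ok" "sg ` I \<subseteq> Ok" using II(1) sg_O by blast+
  have sI: "nf_ideal Ok (sg ` I)" using sg_ideal[OF I(1)] .
  \<comment> \<open>I^2 lies in b Ok: since tau fixes y, the quotient is (x / \<beta>) tau(y /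
    \<beta>).\<close>
  have xb: "x * y / b \<in> Ok" if "x \<in> I" "y \<in> I" for x y
  proof -
    have "tau (y / \<beta>) = y / tau \<beta>"
      using tau.divide[of y \<beta>] tau(3)[of y] Ik[OF that(2)] \<beta>K K(2) by auto
    then have "x * y / b = (x / \<beta>) * tau (y / \<beta>)" unfolding b_def by simp
    moreover have "algebraic_int (x / \<beta>)" "algebraic_int (tau (y / \<beta>))" using div that tau.alg_int by auto
    ultimately have "algebraic_int (x * y / b)" using alg_int_mult by metis
    then show ?thesis using O_iff nfs(8)[OF k nfs(4)[OF k Ik(1)[OF that(1)] Ik(1)[OF that(2)]] bk] by blast
  qed
  have A: "g * x / b \<in> sg ` I" if xI: "x \<in> I" for x
    using g(3)
  proof (rule ideal_mult_induct[where P = "\<lambda>z. z * x / b \<in> sg ` I"])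
    fix u v assume uv: "u \<in> I" "v \<in> sg ` I"
    have "(u * x / b) * v \<in> sg ` I" using nf_idealD(4)[OF sI xb[OF uv(1) xI] uv(2)] .
    then show "u * v * x / b \<in> sg ` I" by (simp add: mult_ac)
  next
    fix u v assume "u * x / b \<in> sg ` I" "v * x / b \<in> sg ` I"
    then show "(u + v) * x / b \<in> sg ` I" using nf_idealD(3)[OF sI] by (simp add: distrib_right add_divide_distrib)
  next
    fix r u assume "r \<in> Ok" "u * x / b \<in> sg ` I"
    then show "r * u * x / b \<in> sg ` I" using nf_idealD(4)[OF sI, of r "u * x / b"] by (simp add: mult.assoc)
  qed (use sub O_ring nf_idealD(2)[OF sI] in auto)
  show c1: "algebraic_int (\<beta> * sg x / g)" if xI: "x \<in> I" for x
    using \<beta>gen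
  proof (rule ideal_gen_induct[where P = "\<lambda>z. algebraic_int (z * sg x / g)"])
    fix r u assume "r \<in> ?R" "algebraic_int (u * sg x / g)"
    then show "algebraic_int (r * u * sg x / g)"
      using alg_int_mult[of r "u * sg x / g"] ring_of_integers_iff by (simp add: mult.assoc)
  qed (use IR R g(4) xI O_iff in \<open>auto simp: distrib_right add_divide_distrib alg_int_add\<close>)
  have sgxK: "sg x \<in> k" "sg x \<in> K" if "x \<in> I" for x using sg_in Ik that K(2) by blast+
  have gk: "g \<in> k" "g \<in> K" using ZIk g K by auto
  have c2: "algebraic_int (tau \<beta> * sg x / g)" if xI: "x \<in> I" for x
  proof -
    have "tau (\<beta> * sg x / g) = tau \<beta> * sg x / g"
      using tau.divide tau.mult tau(3) \<beta>K sgxK[OF xI] gk nfs(4)[OF K(1)] by simp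
    then show ?thesis using tau.alg_int[OF _ c1[OF xI]] \<beta>K sgxK[OF xI] gk nfs(4,8)[OF K(1)] by metis
  qed
  \<comment> \<open>The counterpart of \<open>xb\<close> for sg(I): b sg(I)^2 lies in g^2 Ok,
    because \<beta> sg(x) / g and tau(\<beta>) sg(y) / g are integral.\<close>
  have c3: "b * sg x * sg y / g^2 \<in> Ok" if "x \<in> I" "y \<in> I" for x y
  proof -
    have "b * sg x * sg y / g^2 = (\<beta> * sg x / g) * (tau \<beta> * sg y / g)"
      unfolding b_def by (simp add: power2_eq_square)
    then have "algebraic_int (b * sg x * sg y / g^2)"
      using alg_int_mult[OF c1[OF that(1)] c2[OF that(2)]] by metis
    moreover have "b * sg x * sg y / g^2 \<in> k"
      by (rule nfs(8)[OF k nfs(4)[OF k nfs(4)[OF k bk sgxK(1)[OF that(1)]] sgxK(1)[OF that(2)]]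
            nf_subfield_power[OF k gk(1)]])
    ultimately show ?thesis using O_iff by blast
  qed
  have B: "b * sg x / g \<in> I" if xI: "x \<in> I" for x
  proof -
    have "b * sg x * g / g^2 \<in> I"
      using g(3)
    proof (rule ideal_mult_induct[where P = "\<lambda>z. b * sg x * z / g^2 \<in> I"])
      fix u v assume uv: "u \<in> I" "v \<in> sg ` I"
      then obtain v' where v: "v' \<in> I" "v = sg v'" by blast
      have "(b * sg x * sg v' / g^2) * u \<in> I" using II(4)[OF c3[OF xI v(1)] uv(1)] .
      then show "b * sg x * (u * v) / g^2 \<in> I" using v by (simp add: mult_ac)
    next
      fix u v assume "b * sg x * u / g^2 \<in> I" "b * sg x * v / g^2 \<in> I"
      then show "b * sg x * (u + v) / g^2 \<in> I" using II(3) by (simp add: distrib_left add_divide_distrib)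
    next
      fix r u assume "r \<in> Ok" "b * sg x * u / g^2 \<in> I"
      then show "b * sg x * (r * u) / g^2 \<in> I" using II(4)[of r "b * sg x * u / g^2"] by (simp add: mult_ac)
    qed (use sub O_ring II(2) in auto)
    then show ?thesis using g(2) by (simp add: power2_eq_square)
  qed
  show "(\<lambda>x. (\<beta> * tau \<beta> / g) * sg x) ` I = I"
  proof
    show "(\<lambda>x. (\<beta> * tau \<beta> / g) * sg x) ` I \<subseteq> I" using B unfolding b_def by auto
    show "I \<subseteq> (\<lambda>x. (\<beta> * tau \<beta> / g) * sg x) ` I"
    proof
      fix x assume "x \<in> I"
      then obtain y where y: "y \<in> I" "g * x / b = sg y" using A by blast
      then have "x = (b / g) * sg y" using b0 g(2) by (simp add: field_simps)
      then show "x \<in> (\<lambda>x. (\<beta> * tau \<beta> / g) * sg x) ` I" using y unfolding b_def by blast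
    qed
  qed
qed

text \<open>Both sides of the second conclusion are the product of \<beta> over the four
  automorphisms generated by tau and s1, divided by g^2. The norm of a can thus be computed through
  another intermediate field, namely the one fixed by s1, and the first conclusion provides an
  integer there.\<close>

lemma capitulation_relative_norm:
  assumes I: "nf_ideal Ok I" and g: "g \<in> ZI" "g \<noteq> 0"
    and K: "nf_subfield K" "k \<subseteq> K"
    and tau: "fhom K tau" "\<And>x. x \<in> K \<Longrightarrow> tau x \<in> K" "\<And>x. x \<in> k \<Longrightarrow> tau x = x" "\<And>x. x \<in> K \<Longrightarrow> x * tau x \<in> k"
    and s1: "fhom K s1" "\<And>x. x \<in> K \<Longrightarrow> s1 x \<in> K" "\<And>x. x \<in> k \<Longrightarrow> s1 x = sg x"
    and comm: "\<And>x. x \<in> K \<Longrightarrow> tau (s1 x) = s1 (tau x)"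
    and \<beta>: "\<beta> \<in> K" "ideal_gen (ring_of_integers K) I = (\<lambda>x. \<beta> * x) ` ring_of_integers K"
    and c1: "\<And>x. x \<in> I \<Longrightarrow> algebraic_int (\<beta> * sg x / g)"
  shows "algebraic_int (\<beta> * s1 \<beta> / g)"
    "(\<beta> * s1 \<beta> / g) * tau (\<beta> * s1 \<beta> / g) = (\<beta> * tau \<beta> / g) * sg (\<beta> * tau \<beta> / g)"
proof -
  let ?R = "ring_of_integers K"
  interpret tau: fhom_on K tau using K(1) tau(1) by unfold_locales
  interpret s1: fhom_on K s1 using K(1) s1(1) by unfold_locales
  have R: "subring_C ?R" using ring_of_integers_subring[OF K(1)] .
  note II = nf_idealD[OF I]
  have Ik: "x \<in> k" "x \<in> Ok" if "x \<in> I" for x using that II(1) O_iff by blast+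
  have IR: "I \<subseteq> ?R" using II(1) K(2) O_iff ring_of_integers_iff by blast
  have gk: "g \<in> k" "g \<in> K" using ZIk g K by auto
  have sgg: "sg g = g" using sg_fix g ZI_QI by blast
  have \<beta>gen: "\<beta> \<in> ideal_gen ?R I" unfolding \<beta>(2) using subring_CD(2)[OF R] by (intro image_eqI[of _ _ 1]) auto
  show "algebraic_int (\<beta> * s1 \<beta> / g)"
    using \<beta>gen
  proof (rule ideal_gen_induct[where P = "\<lambda>z. algebraic_int (z * s1 \<beta> / g)"])
    fix x assume xI: "x \<in> I"
    have xk: "sg x \<in> k" "sg x \<in> K" using sg_in Ik xI K(2) by blast+
    have "s1 (\<beta> * sg x / g) = s1 \<beta> * s1 (sg x) / s1 g"
      using s1.divide s1.mult \<beta>(1) xk gk nfs(4)[OF K(1)] by simp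
    also have "\<dots> = x * s1 \<beta> / g" using s1(3) xk gk sgg sg_sg Ik[OF xI] by simp
    finally show "algebraic_int (x * s1 \<beta> / g)"
      using s1.alg_int[OF _ c1[OF xI]] \<beta>(1) xk gk nfs(4,8)[OF K(1)] by metis
  next
    fix r u assume "r \<in> ?R" "algebraic_int (u * s1 \<beta> / g)"
    then show "algebraic_int (r * u * s1 \<beta> / g)"
      using alg_int_mult[of r "u * s1 \<beta> / g"] ring_of_integers_iff by (simp add: mult.assoc)
  qed (use IR R in \<open>auto simp: distrib_right add_divide_distrib alg_int_add\<close>)
  have tb: "tau \<beta> \<in> K" "s1 \<beta> \<in> K" "\<beta> * tau \<beta> \<in> k" "\<beta> * tau \<beta> \<in> K" "\<beta> * s1 \<beta> \<in> K"
    using tau s1 \<beta>(1) nfs(4)[OF K(1)] by auto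
  have "tau (\<beta> * s1 \<beta> / g) = tau \<beta> * s1 (tau \<beta>) / g"
    using tau.divide[OF tb(5) gk(2)] tau.mult[OF \<beta>(1) tb(2)] tau(3)[OF gk(1)] comm[OF \<beta>(1)] by simp
  moreover have "sg (\<beta> * tau \<beta> / g) = s1 \<beta> * s1 (tau \<beta>) / g"
    using sg.divide[OF tb(3) gk(1)] s1(3)[OF tb(3)] s1.mult[OF \<beta>(1) tb(1)] sgg by simp
  ultimately show "(\<beta> * s1 \<beta> / g) * tau (\<beta> * s1 \<beta> / g) = (\<beta> * tau \<beta> / g) * sg (\<beta> * tau \<beta> / g)"
    by simp
qed

text \<open>The square of an ambiguous ideal is \<open>(g)\<close>, where \<open>g\<close> is a square in \<open>\<rat>(\<i>)\<close> up to a
  divisor \<open>w\<close> of \<open>4 D\<^sup>2\<close>: only the ramified primes matter.\<close>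
lemma ambiguous_ideal_square:
  assumes I: "nf_ideal Ok I" "I \<noteq> {0}" and inv: "sg ` I = I"
  obtains g t w where "g \<in> ZI" "g \<noteq> 0" "g \<in> ideal_mult Ok I I" "\<And>x y. x \<in> I \<Longrightarrow> y \<in> I \<Longrightarrow> x * y / g \<in> Ok"
    "t \<in> ZI" "t \<noteq> 0" "w \<in> ZI" "t^2 = g * w" "4 * of_nat D ^ 2 / w \<in> ZI"
proof -
  note II = nf_idealD[OF I(1)]
  have Ik: "x \<in> k" "x \<in> Ok" if "x \<in> I" for x using that II(1) O_iff by blast+
  obtain g where g: "g \<in> ZI" "g \<noteq> 0" "g \<in> ideal_mult Ok I (sg ` I)" "\<And>x y. x \<in> I \<Longrightarrow> y \<in> I \<Longrightarrow> x * sg y / g \<in> Ok"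
    using ideal_norm[OF I] by blast
  have g3: "g \<in> ideal_mult Ok I I" using g(3) inv by simp
  have g4: "x * y / g \<in> Ok" if xI: "x \<in> I" and yI: "y \<in> I" for x y
  proof -
    obtain y' where "y' \<in> I" "y = sg y'" using yI inv by blast
    then show ?thesis using g(4) xI by blast
  qed
  have "\<exists>t. t \<in> I \<inter> ZI \<and> (\<forall>x. x \<in> I \<inter> ZI \<longrightarrow> (\<exists>q\<in>ZI. x = q * t))"
  proof (rule ZI_principal[of "I \<inter> ZI"])
    show "0 \<in> I \<inter> ZI" using II(2) zis by blast
  qed (use II zis ZIO in auto)
  then obtain t where t: "t \<in> I" "t \<in> ZI" "\<And>x. x \<in> I \<Longrightarrow> x \<in> ZI \<Longrightarrow> \<exists>q\<in>ZI. x = q * t" by blast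
  have sgI: "sg x \<in> I" if "x \<in> I" for x using that inv by blast
  obtain x0 where x0: "x0 \<in> I" "x0 \<noteq> 0" using I II(2) by blast
  have "sg x0 \<noteq> 0" using x0 sg.eq0[of x0] Ik by auto
  then have "x0 * sg x0 \<noteq> 0" "x0 * sg x0 \<in> I" "x0 * sg x0 \<in> ZI"
    using x0 II(5) sgI Ik tr_norm_ZI(2) by auto
  then have t0: "t \<noteq> 0" using t(3) by fastforce
  \<comment> \<open>The trace of x and its rescaled s-coordinate both lie in I and in
    \<open>ZI\<close>, so t divides them and hence 2 D x. Products of two such quotients show that w
    divides 4 D^2.\<close>
  have div: "2 * of_nat D * x / t \<in> Ok" if xI: "x \<in> I" for x
  proof -
    have "x + sg x \<in> I" "(x - sg x) * s \<in> I"
      using xI sgI II(3,5) nf_ideal_diff[OF O_ring I(1)] sO by auto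
    then obtain p q where p: "p \<in> ZI" "x + sg x = p * t" and q: "q \<in> ZI" "(x - sg x) * s = q * t"
      using t(3) tr_norm_ZI[OF Ik(2)[OF xI]] by blast
    have "2 * of_nat D * x = of_nat D * (x + sg x) + s * ((x - sg x) * s)"
      unfolding s2[symmetric] by (simp add: algebra_simps power2_eq_square)
    also have "\<dots> = (of_nat D * p + s * q) * t" unfolding p(2) q(2) by (simp add: algebra_simps)
    finally have "2 * of_nat D * x / t = of_nat D * p + s * q" using t0 by simp
    moreover have "of_nat D \<in> Ok" "p \<in> Ok" "q \<in> Ok" using p q ZIO zis by auto
    ultimately show ?thesis using sO subring_CD[OF O_ring] by simp
  qed
  define w where "w = t * t / g"
  have "w \<in> Ok" unfolding w_def using g4 t by blast
  moreover have "w \<in> QI" unfolding w_def using t(2) g(1) ZI_QI nfs(4,8)[OF QI_subfield] by blast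
  ultimately have w: "w \<in> ZI" using O_QI by blast
  have "4 * of_nat D ^ 2 * g / t^2 \<in> Ok"
    using g3
  proof (rule ideal_mult_induct[where P = "\<lambda>z. 4 * of_nat D ^ 2 * z / t^2 \<in> Ok"])
    fix a b assume "a \<in> I" "b \<in> I"
    then have "(2 * of_nat D * a / t) * (2 * of_nat D * b / t) \<in> Ok" using div subring_CD(4)[OF O_ring] by blast
    then show "4 * of_nat D ^ 2 * (a * b) / t^2 \<in> Ok" by (simp add: power2_eq_square mult_ac)
  next
    fix a b assume "4 * of_nat D ^ 2 * a / t^2 \<in> Ok" "4 * of_nat D ^ 2 * b / t^2 \<in> Ok"
    then show "4 * of_nat D ^ 2 * (a + b) / t^2 \<in> Ok" using subring_CD(3)[OF O_ring]
      by (simp add: distrib_left add_divide_distrib)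
  next
    fix r a assume "r \<in> Ok" "4 * of_nat D ^ 2 * a / t^2 \<in> Ok"
    then show "4 * of_nat D ^ 2 * (r * a) / t^2 \<in> Ok"
      using subring_CD(4)[OF O_ring, of r "4 * of_nat D ^ 2 * a / t^2"] by (simp add: mult_ac)
  qed (use II(1) O_ring subring_CD(1)[OF O_ring] in auto)
  moreover have "4 * of_nat D ^ 2 * g / t^2 = 4 * of_nat D ^ 2 / w"
    unfolding w_def using t0 g(2) by (simp add: power2_eq_square)
  moreover have "4 * of_nat D ^ 2 / w \<in> QI"
    using w ZI_QI QI_subfield by (auto intro!: nfs)
  ultimately have "4 * of_nat D ^ 2 / w \<in> ZI" using O_QI by simp
  moreover have "t^2 = g * w" unfolding w_def using g(2) by (simp add: power2_eq_square)
  ultimately show ?thesis using that g(1,2) g3 g4 t(2) t0 w by blast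
qed

end

section \<open>Units of relative norm \<open>\<plusminus>\<i>\<close>\<close>

text \<open>In lowest terms f = p/q, an even q would force p even as well, from m p^2 = n q^2 with m
  odd. So q is odd, and n is congruent to a square mod 4. This is how it is used that 2 does not
  ramify when D is 1 mod 4.\<close>

lemma rat_square_mod_4:
  fixes m :: nat and f :: real
  assumes m: "m mod 4 = 1" and f: "f \<in> \<rat>" and eq: "of_nat m * f ^ 2 = of_int n"
  shows "n mod 4 = 0 \<or> n mod 4 = 1"
proof -
  obtain p q where pq: "q > 0" "coprime p q" "f = of_int p / of_int q" using f by (auto elim!: Rats_cases')
  have "of_nat m * of_int p ^ 2 = (of_int n * of_int q ^ 2 :: real)"
    using eq pq by (simp add: field_simps power_divide)
  then have "(of_int (int m * p ^ 2) :: real) = of_int (n * q ^ 2)" by simp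
  then have e: "int m * p ^ 2 = n * q ^ 2" unfolding of_int_eq_iff .
  have m': "int m mod 4 = 1" using m by presburger
  have "int m * p ^ 2 mod 4 = p ^ 2 mod 4" using m' by (metis mod_mult_left_eq mult_1)
  then have e4: "p ^ 2 mod 4 = n * q ^ 2 mod 4" using e by simp
  have "odd q"
  proof
    assume "even q"
    then have "q ^ 2 mod 4 = 0" using int_square_mod_4[of q] by simp
    then have "n * q ^ 2 mod 4 = 0" by (metis mod_mult_right_eq mult_zero_right mod_0)
    then have "even p" using e4 int_square_mod_4[of p] by (metis zero_neq_one)
    then show False using \<open>even q\<close> pq(2) by (metis coprime_common_divisor odd_one)
  qed
  then have "n * q ^ 2 mod 4 = n mod 4" using int_square_mod_4[of q] by (metis mod_mult_right_eq mult.right_neutral)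
  then show ?thesis using e4 int_square_mod_4[of p] by (metis (full_types))
qed

lemma alg_int_rat: "algebraic_int (complex_of_real r) \<Longrightarrow> r \<in> \<rat> \<Longrightarrow> \<exists>n. r = of_int n"
  using rational_algebraic_int_is_int[of r] by (auto elim: Ints_cases)

text \<open>For \<open>v \<sigma>(v) = \<plusminus>\<i>\<close> the element \<open>z = v \<cdot> cnj (\<sigma> v)\<close> lies in \<open>\<rat>(\<surd>-D)\<close> and has norm 1, so
  \<open>z = \<plusminus>1\<close>. This forces \<open>v = (t / 2) (1 \<plusminus> \<i>)\<close> with \<open>t\<close> real, and \<open>t\<^sup>2 / 2\<close> a unit of \<open>\<rat>(\<surd>D)\<close>,
  which is impossible since 2 is unramified there.\<close>

lemma (in gquad) no_relative_norm_ii: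
  assumes real: "cnj s = s" and D: "D mod 4 = 1" and v: "v \<in> k" "algebraic_int v"
    and n: "v * sg v = \<epsilon>" "\<epsilon> = \<i> \<or> \<epsilon> = -\<i>"
  shows False
proof -
  obtain a b where ab: "a \<in> QI" "b \<in> QI" "v = a + b * s" using v(1) by (rule adjE)
  have sgform: "sg (a + b * s) = a - b * s" if "a \<in> QI" "b \<in> QI" for a b
  proof -
    have "a \<in> k" "b \<in> k" "b * s \<in> k" using that QIk sk nfs(4)[OF k] by blast+
    then show ?thesis using sg.add[of a "b * s"] sg.mult[of b s] sg_fix that sk sg_s by simp
  qed
  have sv: "sg v = a - b * s" using sgform ab by simp
  have rs: "Im s = 0" using real by (simp add: complex_eq_iff)
  define r where "r = Re s"
  have sr: "s = of_real r" unfolding r_def using rs by (simp add: complex_eq_iff)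
  have "complex_of_real (r ^ 2) = of_real (of_nat D)" using s2 sr by simp
  then have r2: "r ^ 2 = of_nat D" unfolding of_real_eq_iff .
  have rat: "Re a \<in> \<rat>" "Im a \<in> \<rat>" "Re b \<in> \<rat>" "Im b \<in> \<rat>" using ab unfolding QI_def by auto
  define z where "z = v * cnj (sg v)"
  define X where "X = Re a ^ 2 + Im a ^ 2 - of_nat D * (Re b ^ 2 + Im b ^ 2)"
  define Y where "Y = 2 * (Im b * Re a - Re b * Im a)"
  have XQ: "X \<in> \<rat>" "Y \<in> \<rat>" unfolding X_def Y_def using rat by auto
  have z: "z = Complex X (Y * r)"
    unfolding z_def sv unfolding ab(3) X_def Y_def sr r2[symmetric]
    by (simp add: complex_eq_iff power2_eq_square algebra_simps)
  have cn: "cmod \<epsilon> = 1" using n(2) by auto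
  have "cmod z = cmod v * cmod (sg v)" unfolding z_def by (simp add: norm_mult)
  also have "\<dots> = 1" using cn n(1) by (metis norm_mult)
  finally have "(cmod z) ^ 2 = 1" by simp
  then have norm1: "X ^ 2 + of_nat D * Y ^ 2 = 1"
    unfolding z cmod_power2 by (simp add: power_mult_distrib r2 mult.commute)
  have zint: "algebraic_int z" unfolding z_def using v sg.alg_int alg_int_mult by simp
  have "z + cnj z = of_real (2 * X)" unfolding z by (simp add: complex_eq_iff)
  moreover have "algebraic_int (z + cnj z)" using zint alg_int_add by simp
  ultimately obtain A where A: "2 * X = of_int A" using alg_int_rat[of "2 * X"] XQ by auto
  have D1: "real D \<ge> 1" using D0 by simp
  \<comment> \<open>Hence A is at most 2 in absolute value. A = \<plusminus>1 would leave 3 on the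
    right, excluded mod 4, and A = 0 would make sqrt D rational.\<close>
  have eqA: "real D * (2 * Y) ^ 2 = of_int (4 - A ^ 2)"
    using norm1 unfolding of_int_diff of_int_power A[symmetric] by (simp add: power_mult_distrib algebra_simps)
  have "0 \<le> real D * (2 * Y) ^ 2" by simp
  then have "A ^ 2 \<le> 4" unfolding eqA by linarith
  then have "\<bar>A\<bar> \<le> 2" using abs_le_square_iff[of A 2] by simp
  then have "A \<in> {-2,-1,0,1,2}" by auto
  moreover have "A \<noteq> 1" "A \<noteq> -1"
    using rat_square_mod_4[OF D _ eqA] XQ by auto
  moreover have "A \<noteq> 0"
  proof
    assume "A = 0"
    then have "(r * Y) ^ 2 = 1" using norm1 A by (simp add: power_mult_distrib r2)
    then have ry: "r * Y = 1 \<or> r * Y = -1" by (simp add: power2_eq_1_iff)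
    then have "Y \<noteq> 0" by auto
    then have "r = (r * Y) / Y" by simp
    moreover have "r * Y \<in> \<rat>" using ry by auto
    ultimately have "r \<in> \<rat>" using XQ(2) Rats_divide by metis
    then show False using sQ unfolding sr QI_def by simp
  qed
  ultimately have "A = 2 \<or> A = -2" by auto
  then have "X = 1 \<or> X = -1" "real D * (2 * Y) ^ 2 = 0" using A eqA by auto
  then have "X = 1 \<or> X = -1" "Y = 0" using D0 by auto
  then have z1: "z = 1 \<or> z = -1" unfolding z by (auto simp: complex_eq_iff)
  have v0: "v \<noteq> 0" using n by auto
  have ceps: "cnj \<epsilon> = - \<epsilon>" "\<epsilon> * \<epsilon> = -1" using n(2) by auto
  \<comment> \<open>As z = \<plusminus>1, this makes v equal to \<plusminus>\<i> times its complex
    conjugate, so v lies on one of the two diagonals of the complex plane.\<close>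
  have "cnj v * z = v * cnj (v * sg v)" unfolding z_def by simp
  also have "\<dots> = - \<epsilon> * v" unfolding n(1) ceps by simp
  finally have "\<epsilon> * v = - z * cnj v" by (simp add: mult.commute)
  then have "\<epsilon> * (\<epsilon> * v) = - z * \<epsilon> * cnj v" by (simp add: mult_ac)
  then have "v = z * \<epsilon> * cnj v" using ceps(2) by (simp add: mult.assoc[symmetric])
  moreover have "z * \<epsilon> = \<i> \<or> z * \<epsilon> = - \<i>" using z1 n(2) by auto
  ultimately have "v = \<i> * cnj v \<or> v = - \<i> * cnj v" by metis
  then have "Im v = Re v \<or> Im v = - Re v" by (auto simp: complex_eq_iff)
  then obtain \<delta> :: int where \<delta>: "\<delta> = 1 \<or> \<delta> = -1" "Im v = of_int \<delta> * Re v"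
    by (metis (no_types) mult_1 mult_minus_left of_int_1 of_int_minus)
  define t where "t = v + cnj v"
  have tre: "t = of_real (2 * Re v)" unfolding t_def by (simp add: complex_eq_iff)
  define e f where "e = 2 * Re a" and "f = 2 * Re b"
  have tef: "t = of_real e + of_real f * s" unfolding t_def ab e_def f_def sr by (simp add: complex_eq_iff)
  have efQ: "e \<in> \<rat>" "f \<in> \<rat>" unfolding e_def f_def using rat by auto
  have st: "sg t = of_real e - of_real f * s" unfolding tef using sgform efQ QI_rat by simp
  have tk: "t \<in> k" unfolding tef using efQ QI_rat adjI by blast
  have vt: "v = t * (1 + of_int \<delta> * \<i>) / 2" unfolding tre using \<delta>(2) by (simp add: complex_eq_iff)
  have dk: "(1 + of_int \<delta> * \<i>) / 2 \<in> QI" using QI_subfield QI_ii by (auto intro!: nfs)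
  have svt: "sg v = sg t * ((1 + of_int \<delta> * \<i>) / 2)"
    unfolding vt using sg.mult[OF tk, of "(1 + of_int \<delta> * \<i>) / 2"] sg_fix[OF dk] dk QIk by auto
  have "v * sg v = (t * sg t) * ((1 + of_int \<delta> * \<i>) / 2)^2"
    unfolding svt by (subst vt) (simp add: power2_eq_square)
  moreover have "((1 + of_int \<delta> * \<i>) / 2)^2 = of_int \<delta> * \<i> / 2" using \<delta>(1) by (auto simp: complex_eq_iff power2_eq_square)
  ultimately have tse: "t * sg t * (of_int \<delta> * \<i>) = 2 * \<epsilon>" using n(1) by (simp add: mult.commute)
  have "t * sg t = - (t * sg t * (of_int \<delta> * \<i>) * (of_int \<delta> * \<i>))" using \<delta>(1) by (auto simp: mult.assoc)
  then have tn: "t * sg t = 2 \<or> t * sg t = -2" unfolding tse using \<delta>(1) n(2) by (auto simp: mult.assoc)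
  have tst: "t * sg t = of_real (e ^ 2 - of_nat D * f ^ 2)"
    unfolding st unfolding tef sr r2[symmetric] by (simp add: algebra_simps power2_eq_square)
  obtain N :: int where N: "N = 2 \<or> N = -2" "e ^ 2 - of_nat D * f ^ 2 = of_int N"
  proof -
    have "complex_of_real (e ^ 2 - of_nat D * f ^ 2) = of_real 2 \<or> complex_of_real (e ^ 2 - of_nat D * f ^ 2) = of_real (-2)"
      using tn tst by simp
    then have "e ^ 2 - of_nat D * f ^ 2 = 2 \<or> e ^ 2 - of_nat D * f ^ 2 = -2" unfolding of_real_eq_iff .
    then show ?thesis using that[of 2] that[of "-2"] by auto
  qed
  have tint: "algebraic_int t" unfolding t_def using v alg_int_add by simp
  have "algebraic_int (t + sg t)" using tint tk sg.alg_int alg_int_add by blast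
  moreover have "t + sg t = of_real (2 * e)" unfolding st unfolding tef by simp
  ultimately obtain T where T: "2 * e = of_int T" using alg_int_rat[of "2 * e"] efQ by auto
  \<comment> \<open>w = t^2 / 2 is integral with trace W = e^2 + D f^2, while e^2 - D f^2 = N =
    \<plusminus>2. Then T^2 = 2 W + 2 N makes e an integer, and D f^2 = e^2 - N is 2 or 3 mod 4, a
    contradiction.\<close>
  define w where "w = v * cnj v"
  have wint: "algebraic_int w" unfolding w_def using v alg_int_mult by simp
  have "w = (t * t) * ((1 + of_int \<delta> * \<i>) * (1 - of_int \<delta> * \<i>) / 4)"
    unfolding w_def by (subst (1 2) vt) (simp add: tre)
  also have "(1 + of_int \<delta> * \<i>) * (1 - of_int \<delta> * \<i>) / 4 = (1 / 2 :: complex)" using \<delta>(1) by (auto simp: complex_eq_iff)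
  finally have w2: "w = t * t / 2" by simp
  have wk: "w \<in> k" unfolding w2 using tk k by (intro nfs) auto
  have sw: "sg w = sg t * sg t / 2" unfolding w2
    using sg.divide[of "t * t" 2] sg.mult[OF tk tk] sg.numeral nfs(4)[OF k tk tk] nf_subfield_numeral[OF k] by simp
  have "w + sg w = of_real (e ^ 2 + of_nat D * f ^ 2)"
    unfolding sw unfolding w2 unfolding st unfolding tef sr r2[symmetric] by (simp add: field_simps power2_eq_square)
  moreover have "algebraic_int (w + sg w)" using wint wk sg.alg_int alg_int_add by blast
  ultimately obtain W where W: "e ^ 2 + of_nat D * f ^ 2 = of_int W"
    using alg_int_rat[of "e ^ 2 + of_nat D * f ^ 2"] efQ by auto
  have "(of_int (T ^ 2) :: real) = (2 * e) ^ 2" unfolding T by simp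
  also have "\<dots> = 2 * (e ^ 2 + of_nat D * f ^ 2) + 2 * (e ^ 2 - of_nat D * f ^ 2)" by (simp add: power2_eq_square)
  also have "\<dots> = of_int (2 * W + 2 * N)" unfolding W N(2) by simp
  finally have "T ^ 2 = 2 * W + 2 * N" unfolding of_int_eq_iff .
  then have "even (T ^ 2)" by simp
  then obtain T' where T': "T = 2 * T'" by auto
  then have eT: "e = of_int T'" using T by simp
  have "of_nat D * f ^ 2 = of_int (T' ^ 2 - N)" using N(2) eT by simp
  then have "(T' ^ 2 - N) mod 4 = 0 \<or> (T' ^ 2 - N) mod 4 = 1" using rat_square_mod_4[OF D] efQ by blast
  then show False using N(1) int_square_mod_4[of T'] by (cases "even T'") presburger+
qed

section \<open>The negative Pell equation\<close>

lemma sqrt_rat_imp_square: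
  assumes "sqrt (real n) \<in> \<rat>" shows "\<exists>m. n = m ^ 2"
proof -
  have "algebraic_int (sqrt (real n))" by (intro algebraic_int_sqrt int_imp_algebraic_int) simp
  then have "sqrt (real n) \<in> \<int>" using assms rational_algebraic_int_is_int by blast
  then obtain j where j: "sqrt (real n) = of_int j" by (auto elim: Ints_cases)
  then have "real n = of_int j ^ 2" by (metis of_nat_0_le_iff real_sqrt_pow2)
  also have "\<dots> = real (nat \<bar>j\<bar> ^ 2)" by simp
  finally have "n = nat \<bar>j\<bar> ^ 2" unfolding of_nat_eq_iff .
  then show ?thesis by blast
qed

lemma prime_not_square: "prime p \<Longrightarrow> \<nexists>m. p = m ^ 2" for p :: nat
  by (auto simp: prime_power_iff)

text \<open>Finitely many approximations would have errors bounded below by some \<epsilon> > 0,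
  sqrt D being irrational; Dirichlet's theorem with 1/N < \<epsilon> produces one more.\<close>

lemma pell_approximations_infinite:
  fixes D :: nat
  assumes irr: "sqrt (real D) \<notin> \<rat>"
  shows "infinite {(h::int, k::int). k > 0 \<and> \<bar>of_int k * sqrt D - of_int h\<bar> < 1 / of_int k}" (is "infinite ?S")
proof
  assume fin: "finite ?S"
  define F where "F = (\<lambda>(h::int, k::int). \<bar>of_int k * sqrt D - of_int h\<bar>) ` ?S"
  have finF: "finite F" unfolding F_def using fin by simp
  have pos: "x > 0" if xF: "x \<in> F" for x
  proof -
    obtain h k :: int where hk: "k > 0" "x = \<bar>of_int k * sqrt D - of_int h\<bar>" using xF unfolding F_def by auto
    have "of_int k * sqrt D \<noteq> of_int h"
    proof
      assume "of_int k * sqrt D = of_int h"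
      then have "sqrt D = of_int h / of_int k" using hk(1) by (simp add: field_simps)
      then show False using irr by simp
    qed
    then show ?thesis using hk by simp
  qed
  have "\<exists>\<epsilon>>0. \<forall>x\<in>F. \<epsilon> \<le> x"
    using finF pos by (induction F rule: finite_induct) (auto intro: exI[of _ 1], metis less_le_trans min.cobounded1 min.cobounded2 min_less_iff_conj order.trans)
  then obtain \<epsilon> where e: "\<epsilon> > 0" "\<And>x. x \<in> F \<Longrightarrow> \<epsilon> \<le> x" by blast
  obtain N :: nat where N: "N > 0" "1 / real N < \<epsilon>"
    using e(1) by (metis nat_approx_posE zero_less_Suc)
  obtain h k where hk: "0 < k" "k \<le> int N" "\<bar>of_int k * sqrt D - of_int h\<bar> < 1 / N"
    using Dirichlet_approx[OF N(1)] by blast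
  have "(1::real) / N \<le> 1 / of_int k" using hk by (simp add: field_simps)
  then have "(h, k) \<in> ?S" using hk by simp
  then have "\<bar>of_int k * sqrt D - of_int h\<bar> \<in> F" unfolding F_def by force
  then show False using e hk N by fastforce
qed

text \<open>Dirichlet approximations have bounded norm h^2 - D k^2, so two distinct ones share the
  norm n and are congruent modulo n. Their quotient is the desired unit.\<close>

lemma pell_solution:
  fixes D :: nat
  assumes irr: "sqrt (real D) \<notin> \<rat>"
  obtains x y :: nat where "y > 0" "x ^ 2 = 1 + D * y ^ 2"
proof -
  define S where "S = {(h::int, k::int). k > 0 \<and> \<bar>of_int k * sqrt D - of_int h\<bar> < 1 / of_int k}"
  have inf: "infinite S" unfolding S_def using pell_approximations_infinite[OF irr] .
  define q where "q = (\<lambda>(h::int, k::int). h ^ 2 - int D * k ^ 2)"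
  \<comment> \<open>With d = h - k sqrt D the norm is d^2 + 2 d k sqrt D, and |d| k < 1 bounds it by
    1 + 2 sqrt D.\<close>
  define B where "B = \<lceil>2 * sqrt D + 1\<rceil>"
  have bound: "q a \<in> {-B..B}" if aS: "a \<in> S" for a
  proof -
    obtain h k where a: "a = (h, k)" "k > 0" "\<bar>of_int k * sqrt D - of_int h\<bar> < 1 / of_int k"
      using aS unfolding S_def by auto
    define d where "d = of_int h - of_int k * sqrt D"
    have d: "\<bar>d\<bar> * of_int k < 1" using a unfolding d_def by (simp add: field_simps abs_minus_commute)
    have k1: "of_int k \<ge> (1::real)" using a by simp
    have "\<bar>d\<bar> * 1 \<le> \<bar>d\<bar> * of_int k" using k1 by (intro mult_left_mono) auto
    then have d1: "\<bar>d\<bar> < 1" using d by linarith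
    have "real_of_int (q a) = d * (d + 2 * of_int k * sqrt D)"
      unfolding q_def a d_def by (simp add: algebra_simps power2_eq_square)
    then have "\<bar>real_of_int (q a)\<bar> = \<bar>d ^ 2 + 2 * (d * of_int k) * sqrt D\<bar>" by (simp add: algebra_simps power2_eq_square)
    also have "\<dots> \<le> \<bar>d\<bar> ^ 2 + 2 * (\<bar>d\<bar> * of_int k) * sqrt D"
      using abs_triangle_ineq[of "d^2" "2 * (d * of_int k) * sqrt D"] a(2) by (simp add: abs_mult)
    also have "\<dots> \<le> 1 + 2 * 1 * sqrt D"
      using d d1 abs_square_le_1[of d] by (intro add_mono mult_right_mono mult_left_mono) auto
    finally have "\<bar>real_of_int (q a)\<bar> \<le> of_int B" unfolding B_def by linarith
    then have "\<bar>q a\<bar> \<le> B" by linarith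
    then show ?thesis by auto
  qed
  have "finite (q ` S)" using bound by (meson finite_atLeastAtMost_int finite_subset image_subsetI)
  then obtain a0 where a0: "a0 \<in> S" "infinite {a \<in> S. q a = q a0}"
    using pigeonhole_infinite[OF inf] by blast
  define n where "n = q a0"
  have n0: "n \<noteq> 0"
  proof
    assume "n = 0"
    obtain h k where hk: "a0 = (h, k)" "k > 0" using a0(1) unfolding S_def by auto
    then have "h ^ 2 = int D * k ^ 2" using \<open>n = 0\<close> unfolding n_def q_def by simp
    then have "real_of_int (h ^ 2) = of_int (int D * k ^ 2)" by simp
    then have "real D = (of_int h / of_int k) ^ 2" using hk by (simp add: field_simps power_divide)
    then have "sqrt D = \<bar>of_int h / of_int k\<bar>" by (metis real_sqrt_abs)
    then show False using irr by simp
  qed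
  define S' where "S' = {a \<in> S. q a = n}"
  have inf': "infinite S'" using a0 unfolding S'_def n_def by simp
  define m where "m = (\<lambda>(h::int, k::int). (h mod n, k mod n))"
  \<comment> \<open>The norm n may be negative and a remainder takes the sign of n, hence the
    symmetric range.\<close>
  have "m ` S' \<subseteq> {-\<bar>n\<bar>..\<bar>n\<bar>} \<times> {-\<bar>n\<bar>..\<bar>n\<bar>}"
  proof -
    have "x mod n \<in> {-\<bar>n\<bar>..\<bar>n\<bar>}" for x :: int
      using n0 abs_mod_less[of n x] by auto
    then show ?thesis unfolding m_def by auto
  qed
  then have "finite (m ` S')" by (meson finite_atLeastAtMost_int finite_SigmaI finite_subset)
  then obtain a1 where a1: "a1 \<in> S'" "infinite {a \<in> S'. m a = m a1}"
    using pigeonhole_infinite[OF inf'] by blast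
  then have "infinite ({a \<in> S'. m a = m a1} - {a1})" by simp
  then obtain a2 where a2: "a2 \<in> S'" "m a2 = m a1" "a2 \<noteq> a1" using infinite_imp_nonempty by blast
  obtain h k h' k' where hk: "a1 = (h, k)" "a2 = (h', k')" by fastforce
  have pos: "k > 0" "k' > 0" and nn: "h ^ 2 - int D * k ^ 2 = n" "h' ^ 2 - int D * k' ^ 2 = n"
    using a1(1) a2(1) unfolding S'_def S_def q_def hk by auto
  have md: "n dvd h' - h" "n dvd k' - k" using a2(2) unfolding m_def hk by (auto simp: mod_eq_dvd_iff)
  have "n dvd h * h' - int D * k * k'"
  proof -
    have "h * h' - int D * k * k' = n + h * (h' - h) - int D * k * (k' - k)"
      unfolding nn(1)[symmetric] by (simp add: algebra_simps power2_eq_square)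
    then show ?thesis using md by (simp add: dvd_add dvd_diff dvd_mult)
  qed
  then obtain x where x: "h * h' - int D * k * k' = n * x" by blast
  have "n dvd h * k' - h' * k"
  proof -
    have "h * k' - h' * k = h * (k' - k) - (h' - h) * k" by (simp add: algebra_simps)
    then show ?thesis using md by (metis dvd_diff dvd_mult dvd_mult2)
  qed
  then obtain y where y: "h * k' - h' * k = n * y" by blast
  \<comment> \<open>The quotient of h + k sqrt D by h' + k' sqrt D is x - y sqrt D, of norm 1; the
    congruences modulo n made x and y integers.\<close>
  have "(n * x) ^ 2 - int D * (n * y) ^ 2 = (h ^ 2 - int D * k ^ 2) * (h' ^ 2 - int D * k' ^ 2)"
    unfolding x[symmetric] y[symmetric] by (simp add: algebra_simps power2_eq_square)
  then have "n ^ 2 * (x ^ 2 - int D * y ^ 2) = n ^ 2 * 1" unfolding nn by (simp add: algebra_simps power2_eq_square)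
  then have xy: "x ^ 2 = 1 + int D * y ^ 2" using n0 by simp
  have "y \<noteq> 0"
  proof
    assume "y = 0"
    then have e: "h * k' = h' * k" using y by simp
    have "n * k' ^ 2 = (h * k') ^ 2 - int D * (k * k') ^ 2" unfolding nn(1)[symmetric] by (simp add: algebra_simps power_mult_distrib)
    also have "\<dots> = n * k ^ 2" unfolding e nn(2)[symmetric] by (simp add: algebra_simps power_mult_distrib)
    finally have "k' ^ 2 = k ^ 2" using n0 by simp
    then have "k' = k" using pos by (simp add: power2_eq_iff)
    then have "h' = h" using e pos by simp
    then show False using a2(3) hk \<open>k' = k\<close> by simp
  qed
  have "int (nat \<bar>x\<bar> ^ 2) = int (1 + D * nat \<bar>y\<bar> ^ 2)" using xy by simp
  then have "nat \<bar>x\<bar> ^ 2 = 1 + D * nat \<bar>y\<bar> ^ 2" unfolding of_nat_eq_iff .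
  then show ?thesis using that[of "nat \<bar>y\<bar>" "nat \<bar>x\<bar>"] \<open>y \<noteq> 0\<close> by simp
qed

lemma coprime_mult_square:
  fixes a b c :: nat assumes "coprime a b" "a * b = c ^ 2"
  obtains d e where "a = d ^ 2" "b = e ^ 2"
proof -
  have "is_nth_power 2 (a * b)" using assms unfolding is_nth_power_def by blast
  then have "is_nth_power 2 a" "is_nth_power 2 b" using is_nth_power_mult_coprime_nat_iff[OF assms(1)] by blast+
  then show ?thesis using that unfolding is_nth_power_def by blast
qed

text \<open>Descent from a minimal solution of \<open>x\<^sup>2 = 1 + p y\<^sup>2\<close>.\<close>

lemma negative_pell:
  fixes p :: nat
  assumes p: "prime p" "p mod 4 = 1"
  obtains T U :: nat where "T ^ 2 + 1 = p * U ^ 2"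
proof -
  have irr: "sqrt (real p) \<notin> \<rat>" using sqrt_rat_imp_square prime_not_square[OF p(1)] by blast
  obtain x0 y0 where xy0: "y0 > 0" "x0 ^ 2 = 1 + p * y0 ^ 2" using pell_solution[OF irr] by blast
  define P where "P = (\<lambda>y. y > 0 \<and> (\<exists>x. x ^ 2 = 1 + p * y ^ 2))"
  have "P y0" unfolding P_def using xy0 by blast
  define y where "y = (LEAST y. P y)"
  have y: "P y" "\<And>z. P z \<Longrightarrow> y \<le> z" unfolding y_def using \<open>P y0\<close> by (auto intro: LeastI Least_le)
  obtain x where x: "x ^ 2 = 1 + p * y ^ 2" using y(1) unfolding P_def by blast
  have sq4: "z ^ 2 mod 4 = (if even z then 0 else 1)" for z :: nat
    using int_square_mod_4[of "int z"] by (auto simp flip: of_nat_power)  presburger+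
  have "p * y ^ 2 mod 4 = y ^ 2 mod 4" using p(2) by (metis mod_mult_left_eq mult_1)
  then have "x ^ 2 mod 4 = (1 + y ^ 2 mod 4) mod 4" unfolding x by (metis mod_add_right_eq)
  then have "odd x" "even y" using sq4[of x] sq4[of y] by (auto split: if_splits)
  then obtain a b where a: "x = 2 * a + 1" and b: "y = 2 * b" by (auto elim!: oddE evenE)
  have "4 * (a * (a + 1)) = 4 * (p * b ^ 2)" using x unfolding a b by (simp add: algebra_simps power2_eq_square)
  then have ab: "a * (a + 1) = p * b ^ 2" by simp
  have b0: "b > 0" using y(1) b unfolding P_def by simp
  have "p dvd a * (a + 1)" unfolding ab by simp
  \<comment> \<open>a and a + 1 are coprime, so apart from p both are squares. If p divides a + 1,
    this is the wanted equation d^2 + 1 = p e^2; otherwise e^2 = 1 + p d^2 with d < y contradicts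
    minimality.\<close>
  then consider "p dvd a + 1" | "p dvd a" using prime_dvd_mult_iff[OF p(1)] by blast
  then show ?thesis
  proof cases
    case 1
    then obtain a' where a': "a + 1 = p * a'" by blast
    have "a * a' = b ^ 2" using ab p(1) unfolding a' by (simp add: prime_gt_0_nat mult.left_commute)
    moreover have "coprime a a'" using a' by (metis coprime_Suc_right_nat Suc_eq_plus1 coprime_mult_right_iff)
    ultimately obtain d e where "a = d ^ 2" "a' = e ^ 2" using coprime_mult_square by blast
    then show ?thesis using that[of d e] a' by simp
  next
    case 2
    then obtain a' where a': "a = p * a'" by blast
    have "p * (a' * (a + 1)) = p * b ^ 2" using ab a' by (metis mult.assoc)
    then have ab': "a' * (a + 1) = b ^ 2" using prime_gt_0_nat[OF p(1)] by simp
    have "coprime a' (a + 1)" using a' by (metis coprime_Suc_right_nat Suc_eq_plus1 coprime_mult_left_iff)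
    then obtain d e where de: "a' = d ^ 2" "a + 1 = e ^ 2" using coprime_mult_square ab' by blast
    have "e ^ 2 = 1 + p * d ^ 2" using de a' by simp
    moreover have "d > 0" using b0 ab' de by (cases d) auto
    ultimately have "y \<le> d" using y(2)[of d] unfolding P_def by blast
    moreover have "d ^ 2 < y ^ 2"
    proof -
      have "y ^ 2 = 4 * (d ^ 2 * (a + 1))" unfolding de(1)[symmetric] ab' b by (simp add: power_mult_distrib)
      also have "\<dots> > d ^ 2" using \<open>d > 0\<close> by simp
      finally show ?thesis .
    qed
    ultimately have False by (meson not_le power_less_imp_less_base zero_le)
    then show ?thesis ..
  qed
qed

section \<open>Gaussian primes\<close>

lemma one_divide_unit: "a * b = 1 \<Longrightarrow> 1 / a = b" for a b :: complex
  by (simp add: divide_inverse inverse_unique)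

text \<open>T is even, so T + \<i> and T - \<i> are coprime with product p U^2. Dividing T + \<i> by
  the square of d = gcd(U, T + \<i>) leaves a factor of p, and Bezout relations take the place of
  unique factorisation.\<close>

lemma gaussian_prime_from_pell:
  fixes p T U :: nat
  assumes TU: "T ^ 2 + 1 = p * U ^ 2" and p: "p mod 4 = 1"
  obtains \<pi> d where "\<pi> \<in> ZI" "d \<in> ZI" "d \<noteq> 0" "of_nat T + \<i> = \<pi> * d ^ 2" "\<pi> * cnj \<pi> = of_nat p"
proof -
  define A B where "A = of_nat T + \<i>" and "B = of_nat T - \<i>"
  have AZ: "A \<in> ZI" "B \<in> ZI" "cnj A = B" "cnj B = A" unfolding A_def B_def by (auto intro!: zis)
  have AB: "A * B = of_nat (T ^ 2 + 1)" unfolding A_def B_def by (simp add: algebra_simps power2_eq_square)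
  then have ABU: "A * B = of_nat p * of_nat U ^ 2" unfolding TU by simp
  have "int T ^ 2 + 1 = int p * int U ^ 2" using TU by (metis of_nat_1 of_nat_add of_nat_mult of_nat_power)
  moreover have "int p mod 4 = 1" using p by presburger
  ultimately have "(int T ^ 2 + 1) mod 4 = int U ^ 2 mod 4" by (metis mod_mult_left_eq mult_1)
  then have evT: "even T" using int_square_mod_4[of "int T"] int_square_mod_4[of "int U"]
    by (cases "even T"; cases "even U") (simp_all, presburger+)
  then obtain e where e: "T ^ 2 = 2 * e" by (metis dvd_def even_power zero_less_numeral)
  \<comment> \<open>Since A - B = 2 \<i> and A B = 2 e + 1, the combination A B + e \<i> (A - B)
    equals 1.\<close>
  define x y where "x = B + of_nat e * \<i>" and "y = - of_nat e * \<i>"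
  have xy: "x \<in> ZI" "y \<in> ZI" unfolding x_def y_def using AZ by (auto intro!: zis)
  have "x * A + y * B = A * B + of_nat e * \<i> * (A - B)" unfolding x_def y_def by (simp add: algebra_simps)
  also have "\<dots> = 1" unfolding AB e unfolding A_def B_def by (simp add: algebra_simps)
  finally have one: "x * A + y * B = 1" .
  have UZ: "of_nat U \<in> ZI" by (rule zis)
  obtain d u v where d: "d \<in> ZI" "u \<in> ZI" "v \<in> ZI" "d = u * of_nat U + v * A"
    and q: "\<exists>q\<in>ZI. of_nat U = q * d" "\<exists>q\<in>ZI. A = q * d"
    by (rule ZI_gcd[OF UZ AZ(1)])
  obtain U1 where U1: "U1 \<in> ZI" "of_nat U = U1 * d" using q by blast
  obtain A1 where A1: "A1 \<in> ZI" "A = A1 * d" using q by blast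
  define \<pi> where "\<pi> = x * A1 ^ 2 + y * of_nat p * U1 ^ 2"
  have "A = A * (x * A + y * B)" using one by simp
  also have "\<dots> = x * A ^ 2 + y * (A * B)" by (simp add: algebra_simps power2_eq_square)
  also have "\<dots> = \<pi> * d ^ 2" unfolding ABU unfolding \<pi>_def U1(2) by (subst A1(2)) (simp add: algebra_simps power_mult_distrib)
  finally have A\<pi>: "A = \<pi> * d ^ 2" .
  have \<pi>Z: "\<pi> \<in> ZI" unfolding \<pi>_def using xy A1 U1 by (auto intro!: zis)
  \<comment> \<open>The norm c of d and U divide each other, so they differ by a Gaussian unit w;
    once w = 1, comparing p U^2 = A cnj(A) with the factorisation of A gives \<pi> the norm
    p.\<close>
  define c where "c = d * cnj d"
  have c: "c \<in> ZI" unfolding c_def using d(1) by (intro zis)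
  have cU: "of_nat U = cnj U1 * cnj d" using U1(2) by (metis complex_cnj_mult complex_cnj_of_nat)
  have BA: "B = cnj A1 * cnj d" using A1(2) AZ(3) by (metis complex_cnj_mult)
  have "of_nat U = of_nat U * (x * A) + of_nat U * (y * B)" using one by (metis distrib_left mult.right_neutral)
  also have "of_nat U * (x * A) = (cnj U1 * x * A1) * c" unfolding c_def cU by (subst A1(2)) simp
  also have "of_nat U * (y * B) = (U1 * y * cnj A1) * c" unfolding c_def U1(2) BA by simp
  finally have "of_nat U = (cnj U1 * x * A1 + U1 * y * cnj A1) * c" by (simp add: distrib_right)
  moreover have "cnj U1 * x * A1 + U1 * y * cnj A1 \<in> ZI" using U1 A1 xy by (auto intro!: zis)
  ultimately obtain w where w: "w \<in> ZI" "of_nat U = w * c" by blast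
  have dB: "cnj d = cnj u * of_nat U + cnj v * B" unfolding d(4) by (simp add: AZ)
  have "c = (u * of_nat U + v * A) * (cnj u * of_nat U + cnj v * B)" unfolding c_def dB using d(4) by simp
  also have "\<dots> = of_nat U * (u * cnj u * of_nat U + u * cnj v * B + v * cnj u * A) + v * cnj v * (A * B)"
    by (simp add: algebra_simps)
  also have "\<dots> = (u * cnj u * of_nat U + u * cnj v * B + v * cnj u * A + v * cnj v * of_nat p * of_nat U) * of_nat U"
    unfolding ABU by (simp add: algebra_simps power2_eq_square)
  moreover have "u * cnj u * of_nat U + u * cnj v * B + v * cnj u * A + v * cnj v * of_nat p * of_nat U \<in> ZI"
    using d AZ by (auto intro!: zis)
  ultimately obtain w' where w': "w' \<in> ZI" "c = w' * of_nat U" by metis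
  have U0: "U \<noteq> 0" using TU by (cases U) auto
  have "w * w' * of_nat U = 1 * of_nat U" using w(2) w'(2) by simp
  then have ww: "w * w' = 1" using U0 mult_right_cancel[of "of_nat U" "w * w'" 1] by simp
  then have w1: "1 / w = w'" "w \<noteq> 0" using one_divide_unit by auto
  then have wu: "w \<in> {1, -1, \<i>, -\<i>}" using ZI_unit w(1) w'(1) by metis
  have cre: "c = of_real ((cmod d)^2)" unfolding c_def using complex_norm_square[of d] by simp
  have d0: "d \<noteq> 0" using U1 U0 by auto
  \<comment> \<open>U and c = |d|^2 are positive reals, which leaves only w = 1 among the four
    units.\<close>
  have "Re (of_nat U) = Re w * (cmod d)^2" "Im (of_nat U) = Im w * (cmod d)^2" using w(2) unfolding cre by auto
  then have "Re w > 0" "Im w = 0" using U0 d0 by (auto simp: zero_less_mult_iff) (metis U0 norm_eq_zero of_nat_0_less_iff zero_less_mult_pos2 zero_less_norm_iff zero_less_power gr0I)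
  then have "w = 1" using wu by auto
  then have cU': "c = of_nat U" using w by simp
  have "of_nat p * of_nat U ^ 2 = A * cnj A" using ABU AZ by simp
  also have "\<dots> = \<pi> * cnj \<pi> * c ^ 2" unfolding A\<pi> c_def by (simp add: power_mult_distrib)
  finally have "\<pi> * cnj \<pi> = of_nat p" unfolding cU' using U0 by simp
  then show ?thesis using that \<pi>Z d(1) d0 A\<pi> unfolding A_def by blast
qed

lemma prime_gnorm_dvd:
  assumes q: "q \<in> ZI" "prime (gnorm q)" and xy: "x \<in> ZI" "y \<in> ZI" "x * y / q \<in> ZI"
  shows "x / q \<in> ZI \<or> y / q \<in> ZI"
proof -
  obtain d u v where d: "d \<in> ZI" "u \<in> ZI" "v \<in> ZI" "d = u * x + v * q"
    and ex: "\<exists>f\<in>ZI. x = f * d" "\<exists>e\<in>ZI. q = e * d"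
    by (rule ZI_gcd[OF xy(1) q(1)])
  obtain f where f: "f \<in> ZI" "x = f * d" using ex by blast
  obtain e where e: "e \<in> ZI" "q = e * d" using ex by blast
  have q0: "q \<noteq> 0" using q gnorm_0[of q] by auto
  have e0: "e \<noteq> 0" and d0: "d \<noteq> 0" using e q0 by auto
  have "prime (gnorm e * gnorm d)" using gnorm_mult[OF e(1) d(1)] e(2) q(2) by simp
  then consider "gnorm e = 1" | "gnorm d = 1" using prime_product by blast
  then show ?thesis
  proof cases
    case 1
    then have "e * cnj e = 1" using gnorm_cnj[OF e(1)] by simp
    then have "x = (f * cnj e) * q" unfolding f(2) e(2) by (simp add: algebra_simps)
    then have "x / q = f * cnj e" using q0 by simp
    then show ?thesis using zis(4)[OF f(1) zis(11)[OF e(1)]] by simp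
  next
    case 2
    then have dd: "d * cnj d = 1" using gnorm_cnj[OF d(1)] by simp
    have "y / q = cnj d * (d * y / q)" using dd by (simp add: algebra_simps)
    also have "d * y / q = u * (x * y / q) + v * y" unfolding d(4) using q0 by (simp add: field_simps)
    finally show ?thesis using zis(4)[OF zis(11)[OF d(1)] zis(3)[OF zis(4)[OF d(2) xy(3)] zis(4)[OF d(3) xy(2)]]] by simp
  qed
qed

text \<open>The inductive step for divisors of a product of primes: a divisor w of q w' either
  divides w' already or gives off one factor q.\<close>

lemma prime_gnorm_dvd_mult:
  assumes q: "q \<in> ZI" "prime (gnorm q)" and w: "w \<in> ZI" "w \<noteq> 0" "w' \<in> ZI" "q * w' / w \<in> ZI"
  shows "w' / w \<in> ZI \<or> (w / q \<in> ZI \<and> w' / (w / q) \<in> ZI)"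
proof -
  have "q \<noteq> 0" using q gnorm_0[of q] by auto
  then have "w / q \<in> ZI \<or> w' / w \<in> ZI"
    using prime_gnorm_dvd[OF q w(1,4)] w(2,3) by simp
  then show ?thesis using w(4) by (auto simp: mult.commute)
qed

section \<open>Elements that are squares up to units\<close>

text \<open>The unit u is taken among all algebraic integers; if w is in F and c is nonzero, then u
  = w / c^2 lies in F by itself.\<close>

definition unit_square :: "complex set \<Rightarrow> complex \<Rightarrow> bool" where
  "unit_square F w \<longleftrightarrow> (\<exists>u c. algebraic_int u \<and> algebraic_int (1 / u) \<and> u \<noteq> 0 \<and> c \<in> F \<and> w = u * c ^ 2)"

lemma unit_squareI: "algebraic_int u \<Longrightarrow> algebraic_int (1 / u) \<Longrightarrow> u \<noteq> 0 \<Longrightarrow> c \<in> F \<Longrightarrow> w = u * c ^ 2 \<Longrightarrow> unit_square F w"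
  unfolding unit_square_def by blast

lemma unit_square_mult:
  assumes "nf_subfield F" "unit_square F a" "unit_square F b" shows "unit_square F (a * b)"
proof -
  obtain u c u' c' where "algebraic_int u" "algebraic_int (1 / u)" "u \<noteq> 0" "c \<in> F" "a = u * c ^ 2"
    "algebraic_int u'" "algebraic_int (1 / u')" "u' \<noteq> 0" "c' \<in> F" "b = u' * c' ^ 2"
    using assms unfolding unit_square_def by metis
  then show ?thesis using alg_int_mult[of u u'] alg_int_mult[of "1 / u" "1 / u'"] assms(1) nfs(4)
    by (intro unit_squareI[of "u * u'" "c * c'"]) (auto simp: power_mult_distrib)
qed

lemma unit_square_inverse:
  assumes "nf_subfield F" "unit_square F a" shows "unit_square F (1 / a)"
proof -
  obtain u c where "algebraic_int u" "algebraic_int (1 / u)" "u \<noteq> 0" "c \<in> F" "a = u * c ^ 2"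
    using assms unfolding unit_square_def by metis
  then show ?thesis using assms(1) nfs(6)[of F c]
    by (intro unit_squareI[of "1 / u" "inverse c"]) (auto simp: field_simps)
qed

lemma unit_square_square: "nf_subfield F \<Longrightarrow> c \<in> F \<Longrightarrow> unit_square F (c ^ 2)"
  by (rule unit_squareI[of 1 c]) auto

text \<open>A divisor of a product of Gaussian primes is a unit times a subproduct; the induction
  peels off one prime at a time, ending with a Gaussian unit for the empty list.\<close>

lemma unit_square_divisor:
  assumes F: "nf_subfield F"
  shows "w \<in> ZI \<Longrightarrow> w \<noteq> 0 \<Longrightarrow> prod_list qs / w \<in> ZI \<Longrightarrow>
    (\<And>q. q \<in> set qs \<Longrightarrow> q \<in> ZI \<and> prime (gnorm q) \<and> unit_square F q) \<Longrightarrow> unit_square F w"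
proof (induction qs arbitrary: w)
  case Nil
  then show ?case using F nfs(2)
    by (intro unit_squareI[of w 1]) (auto intro: ZI_alg_int)
next
  case (Cons q qs)
  have pz: "prod_list ps \<in> ZI" if "set ps \<subseteq> ZI" for ps using that by (induction ps) (auto intro: zis)
  have q: "q \<in> ZI" "prime (gnorm q)" "unit_square F q" using Cons.prems by auto
  have q0: "q \<noteq> 0" using q gnorm_0[of q] by auto
  have "prod_list qs / w \<in> ZI \<or> (w / q \<in> ZI \<and> prod_list qs / (w / q) \<in> ZI)"
    using Cons.prems q by (intro prime_gnorm_dvd_mult pz) auto
  then show ?case
  proof
    assume "prod_list qs / w \<in> ZI"
    then show ?thesis using Cons by auto
  next
    assume "w / q \<in> ZI \<and> prod_list qs / (w / q) \<in> ZI"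
    then have "unit_square F (w / q)" using Cons q0 by auto
    then have "unit_square F (q * (w / q))" using q(3) unit_square_mult[OF F] by blast
    then show ?thesis using q0 by simp
  qed
qed

lemma unit_square_one_plus_ii:
  assumes F: "nf_subfield F" and "complex_of_real (sqrt 2) \<in> F" "\<i> \<in> F"
  shows "unit_square F (1 + \<i>)"
proof -
  define r where "r = complex_of_real (sqrt 2)"
  have r2: "r * r = 2" unfolding r_def by (simp flip: of_real_mult)
  have r0: "r \<noteq> 0" using r2 by auto
  have rint: "algebraic_int r" unfolding r_def by (intro algebraic_int_of_real algebraic_int_sqrt int_imp_algebraic_int) simp
  have unit: "(1 + r) * (r - 1) = 1" using r2 by (simp add: algebra_simps)
  have inv2: "1 / (r - 1) = 1 + r" using unit by (metis mult_zero_right nonzero_eq_divide_eq zero_neq_one)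
  \<comment> \<open>A primitive 8th root of unity. The unit in the result is r - 1, the inverse of 1
    + sqrt 2.\<close>
  define z where "z = (1 + \<i>) / r"
  have one: "algebraic_int (1 :: complex)" by (intro ZI_alg_int zis)
  have "(1 + z) ^ 2 * r ^ 2 = (r + (1 + \<i>)) ^ 2" unfolding z_def using r0 by (simp add: field_simps power2_eq_square)
  also have "\<dots> = (1 + \<i>) * (1 + r) * r ^ 2"
    using r2 by (simp add: power2_eq_square algebra_simps)
  finally have z2: "(1 + z) ^ 2 = (1 + \<i>) * (1 + r)" using r0 by simp
  have "1 + \<i> = (r - 1) * (1 + z) ^ 2" unfolding z2 using unit by (simp add: algebra_simps)
  moreover have "1 + z \<in> F" unfolding z_def r_def using assms by (auto intro!: nfs)
  moreover have "algebraic_int (r - 1)" "algebraic_int (1 / (r - 1))" "r - 1 \<noteq> 0"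
    using alg_int_diff[OF rint one] alg_int_add[OF one rint] unit by (auto simp: inv2)
  ultimately show ?thesis by (intro unit_squareI[of "r - 1" "1 + z"]) auto
qed

lemma unit_square_gaussian_prime:
  fixes p :: nat
  assumes p: "prime p" "p mod 4 = 1" and F: "nf_subfield F" "complex_of_real (sqrt p) \<in> F" "\<i> \<in> F"
  obtains \<pi> where "\<pi> \<in> ZI" "\<pi> * cnj \<pi> = of_nat p" "unit_square F \<pi>" "unit_square F (cnj \<pi>)"
proof -
  obtain T U :: nat where TU: "T ^ 2 + 1 = p * U ^ 2" using negative_pell[OF p] by blast
  obtain \<pi> d where \<pi>: "\<pi> \<in> ZI" "d \<in> ZI" "d \<noteq> 0" "of_nat T + \<i> = \<pi> * d ^ 2" "\<pi> * cnj \<pi> = of_nat p"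
    using gaussian_prime_from_pell[OF TU p(2)] by blast
  define r where "r = complex_of_real (sqrt p)"
  have r2: "r ^ 2 = of_nat p" unfolding r_def by (simp flip: of_real_power)
  have rint: "algebraic_int r" unfolding r_def by (intro algebraic_int_of_real algebraic_int_sqrt int_imp_algebraic_int) simp
  define \<epsilon> where "\<epsilon> = of_nat T + of_nat U * r"
  \<comment> \<open>The inverse of \<epsilon>, as p U^2 - T^2 = 1.\<close>
  define \<epsilon>' where "\<epsilon>' = of_nat U * r - of_nat T"
  have nat: "algebraic_int (of_nat n :: complex)" for n by (intro ZI_alg_int zis)
  have eint: "algebraic_int \<epsilon>" "algebraic_int \<epsilon>'" unfolding \<epsilon>_def \<epsilon>'_def
    using rint nat alg_int_add alg_int_mult alg_int_diff by auto
  have TU': "of_nat p * of_nat U ^ 2 = (of_nat T ^ 2 + 1 :: complex)" using TU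
    by (metis of_nat_1 of_nat_add of_nat_mult of_nat_power)
  have "\<epsilon> * \<epsilon>' = of_nat U ^ 2 * r ^ 2 - of_nat T ^ 2" unfolding \<epsilon>_def \<epsilon>'_def by (simp add: algebra_simps power2_eq_square)
  also have "\<dots> = 1" unfolding r2 using TU' by (simp add: algebra_simps)
  finally have ee: "\<epsilon> * \<epsilon>' = 1" .
  have "\<epsilon> ^ 2 = of_nat T ^ 2 + of_nat U ^ 2 * r ^ 2 + 2 * of_nat T * (of_nat U * r)"
    unfolding \<epsilon>_def by (simp add: algebra_simps power2_eq_square)
  also have "of_nat U ^ 2 * r ^ 2 = of_nat T ^ 2 + 1" unfolding r2 using TU' by (simp add: mult.commute)
  finally have e2: "\<epsilon> ^ 2 = 2 * of_nat T * \<epsilon> + 1" unfolding \<epsilon>_def by (simp add: algebra_simps power2_eq_square)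
  have i2: "(1 + \<i>) ^ 2 = 2 * \<i>" by (simp add: power2_eq_square algebra_simps)
  have i0: "1 + \<i> \<noteq> 0" by (simp add: complex_eq_iff)
  define c where "c = (1 + \<i> * \<epsilon>) / (1 + \<i>)"
  have "(1 + \<i> * \<epsilon>) ^ 2 = 1 + 2 * \<i> * \<epsilon> - \<epsilon> ^ 2" by (simp add: power2_eq_square algebra_simps)
  also have "\<dots> = 2 * \<i> * (\<i> * \<epsilon> * (of_nat T - \<i>))" unfolding e2 by (simp add: algebra_simps)
  finally have "c ^ 2 = \<i> * \<epsilon> * (of_nat T - \<i>)" unfolding c_def power_divide i2 by simp
  then have cT: "of_nat T - \<i> = (- \<i> * \<epsilon>') * c ^ 2" using ee by (simp add: algebra_simps)
  have "c \<in> F" unfolding c_def \<epsilon>_def r_def using F by (auto intro!: nfs)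
  moreover have "algebraic_int (- \<i> * \<epsilon>')" using alg_int_mult[OF _ eint(2), of "- \<i>"] by auto
  moreover have "1 / (- \<i> * \<epsilon>') = \<i> * \<epsilon>" by (rule one_divide_unit) (use ee in \<open>simp add: algebra_simps\<close>)
  then have "algebraic_int (1 / (- \<i> * \<epsilon>'))" using alg_int_mult[OF algebraic_int_ii eint(1)] by simp
  moreover have "- \<i> * \<epsilon>' \<noteq> 0" using ee by auto
  ultimately have uB: "unit_square F (of_nat T - \<i>)" using cT by (intro unit_squareI[of "- \<i> * \<epsilon>'" c]) auto
  have ZIF: "x \<in> F" if "x \<in> ZI" for x
  proof -
    have "x \<in> gen_field {\<i>}" using that ZI_QI gen_field_ii by blast
    then show ?thesis using F unfolding gen_field_def by blast
  qed
  have "cnj \<pi> = (of_nat T - \<i>) * (1 / (cnj d) ^ 2)"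
    using arg_cong[OF \<pi>(4), of cnj] \<pi>(3) by (simp add: field_simps)
  moreover have "unit_square F (1 / (cnj d) ^ 2)"
    using unit_square_inverse[OF F(1) unit_square_square[OF F(1) ZIF]] \<pi>(2) zis(11) by blast
  ultimately have u1: "unit_square F (cnj \<pi>)" using unit_square_mult[OF F(1) uB] by metis
  have p0: "cnj \<pi> \<noteq> 0" using \<pi>(5) p(1) by (auto simp: prime_gt_0_nat)
  \<comment> \<open>The identity for c^2 treats T - \<i>, hence cnj \<pi>; the other prime follows
    because the product p of the two is the square of r in F.\<close>
  then have "\<pi> = r ^ 2 * (1 / cnj \<pi>)" unfolding r2 \<pi>(5)[symmetric] by simp
  moreover have "unit_square F (r ^ 2)" using unit_square_square F unfolding r_def by blast
  ultimately have "unit_square F \<pi>" using unit_square_mult[OF F(1)] unit_square_inverse[OF F(1) u1] by metis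
  then show ?thesis using that \<pi> u1 by blast
qed

section \<open>Capitulation of ambiguous classes in the genus field\<close>

definition becomes_principal :: "complex set \<Rightarrow> complex set \<Rightarrow> bool" where
  "becomes_principal R I \<longleftrightarrow> (\<exists>c\<in>R - {0}. ideal_gen R I = (\<lambda>x. c * x) ` R)"

lemma ideal_gen_scale:
  assumes R: "subring_C R" and sub: "I \<subseteq> R" "J \<subseteq> R"
    and eq: "(\<lambda>x. a * x) ` I = (\<lambda>x. b * x) ` J" and x: "x \<in> ideal_gen R I"
  shows "\<exists>y\<in>ideal_gen R J. a * x = b * y"
proof -
  have G: "nf_ideal R (ideal_gen R J)" using ideal_gen_ideal[OF R sub(2)] .
  show ?thesis using x
  proof (rule ideal_gen_induct[where P = "\<lambda>x. \<exists>y\<in>ideal_gen R J. a * x = b * y"])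
    show "\<exists>y\<in>ideal_gen R J. a * 0 = b * y" using nf_idealD(2)[OF G] by (intro bexI[of _ 0]) auto
  next
    fix u assume "u \<in> I"
    then have "a * u \<in> (\<lambda>x. b * x) ` J" unfolding eq[symmetric] by blast
    then show "\<exists>y\<in>ideal_gen R J. a * u = b * y" using ideal_gen_base by blast
  next
    fix u v assume "\<exists>y\<in>ideal_gen R J. a * u = b * y" "\<exists>y\<in>ideal_gen R J. a * v = b * y"
    then obtain u' v' where "u' \<in> ideal_gen R J" "a * u = b * u'" "v' \<in> ideal_gen R J" "a * v = b * v'" by blast
    then show "\<exists>y\<in>ideal_gen R J. a * (u + v) = b * y"
      using nf_idealD(3)[OF G] by (intro bexI[of _ "u' + v'"]) (auto simp: distrib_left)
  next
    fix r u assume "r \<in> R" "\<exists>y\<in>ideal_gen R J. a * u = b * y"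
    then obtain u' where u': "u' \<in> ideal_gen R J" "a * u = b * u'" by blast
    have "a * (r * u) = b * (r * u')" using u'(2) by (metis mult.left_commute)
    then show "\<exists>y\<in>ideal_gen R J. a * (r * u) = b * y"
      using nf_idealD(4)[OF G \<open>r \<in> R\<close> u'(1)] by blast
  qed (use R sub in auto)
qed

lemma becomes_principal_equiv:
  assumes R: "subring_C R" and sub: "I \<subseteq> R" "J \<subseteq> R" and "ideal_equiv Rk I J" "becomes_principal R I"
  shows "becomes_principal R J"
proof -
  obtain a b where a: "a \<noteq> 0" "b \<noteq> 0" "(\<lambda>x. a * x) ` I = (\<lambda>x. b * x) ` J"
    using assms(4) by (rule ideal_equivE)
  obtain c where c: "c \<in> R" "c \<noteq> 0" "ideal_gen R I = (\<lambda>x. c * x) ` R"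
    using assms(5) unfolding becomes_principal_def by blast
  have G: "nf_ideal R (ideal_gen R J)" using ideal_gen_ideal[OF R sub(2)] .
  have "c \<in> ideal_gen R I" unfolding c(3) using subring_CD(2)[OF R] by (intro image_eqI[of _ _ 1]) auto
  then obtain d where d: "d \<in> ideal_gen R J" "a * c = b * d" using ideal_gen_scale[OF R sub a(3)] by blast
  have "ideal_gen R J = (\<lambda>x. d * x) ` R"
  proof
    show "(\<lambda>x. d * x) ` R \<subseteq> ideal_gen R J" using nf_idealD(5)[OF G _ d(1)] by blast
    show "ideal_gen R J \<subseteq> (\<lambda>x. d * x) ` R"
    proof
      fix y assume "y \<in> ideal_gen R J"
      then obtain x where x: "x \<in> ideal_gen R I" "b * y = a * x"
        using ideal_gen_scale[OF R sub(2,1) a(3)[symmetric]] by blast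
      then obtain r where r: "r \<in> R" "x = c * r" unfolding c(3) by blast
      have "b * y = b * (d * r)" unfolding x(2) r(2) using d(2) by (metis mult.assoc)
      then have "y = d * r" using a(2) by simp
      then show "y \<in> (\<lambda>x. d * x) ` R" using r(1) by blast
    qed
  qed
  moreover have "d \<noteq> 0" using d(2) a(1) c(2) by auto
  moreover have "d \<in> R" using d(1) nf_idealD(1)[OF G] by blast
  ultimately show ?thesis unfolding becomes_principal_def by blast
qed

lemma becomes_principal_mult:
  assumes R: "subring_C R" and Rk: "subring_C Rk" "Rk \<subseteq> R" and sub: "I \<subseteq> Rk" "J \<subseteq> Rk"
    and "becomes_principal R I" "becomes_principal R J"
  shows "becomes_principal R (ideal_mult Rk I J)"
proof -
  let ?M = "ideal_mult Rk I J"
  obtain c where c: "c \<in> R" "c \<noteq> 0" "ideal_gen R I = (\<lambda>x. c * x) ` R"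
    using assms(6) unfolding becomes_principal_def by blast
  obtain d where d: "d \<in> R" "d \<noteq> 0" "ideal_gen R J = (\<lambda>x. d * x) ` R"
    using assms(7) unfolding becomes_principal_def by blast
  have MR: "?M \<subseteq> R" using nf_idealD(1)[OF ideal_mult_ideal[OF Rk(1) sub]] Rk(2) by blast
  have G: "nf_ideal R (ideal_gen R ?M)" using ideal_gen_ideal[OF R MR] .
  have cd: "c * d \<in> R" using c d subring_CD(4)[OF R] by blast
  have IR: "I \<subseteq> R" "J \<subseteq> R" using sub Rk(2) by blast+
  have "ideal_gen R ?M \<subseteq> (\<lambda>x. c * d * x) ` R"
  proof (rule ideal_gen_least[OF nf_ideal_prin[OF R cd]])
    show "?M \<subseteq> (\<lambda>x. c * d * x) ` R"
    proof
      fix x assume "x \<in> ?M"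
      then show "x \<in> (\<lambda>x. c * d * x) ` R"
      proof (rule ideal_mult_induct[where P = "\<lambda>x. x \<in> (\<lambda>x. c * d * x) ` R"])
        fix a b assume "a \<in> I" "b \<in> J"
        then have "a \<in> (\<lambda>x. c * x) ` R" "b \<in> (\<lambda>x. d * x) ` R" using ideal_gen_base c(3) d(3) by blast+
        then obtain a' b' where "a = c * a'" "a' \<in> R" "b = d * b'" "b' \<in> R" by blast
        then show "a * b \<in> (\<lambda>x. c * d * x) ` R"
          using subring_CD(4)[OF R] by (intro image_eqI[of _ _ "a' * b'"]) auto
      next
        fix r x assume "r \<in> Rk" "x \<in> (\<lambda>x. c * d * x) ` R"
        then show "r * x \<in> (\<lambda>x. c * d * x) ` R" using Rk(2) nf_idealD(4)[OF nf_ideal_prin[OF R cd]] by blast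
      qed (use sub Rk(1) nf_idealD(2,3)[OF nf_ideal_prin[OF R cd]] in auto)
    qed
  qed
  moreover have "(\<lambda>x. c * d * x) ` R \<subseteq> ideal_gen R ?M"
  proof -
    have 1: "x * b \<in> ideal_gen R ?M" if "x \<in> ideal_gen R I" and b: "b \<in> J" for x b
      using that(1)
    proof (rule ideal_gen_induct[where P = "\<lambda>x. x * b \<in> ideal_gen R ?M"])
      fix a assume "a \<in> I"
      then have "a * b \<in> ?M" using b by (rule ideal_mult_base)
      then show "a * b \<in> ideal_gen R ?M" using ideal_gen_base by blast
    qed (use IR R nf_idealD[OF G] in \<open>auto simp: distrib_right mult.assoc\<close>)
    have "c \<in> ideal_gen R I" unfolding c(3) using subring_CD(2)[OF R] by (intro image_eqI[of _ _ 1]) auto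
    then have 2: "c * b \<in> ideal_gen R ?M" if "b \<in> J" for b using 1 that by blast
    have 3: "c * y \<in> ideal_gen R ?M" if "y \<in> ideal_gen R J" for y
      using that
    proof (rule ideal_gen_induct[where P = "\<lambda>y. c * y \<in> ideal_gen R ?M"])
      fix r y assume "r \<in> R" "c * y \<in> ideal_gen R ?M"
      then show "c * (r * y) \<in> ideal_gen R ?M" using nf_idealD(4)[OF G, of r "c * y"] by (simp add: mult.left_commute)
    qed (use IR R nf_idealD[OF G] 2 in \<open>auto simp: distrib_left\<close>)
    have "d \<in> ideal_gen R J" unfolding d(3) using subring_CD(2)[OF R] by (intro image_eqI[of _ _ 1]) auto
    then have "c * d \<in> ideal_gen R ?M" using 3 by blast
    then show ?thesis using nf_idealD(5)[OF G] by blast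
  qed
  ultimately show ?thesis using c d cd unfolding becomes_principal_def by (intro bexI[of _ "c * d"]) auto
qed

lemma capitulation_kernel_iff:
  assumes Rk: "subring_C Rk" and R: "subring_C R" "Rk \<subseteq> R" and I: "I \<in> nz_ideals Rk"
  shows "ideal_class Rk I \<in> capitulation_kernel Rk R \<longleftrightarrow> becomes_principal R I"
proof -
  define J where "J = (SOME J. J \<in> ideal_class Rk I)"
  have J: "J \<in> nz_ideals Rk" "ideal_equiv Rk I J" unfolding J_def using some_ideal_class[OF Rk I] by auto
  have sub: "I \<subseteq> R" "J \<subseteq> R" using I J R(2) nf_idealD(1) unfolding nz_ideals_def by blast+
  have "ideal_class Rk I \<in> capitulation_kernel Rk R \<longleftrightarrow> ideal_class R (ideal_gen R J) = ideal_class R R"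
    using I unfolding capitulation_kernel_def ext_class_def ideal_ext_def J_def by (auto simp: class_group_def)
  also have "\<dots> \<longleftrightarrow> becomes_principal R J"
    unfolding becomes_principal_def using ideal_class_one_iff[OF R(1) ideal_gen_ideal[OF R(1) sub(2)]] .
  also have "\<dots> \<longleftrightarrow> becomes_principal R I"
    using becomes_principal_equiv[OF R(1) sub J(2)] becomes_principal_equiv[OF R(1) sub(2,1) ideal_equiv_sym[OF J(2)]] by blast
  finally show ?thesis .
qed

text \<open>Induction over \<open>generate\<close>. The delicate case is the inverse of a generator:
  an invariant I satisfies I^2 = (g), so its class is an involution and equals its own
  inverse.\<close>

lemma (in gquad) Am_s_subset_capitulation_kernel:
  assumes F: "nf_subfield F" "k \<subseteq> F"
    and amb: "\<And>I. nf_ideal Ok I \<Longrightarrow> I \<noteq> {0} \<Longrightarrow> sg ` I = I \<Longrightarrow> becomes_principal (ring_of_integers F) I"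
  shows "Am_s k QI \<subseteq> capitulation_kernel Ok (ring_of_integers F)"
proof
  let ?R = "ring_of_integers F"
  have R: "subring_C ?R" "Ok \<subseteq> ?R" using ring_of_integers_subring[OF F(1)] F(2) by (auto simp: ring_of_integers_iff)
  note iff = capitulation_kernel_iff[OF O_ring R]
  have str: "\<exists>I\<in>nz_ideals Ok. X = ideal_class Ok I \<and> sg ` I = I" if "X \<in> strongly_ambiguous_classes k QI" for X
    using that sg_rel_aut unfolding strongly_ambiguous_classes_def by blast
  have strK: "X \<in> capitulation_kernel Ok ?R" if "X \<in> strongly_ambiguous_classes k QI" for X
    using str[OF that] amb iff by (auto simp: nz_ideals_def)
  fix X assume "X \<in> Am_s k QI"
  then show "X \<in> capitulation_kernel Ok ?R" unfolding Am_s_def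
  proof (induction rule: generate.induct)
    case one
    have "becomes_principal ?R Ok"
    proof -
      have "ideal_gen ?R Ok = ?R"
        using nf_ideal_one[OF ideal_gen_ideal[OF R]] ideal_gen_base[of Ok ?R] subring_CD(2)[OF O_ring] by blast
      then show ?thesis unfolding becomes_principal_def using subring_CD(2)[OF R(1)] by (intro bexI[of _ 1]) auto
    qed
    then show ?case using iff[OF R_nz[OF O_ring]] by (simp add: class_group_def)
  next
    case (incl h)
    then show ?case using strK by blast
  next
    case (inv h)
    obtain I where I: "I \<in> nz_ideals Ok" "h = ideal_class Ok I" "sg ` I = I" using str[OF inv] by blast
    then have I': "nf_ideal Ok I" "I \<noteq> {0}" "I \<subseteq> Ok" using nf_idealD(1) by (auto simp: nz_ideals_def)
    obtain g where g: "g \<in> ZI" "g \<noteq> 0" "g \<in> ideal_mult Ok I I" "\<And>x y. x \<in> I \<Longrightarrow> y \<in> I \<Longrightarrow> x * y / g \<in> Ok"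
      using ambiguous_ideal_square[OF I'(1,2) I(3)] by metis
    have M: "nf_ideal Ok (ideal_mult Ok I I)" using ideal_mult_ideal[OF O_ring I'(3,3)] .
    have "ideal_mult Ok I I = (\<lambda>x. g * x) ` Ok"
    proof
      show "ideal_mult Ok I I \<subseteq> (\<lambda>x. g * x) ` Ok"
      proof (rule ideal_mult_least[OF O_ring I'(3,3) nf_ideal_prin[OF O_ring ZIO[OF g(1)]]])
        fix a b assume "a \<in> I" "b \<in> I"
        then show "a * b \<in> (\<lambda>x. g * x) ` Ok" using g(2,4) by (intro image_eqI[of _ _ "a * b / g"]) auto
      qed
      show "(\<lambda>x. g * x) ` Ok \<subseteq> ideal_mult Ok I I" using nf_idealD(5)[OF M _ g(3)] by blast
    qed
    then have "ideal_class Ok (ideal_mult Ok I I) = ideal_class Ok Ok"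
      using ideal_class_one_iff[OF O_ring M] g(2) ZIO[OF g(1)] by blast
    then have "inv\<^bsub>class_group Ok\<^esub> h = h" using class_group_inv_involution[OF O_ring I(1)] I(2) by simp
    then show ?case using strK[OF inv] by simp
  next
    case (eng h1 h2)
    obtain I J where IJ: "I \<in> nz_ideals Ok" "h1 = ideal_class Ok I" "J \<in> nz_ideals Ok" "h2 = ideal_class Ok J"
      using eng.IH unfolding capitulation_kernel_def by (auto simp: class_group_def)
    then have "becomes_principal ?R I" "becomes_principal ?R J" using eng.IH iff by auto
    then have "becomes_principal ?R (ideal_mult Ok I J)"
      using becomes_principal_mult[OF R(1) O_ring R(2)] IJ nf_idealD(1) by (simp add: nz_ideals_def)
    then show ?case using iff[OF ideal_mult_nz[OF O_ring IJ(1,3)]] class_group_mult[OF O_ring IJ(1,3)] IJ by simp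
  qed
qed

text \<open>With g = u c^2 the relation I^2 = (g) suggests that I becomes (c). Indeed (x/c)^2 = u
  x^2 / g is integral for x in I, and conversely g / c = u c lies in the extended ideal, where u is
  a unit.\<close>

lemma becomes_principal_if_square:
  assumes F: "nf_subfield F" and R: "subring_C Rk" "Rk \<subseteq> ring_of_integers F" and I: "nf_ideal Rk I"
    and g: "g \<in> ideal_mult Rk I I" "\<And>x y. x \<in> I \<Longrightarrow> y \<in> I \<Longrightarrow> algebraic_int (x * y / g)" "g \<noteq> 0"
    and sq: "unit_square F g" and gi: "algebraic_int g"
  shows "becomes_principal (ring_of_integers F) I"
proof -
  let ?R = "ring_of_integers F"
  have RF: "subring_C ?R" using ring_of_integers_subring[OF F] .
  obtain u c where u: "algebraic_int u" "algebraic_int (1 / u)" "u \<noteq> 0" "c \<in> F" "g = u * c ^ 2"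
    using sq unfolding unit_square_def by blast
  have c0: "c \<noteq> 0" using g(3) u(5) by auto
  have "c ^ 2 = g * (1 / u)" using u by simp
  then have "algebraic_int (c ^ 2)" using alg_int_mult[OF gi u(2)] by simp
  then have cR: "c \<in> ?R" using alg_int_sqrt u(4) ring_of_integers_iff by blast
  have IR: "I \<subseteq> ?R" "I \<subseteq> Rk" using nf_idealD(1)[OF I] R(2) by blast+
  have div: "x / c \<in> ?R" if xI: "x \<in> I" for x
  proof -
    have "(x / c) ^ 2 = u * (x * x / g)" unfolding u(5) using u(3) by (simp add: power2_eq_square)
    then have "algebraic_int ((x / c) ^ 2)" using alg_int_mult[OF u(1) g(2)[OF xI xI]] by simp
    moreover have "x / c \<in> F" using IR xI u(4) nfs(8)[OF F] ring_of_integers_iff by blast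
    ultimately show ?thesis using alg_int_sqrt ring_of_integers_iff by blast
  qed
  have G: "nf_ideal ?R (ideal_gen ?R I)" using ideal_gen_ideal[OF RF IR(1)] .
  have "ideal_gen ?R I = (\<lambda>x. c * x) ` ?R"
  proof
    show "ideal_gen ?R I \<subseteq> (\<lambda>x. c * x) ` ?R"
    proof (rule ideal_gen_least[OF nf_ideal_prin[OF RF cR]])
      show "I \<subseteq> (\<lambda>x. c * x) ` ?R"
      proof
        fix x assume "x \<in> I"
        then show "x \<in> (\<lambda>x. c * x) ` ?R" using div c0 by (intro image_eqI[of _ _ "x / c"]) auto
      qed
    qed
    have "g / c \<in> ideal_gen ?R I"
      using g(1)
    proof (rule ideal_mult_induct[where P = "\<lambda>z. z / c \<in> ideal_gen ?R I"])
      fix a b assume "a \<in> I" "b \<in> I"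
      then have "(b / c) * a \<in> ideal_gen ?R I" using nf_idealD(4)[OF G div] ideal_gen_base by blast
      then show "a * b / c \<in> ideal_gen ?R I" by (simp add: mult.commute)
    next
      fix a b assume "a / c \<in> ideal_gen ?R I" "b / c \<in> ideal_gen ?R I"
      then show "(a + b) / c \<in> ideal_gen ?R I" using nf_idealD(3)[OF G] by (simp add: add_divide_distrib)
    next
      fix r a assume "r \<in> Rk" "a / c \<in> ideal_gen ?R I"
      then show "r * a / c \<in> ideal_gen ?R I" using nf_idealD(4)[OF G, of r "a / c"] R(2) by auto
    qed (use R(1) IR nf_idealD(2)[OF G] in auto)
    moreover have "g / c = u * c" unfolding u(5) using c0 by (simp add: power2_eq_square)
    moreover have "1 / u \<in> ?R"
    proof -
      have "u = g / c ^ 2" unfolding u(5) using c0 by simp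
      moreover have "g \<in> F" using g(1) nf_idealD(1)[OF ideal_mult_ideal[OF R(1) IR(2,2)]] R(2) ring_of_integers_iff by blast
      ultimately have "1 / u \<in> F" using nfs(2,8)[OF F] nf_subfield_power[OF F u(4)] by metis
      then show ?thesis using u(2) ring_of_integers_iff by blast
    qed
    ultimately have "(1 / u) * (u * c) \<in> ideal_gen ?R I" using nf_idealD(4)[OF G] by metis
    then have "c \<in> ideal_gen ?R I" using u(3) by simp
    then show "(\<lambda>x. c * x) ` ?R \<subseteq> ideal_gen ?R I" using nf_idealD(5)[OF G] by blast
  qed
  then show ?thesis unfolding becomes_principal_def using cR c0 by blast
qed

lemma prime_gnorm_if: "x \<in> ZI \<Longrightarrow> x * cnj x = of_nat p \<Longrightarrow> prime p \<Longrightarrow> prime (gnorm x)"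
  using gnorm_cnj[of x] by (metis of_nat_eq_iff)

lemma (in gquad) ambiguous_ideal_becomes_principal:
  fixes p1 p2 :: nat
  assumes D: "D = 2 * p1 * p2" and p: "prime p1" "prime p2" "p1 mod 4 = 1" "p2 mod 4 = 1"
    and F: "nf_subfield F" "k \<subseteq> F" "complex_of_real (sqrt 2) \<in> F" "complex_of_real (sqrt p1) \<in> F"
      "complex_of_real (sqrt p2) \<in> F" "\<i> \<in> F"
    and I: "nf_ideal Ok I" "I \<noteq> {0}" "sg ` I = I"
  shows "becomes_principal (ring_of_integers F) I"
proof -
  obtain g t w where g: "g \<in> ZI" "g \<noteq> 0" "g \<in> ideal_mult Ok I I" "\<And>x y. x \<in> I \<Longrightarrow> y \<in> I \<Longrightarrow> x * y / g \<in> Ok"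
    and t: "t \<in> ZI" "t \<noteq> 0" and w: "w \<in> ZI" "t^2 = g * w" "4 * of_nat D ^ 2 / w \<in> ZI"
    using ambiguous_ideal_square[OF I] by blast
  have w0: "w \<noteq> 0" using t w by auto
  obtain a where a: "a \<in> ZI" "a * cnj a = of_nat p1" "unit_square F a" "unit_square F (cnj a)"
    using unit_square_gaussian_prime[OF p(1,3) F(1,4,6)] by blast
  obtain b where b: "b \<in> ZI" "b * cnj b = of_nat p2" "unit_square F b" "unit_square F (cnj b)"
    using unit_square_gaussian_prime[OF p(2,4) F(1,5,6)] by blast
  \<comment> \<open>Prime factors of 4 D^2 = 16 p1^2 p2^2: the eighth power of 1 + \<i> is 16, and
    the conjugate pairs give p1 and p2, each squared.\<close>
  define qs where "qs = replicate 8 (1 + \<i>) @ [a, a, cnj a, cnj a, b, b, cnj b, cnj b]"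
  have "(1 + \<i>) ^ 8 = ((1 + \<i>) ^ 2) ^ 4" by (simp flip: power_mult)
  also have "(1 + \<i>) ^ 2 = 2 * \<i>" by (simp add: power2_eq_square algebra_simps)
  also have "(2 * \<i>) ^ 4 = 16" by (simp add: power_mult_distrib)
  finally have i8: "(1 + \<i>) ^ 8 = 16" .
  have "prod_list qs = (1 + \<i>) ^ 8 * ((a * cnj a) ^ 2 * (b * cnj b) ^ 2)"
    unfolding qs_def by (simp add: prod_list_replicate power2_eq_square mult_ac)
  also have "\<dots> = 4 * of_nat D ^ 2" unfolding i8 a(2) b(2) D by (simp add: power_mult_distrib)
  finally have prod: "prod_list qs = 4 * of_nat D ^ 2" .
  have "unit_square F w"
  proof (rule unit_square_divisor[OF F(1) w(1) w0])
    show "prod_list qs / w \<in> ZI" unfolding prod by (rule w(3))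
    have i: "1 + \<i> \<in> ZI" by (intro zis)
    have "prime (gnorm (1 + \<i>))" by (rule prime_gnorm_if[OF i, of 2]) (simp_all add: complex_eq_iff)
    moreover have "prime (gnorm a)" "prime (gnorm (cnj a))" "prime (gnorm b)" "prime (gnorm (cnj b))"
      using a b p prime_gnorm_if zis(11) by (auto simp: mult.commute)
    ultimately show "\<And>q. q \<in> set qs \<Longrightarrow> q \<in> ZI \<and> prime (gnorm q) \<and> unit_square F q"
      using a b i zis(11) unit_square_one_plus_ii[OF F(1,3,6)] unfolding qs_def by auto
  qed
  then have "unit_square F (t ^ 2 * (1 / w))"
    using unit_square_mult[OF F(1) unit_square_square[OF F(1)] unit_square_inverse[OF F(1)]] ZIk[OF t(1)] F(2) by blast
  moreover have "t ^ 2 * (1 / w) = g" using w(2) w0 by simp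
  ultimately have sq: "unit_square F g" by simp
  show ?thesis
  proof (rule becomes_principal_if_square[OF F(1) O_ring _ I(1) g(3) _ g(2) sq])
    show "Ok \<subseteq> ring_of_integers F" using F(2) by (auto simp: ring_of_integers_iff)
    show "algebraic_int g" using ZI_alg_int g(1) by blast
  qed (use g(4) O_iff in auto)
qed

section \<open>Ramification\<close>

text \<open>Maximality is stated as invertibility modulo Q, the form from which both primality and
  cancellation modulo Q^2 follow directly.\<close>

locale max_ideal =
  fixes R Q :: "complex set"
  assumes R: "subring_C R" and Q: "nf_ideal R Q" and one: "1 \<notin> Q"
    and max: "\<And>x. x \<in> R \<Longrightarrow> x \<notin> Q \<Longrightarrow> \<exists>r\<in>R. \<exists>q\<in>Q. r * x + q = 1"
begin

lemma prime: assumes "a \<in> R" "b \<in> R" "a * b \<in> Q" shows "a \<in> Q \<or> b \<in> Q"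
proof (rule ccontr)
  assume "\<not> (a \<in> Q \<or> b \<in> Q)"
  then obtain r q where rq: "r \<in> R" "q \<in> Q" "r * a + q = 1" using max assms by blast
  have "b = b * (r * a + q)" using rq by simp
  also have "\<dots> = r * (a * b) + q * b" by (simp add: algebra_simps)
  also have "\<dots> \<in> Q" using nf_idealD(3)[OF Q nf_idealD(4)[OF Q rq(1) assms(3)] nf_idealD(5)[OF Q assms(2) rq(2)]] .
  finally show False using \<open>\<not> (a \<in> Q \<or> b \<in> Q)\<close> by blast
qed

lemma QR: "x \<in> Q \<Longrightarrow> x \<in> R" using nf_idealD(1)[OF Q] by blast

lemma QQ: "nf_ideal R (ideal_mult R Q Q)"
  using ideal_mult_ideal[OF R] nf_idealD(1)[OF Q] by blast

lemma square_mem: "x \<in> Q \<Longrightarrow> x ^ 2 \<in> ideal_mult R Q Q"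
  using ideal_mult_base[of x Q x Q R] by (simp add: power2_eq_square)

text \<open>A substitute for localising at Q: with r j + q = 1, x is the sum of r (j x) and q x,
  both in Q^2.\<close>

lemma cancel:
  assumes "x \<in> Q" "j \<in> R" "j \<notin> Q" "j * x \<in> ideal_mult R Q Q"
  shows "x \<in> ideal_mult R Q Q"
proof -
  obtain r q where rq: "r \<in> R" "q \<in> Q" "r * j + q = 1" using max assms by blast
  have "x = (r * j + q) * x" using rq by simp
  also have "\<dots> = r * (j * x) + q * x" by (simp add: algebra_simps)
  also have "\<dots> \<in> ideal_mult R Q Q"
    using nf_idealD(3)[OF QQ] nf_idealD(4)[OF QQ rq(1) assms(4)] ideal_mult_base[OF rq(2) assms(1)] by blast
  finally show ?thesis .
qed

end

lemma max_ideal_exists: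
  assumes R: "subring_C R" and a: "a \<in> R" "\<And>r. r \<in> R \<Longrightarrow> a * r \<noteq> 1"
  obtains Q where "max_ideal R Q" "a \<in> Q"
proof -
  define A where "A = {I. nf_ideal R I \<and> a \<in> I \<and> 1 \<notin> I}"
  have "(\<lambda>x. a * x) ` R \<in> A"
    unfolding A_def using nf_ideal_prin[OF R a(1)] a(2) subring_CD(2)[OF R] by force
  then have ne: "A \<noteq> {}" by blast
  have "\<exists>M\<in>A. \<forall>X\<in>A. M \<subseteq> X \<longrightarrow> X = M"
  proof (rule subset_Zorn_nonempty[OF ne])
    fix C assume C: "C \<noteq> {}" "subset.chain A C"
    have CA: "C \<subseteq> A" and lin: "\<And>X Y. X \<in> C \<Longrightarrow> Y \<in> C \<Longrightarrow> X \<subseteq> Y \<or> Y \<subseteq> X"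
      using C(2) unfolding subset.chain_def by auto
    have "nf_ideal R (\<Union>C)" unfolding nf_ideal_def
    proof (intro conjI ballI)
      show "\<Union>C \<subseteq> R" using CA nf_idealD(1) unfolding A_def by blast
      show "0 \<in> \<Union>C" using C(1) CA nf_idealD(2) unfolding A_def by blast
      fix x assume "x \<in> \<Union>C" then obtain X where X: "X \<in> C" "x \<in> X" by blast
      { fix y assume "y \<in> \<Union>C" then obtain Y where Y: "Y \<in> C" "y \<in> Y" by blast
        obtain Z where Z: "Z \<in> C" "x \<in> Z" "y \<in> Z" using lin[OF X(1) Y(1)] X Y by blast
        then have "x + y \<in> Z" using CA nf_idealD(3) unfolding A_def by blast
        then show "x + y \<in> \<Union>C" using Z by blast }
      fix r assume "r \<in> R"
      then have "r * x \<in> X" using X CA nf_idealD(4) unfolding A_def by blast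
      then show "r * x \<in> \<Union>C" using X by blast
    qed
    then show "\<Union>C \<in> A" using CA C(1) unfolding A_def by blast
  qed
  then obtain Q where Q: "Q \<in> A" "\<And>X. X \<in> A \<Longrightarrow> Q \<subseteq> X \<Longrightarrow> X = Q" by blast
  have QI: "nf_ideal R Q" "a \<in> Q" "1 \<notin> Q" using Q(1) unfolding A_def by auto
  have "max_ideal R Q"
  proof
    fix x assume x: "x \<in> R" "x \<notin> Q"
    define J where "J = {r * x + q | r q. r \<in> R \<and> q \<in> Q}"
    have JI: "r * x + q \<in> J" if "r \<in> R" "q \<in> Q" for r q using that unfolding J_def by blast
    note D = subring_CD[OF R] nf_idealD[OF QI(1)]
    have "nf_ideal R J" unfolding nf_ideal_def
    proof (intro conjI ballI)
      show "J \<subseteq> R"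
      proof
        fix y assume "y \<in> J"
        then obtain r q where y: "r \<in> R" "q \<in> Q" "y = r * x + q" unfolding J_def by blast
        show "y \<in> R" unfolding y(3) using D(3)[OF D(4)[OF y(1) x(1)] subsetD[OF D(7) y(2)]] .
      qed
      show "0 \<in> J" using JI[OF D(1) D(8)] by simp
      fix y assume "y \<in> J" then obtain r q where y: "r \<in> R" "q \<in> Q" "y = r * x + q" unfolding J_def by blast
      { fix z assume "z \<in> J" then obtain r' q' where z: "r' \<in> R" "q' \<in> Q" "z = r' * x + q'" unfolding J_def by blast
        have "(r + r') * x + (q + q') \<in> J" using JI[OF D(3)[OF y(1) z(1)] D(9)[OF y(2) z(2)]] .
        then show "y + z \<in> J" using y z by (simp add: algebra_simps) }
      fix c assume c: "c \<in> R"
      have "(c * r) * x + c * q \<in> J" using JI[OF D(4)[OF c y(1)] D(10)[OF c y(2)]] .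
      then show "c * y \<in> J" using y by (simp add: algebra_simps)
    qed
    moreover have QJ: "Q \<subseteq> J" using JI[OF D(1)] by auto
    moreover have "x \<in> J" using JI[OF D(2) D(8)] by simp
    ultimately have "1 \<in> J" using Q(2)[of J] QI x unfolding A_def by blast
    then obtain r q where "r \<in> R" "q \<in> Q" "1 = r * x + q" unfolding J_def by blast
    then show "\<exists>r\<in>R. \<exists>q\<in>Q. r * x + q = 1" by metis
  qed (use R QI in auto)
  then show ?thesis using that QI by blast
qed

text \<open>Every \<open>y \<in> Q \<inter> O\<close> lies in \<open>Q\<^sup>2\<close>: if the trace of \<open>y\<close> is not in \<open>Q\<close>, cancel \<open>\<sigma>(y)\<close> in the norm;
  otherwise \<open>\<pi>\<close> divides both terms of \<open>2 D y = D (y + \<sigma>(y)) + s ((y - \<sigma>(y)) s)\<close>.\<close>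

lemma (in gquad) not_unramifiedI:
  assumes K: "nf_subfield K" "k \<subseteq> K" and Q: "max_ideal (ring_of_integers K) Q"
    and \<pi>: "\<pi> \<in> ZI" "\<pi> \<noteq> 0" "\<And>x. x \<in> ZI \<Longrightarrow> x \<in> Q \<Longrightarrow> \<exists>q\<in>ZI. x = q * \<pi>"
    and \<pi>2: "\<pi> \<in> ideal_mult (ring_of_integers K) Q Q" and two: "2 \<notin> Q"
    and s: "s \<notin> Q \<or> (s \<in> ideal_mult (ring_of_integers K) Q Q \<and> (\<exists>e\<in>ZI. e \<notin> Q \<and> of_nat D = \<pi> * e))"
  shows "\<not> unramified k K"
proof -
  let ?R = "ring_of_integers K"
  let ?QQ = "ideal_mult ?R Q Q"
  interpret max_ideal ?R Q by (rule Q)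
  have QQsub: "x \<in> Q" if "x \<in> ?QQ" for x
    using ideal_mult_least[OF R nf_idealD(1)[OF local.Q] nf_idealD(1)[OF local.Q] local.Q] QR nf_idealD(4)[OF local.Q] that by blast
  have OR: "x \<in> ?R" if "x \<in> Ok" for x using that K(2) O_iff ring_of_integers_iff by blast
  have ZR: "x \<in> ?R" if "x \<in> ZI" for x using that ZIO OR by blast
  note qq = nf_idealD[OF QQ]
  \<comment> \<open>The prime of k below Q. Once P lies in Q^2, so does its extension to K, and
    \<open>unramified\<close> fails.\<close>
  define P where "P = Q \<inter> Ok"
  have P: "nf_ideal Ok P" unfolding nf_ideal_def P_def
    using nf_idealD[OF local.Q] subring_CD[OF O_ring] OR by auto
  have "nf_prime Ok P" unfolding nf_prime_def
  proof (intro conjI ballI impI P)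
    have "\<pi> \<in> P" unfolding P_def using \<pi>2 QQsub ZIO \<pi>(1) by blast
    then show "P \<noteq> {0}" using \<pi>(2) by blast
    show "P \<noteq> Ok" unfolding P_def using one subring_CD(2)[OF O_ring] by blast
    fix a b assume "a \<in> Ok" "b \<in> Ok" "a * b \<in> P"
    then show "a \<in> P \<or> b \<in> P" using prime[of a b] OR unfolding P_def by blast
  qed
  moreover have "nf_prime ?R Q" unfolding nf_prime_def
  proof (intro conjI ballI impI local.Q prime)
    have "\<pi> \<in> Q" using \<pi>2 QQsub by blast
    then show "Q \<noteq> {0}" using \<pi>(2) by blast
    show "Q \<noteq> ?R" using one subring_CD(2)[OF R] by blast
  qed
  moreover have "P \<subseteq> ?QQ"
  proof
    fix y assume "y \<in> P"
    then have y: "y \<in> Q" "y \<in> Ok" unfolding P_def by auto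
    define t n W where "t = y + sg y" and "n = y * sg y" and "W = (y - sg y) * s"
    have Z: "t \<in> ZI" "n \<in> ZI" "W \<in> ZI" unfolding t_def n_def W_def using tr_norm_ZI[OF y(2)] by auto
    have sy: "sg y \<in> ?R" using sg_O[OF y(2)] OR by blast
    have "n \<in> Q" unfolding n_def using nf_idealD(5)[OF local.Q sy y(1)] .
    then obtain n' where n': "n' \<in> ZI" "n = n' * \<pi>" using \<pi>(3) Z by blast
    have nQQ: "n \<in> ?QQ" unfolding n' using qq(4)[OF ZR[OF n'(1)] \<pi>2] .
    show "y \<in> ?QQ"
    proof (cases "t \<in> Q")
      case False
      have "sg y \<notin> Q"
      proof
        assume "sg y \<in> Q"
        then have "t \<in> Q" unfolding t_def using nf_idealD(3)[OF local.Q y(1)] by blast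
        then show False using False by blast
      qed
      moreover have "sg y * y \<in> ?QQ" using nQQ unfolding n_def by (simp add: mult.commute)
      ultimately show ?thesis using cancel[OF y(1) sy] by blast
    next
      case True
      then obtain t' where t': "t' \<in> ZI" "t = t' * \<pi>" using \<pi>(3) Z by blast
      have tQQ: "t \<in> ?QQ" unfolding t' using qq(4)[OF ZR[OF t'(1)] \<pi>2] .
      \<comment> \<open>(y - sg y)^2 = t^2 - 4 n, and \<pi> divides both t and n; so W^2, hence W,
        lies in Q, and W is a multiple of \<pi>.\<close>
      have "W * W = s ^ 2 * (t * t - 4 * n)" unfolding W_def t_def n_def by (simp add: algebra_simps power2_eq_square)
      also have "\<dots> = of_nat D * (t' * t - 4 * n') * \<pi>" unfolding s2 n' by (subst t'(2)) (simp add: algebra_simps t'(2))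
      also have "\<dots> \<in> Q"
      proof (rule nf_idealD(4)[OF local.Q])
        show "of_nat D * (t' * t - 4 * n') \<in> ?R" using Z n' t' by (intro ZR zis)
        show "\<pi> \<in> Q" using QQsub \<pi>2 by blast
      qed
      finally have "W \<in> Q" using prime ZR Z by blast
      then obtain w' where w': "w' \<in> ZI" "W = w' * \<pi>" using \<pi>(3) Z by blast
      have eq: "2 * of_nat D * y = of_nat D * t + s * W"
        unfolding W_def t_def s2[symmetric] by (simp add: algebra_simps power2_eq_square)
      have sR: "s \<in> ?R" using sO OR by blast
      from s show ?thesis
      proof
        assume sQ: "s \<notin> Q"
        then have "of_nat D \<notin> Q" using prime[OF sR sR] s2 by (auto simp: power2_eq_square)
        then have DQ: "2 * of_nat D \<notin> Q" using two prime[OF ZR[OF zis(9)] ZR[OF zis(8)]] by blast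
        have "W \<in> ?QQ" unfolding w' using qq(4)[OF ZR[OF w'(1)] \<pi>2] .
        then have "2 * of_nat D * y \<in> ?QQ" unfolding eq
          using qq(3)[OF qq(4)[OF ZR[OF zis(8)] tQQ] qq(4)[OF sR]] by blast
        moreover have "2 * of_nat D \<in> ?R" by (intro ZR zis)
        ultimately show ?thesis using cancel[OF y(1) _ DQ] by blast
      next
        assume "s \<in> ?QQ \<and> (\<exists>e\<in>ZI. e \<notin> Q \<and> of_nat D = \<pi> * e)"
        then obtain e where sQQ: "s \<in> ?QQ" and e: "e \<in> ZI" "e \<notin> Q" "of_nat D = \<pi> * e" by blast
        \<comment> \<open>Now D and W each carry a factor \<pi>; after cancelling it, the right side
          is a combination of t and s, both in Q^2.\<close>
        have "\<pi> * (2 * e * y) = \<pi> * (e * t + w' * s)"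
          using eq unfolding w'(2) e(3) by (simp add: algebra_simps)
        then have "2 * e * y = e * t + w' * s" using \<pi>(2) by simp
        moreover have "\<dots> \<in> ?QQ" using qq(3)[OF qq(4)[OF ZR[OF e(1)] tQQ] qq(4)[OF ZR[OF w'(1)] sQQ]] .
        ultimately have "2 * e * y \<in> ?QQ" by simp
        moreover have "2 * e \<notin> Q" using two prime[OF ZR[OF zis(9)] ZR[OF e(1)]] e(2) by blast
        moreover have "2 * e \<in> ?R" using e(1) by (intro ZR zis)
        ultimately show ?thesis using cancel[OF y(1)] by blast
      qed
    qed
  qed
  then have "ideal_ext ?R P \<subseteq> ?QQ" unfolding ideal_ext_def by (rule ideal_gen_least[OF QQ])
  ultimately show ?thesis unfolding unramified_def by blast
qed

section \<open>Square roots that force ramification at odd primes\<close>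

lemma prime_sum_squares_not_dvd:
  fixes a b :: int
  assumes p: "prime p" and "a^2 + b^2 = int p" "int p dvd a" "int p dvd b" shows False
proof -
  have "(int p)^2 dvd a^2 + b^2" using assms(3,4) by (intro dvd_add) simp_all
  then have "int p * int p dvd int p * 1" using assms(2) by (simp add: power2_eq_square)
  then show False using p by (simp add: prime_gt_0_nat)
qed

lemma (in max_ideal) int_mem:
  assumes R: "\<And>x. x \<in> ZI \<Longrightarrow> x \<in> R" and p: "prime p" "of_nat p \<in> Q" and z: "of_int z \<in> Q"
  shows "int p dvd z"
proof (rule ccontr)
  assume "\<not> int p dvd z"
  then have "coprime z (int p)" using prime_imp_coprime[of "int p" z] p(1) by (simp add: coprime_commute)
  then obtain u v where uv: "u * z + v * int p = 1" using bezout_int[of z "int p"] by (metis coprime_iff_gcd_eq_1)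
  have "of_int u * of_int z + of_int v * of_nat p \<in> Q"
    using nf_idealD(3,4)[OF Q] z p(2) R zis(7) by blast
  moreover have "of_int u * of_int z + of_int v * of_nat p = (of_int (u * z + v * int p) :: complex)" by simp
  ultimately show False using one uv by simp
qed

text \<open>If both conjugates of \<pi> = a + b \<i> were in Q, then so would be 2 a and 2 b, and p
  would divide a and b, against a^2 + b^2 = p.\<close>

lemma (in max_ideal) cnj_not_mem:
  assumes R: "\<And>x. x \<in> ZI \<Longrightarrow> x \<in> R" and p: "prime p" "of_nat p \<in> Q" "odd p"
    and \<pi>: "\<pi> \<in> ZI" "\<pi> * cnj \<pi> = of_nat p" "\<pi> \<in> Q"
  shows "cnj \<pi> \<notin> Q"
proof
  assume c: "cnj \<pi> \<in> Q"
  obtain a b where ab: "Re \<pi> = of_int a" "Im \<pi> = of_int b" using \<pi>(1) unfolding ZI_def by (auto elim!: Ints_cases)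
  have "\<pi> + cnj \<pi> = of_int (2 * a)" "\<i> * (cnj \<pi> + (-1) * \<pi>) = of_int (2 * b)" using ab by (auto simp: complex_eq_iff)
  moreover have "\<pi> + cnj \<pi> \<in> Q" "\<i> * (cnj \<pi> + (-1) * \<pi>) \<in> Q"
    using nf_idealD(3,4)[OF Q] c \<pi>(3) R[OF zis(10)] R[OF zis(5)[OF zis(2)]] by blast+
  ultimately have "int p dvd 2 * a" "int p dvd 2 * b" using int_mem[OF R p(1,2)] by metis+
  moreover have "coprime (int p) 2" using p(3) by simp
  ultimately have "int p dvd a" "int p dvd b" using coprime_dvd_mult_right_iff by blast+
  moreover have "\<pi> * cnj \<pi> = of_int (a^2 + b^2)" using ab by (simp add: complex_eq_iff power2_eq_square)
  then have "(of_int (a^2 + b^2) :: complex) = of_int (int p)" using \<pi>(2) by simp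
  then have "a^2 + b^2 = int p" unfolding of_int_eq_iff .
  ultimately show False using prime_sum_squares_not_dvd[OF p(1)] by blast
qed

text \<open>q divides \<theta>^2 exactly once, so \<theta> in Q puts q into Q^2. Whether q splits in
  the Gaussian integers is left open: \<pi> generates the Gaussian integers in Q, and the cofactor e
  of \<pi> in q is cancelled because an odd q does not ramify there.\<close>

lemma (in gquad) ramified_at_integer:
  fixes q :: nat and n :: int
  assumes K: "nf_subfield K" "k \<subseteq> K" and \<theta>: "\<theta> \<in> K" "\<theta> ^ 2 = of_int n"
    and q: "prime q" "odd q" "int q dvd n" "\<not> int q ^ 2 dvd n" "\<not> q dvd D"
  shows "\<not> unramified k K"
proof -
  let ?R = "ring_of_integers K"
  have R: "subring_C ?R" using ring_of_integers_subring[OF K(1)] .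
  have OR: "x \<in> ?R" if "x \<in> Ok" for x using that K(2) O_iff ring_of_integers_iff by blast
  have ZR: "x \<in> ?R" if "x \<in> ZI" for x using that ZIO OR by blast
  have "of_nat q * r \<noteq> 1" if "r \<in> ?R" for r
  proof
    assume "of_nat q * r = 1"
    then have "r = of_real (1 / real q)" using q(1) by (simp add: field_simps prime_gt_0_nat)
    moreover have "algebraic_int r" using that ring_of_integers_iff by blast
    ultimately obtain j where j: "1 / real q = of_int j" using alg_int_rat[of "1 / real q"] by auto
    then have "real_of_int (int q * j) = of_int 1" using q(1) by (simp add: field_simps prime_gt_0_nat)
    then have "int q * j = 1" unfolding of_int_eq_iff .
    then have "int q dvd 1" by (metis dvd_triv_left)
    then show False using q(1) by simp
  qed
  then obtain Q where Q: "max_ideal ?R Q" "of_nat q \<in> Q"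
    using max_ideal_exists[OF R ZR[OF zis(8)]] by blast
  interpret Q: max_ideal ?R Q by (rule Q(1))
  note QI = nf_idealD[OF Q.Q] and QQ = nf_idealD[OF Q.QQ]
  have intQ: "int q dvd z" if "of_int z \<in> Q" for z using Q.int_mem[OF ZR q(1) Q(2) that] .
  obtain n' where n': "n = int q * n'" using q(3) by blast
  have "\<not> int q dvd n'" using q(4) unfolding n' by (auto simp: power2_eq_square)
  then have n'Q: "of_int n' \<notin> Q" using intQ by blast
  have "algebraic_int (\<theta> ^ 2)" unfolding \<theta> by (intro ZI_alg_int zis)
  then have \<theta>R: "\<theta> \<in> ?R" using \<theta>(1) alg_int_sqrt ring_of_integers_iff by blast
  have nn: "(of_int n :: complex) = of_int n' * of_nat q" unfolding n' by simp
  have "of_int n \<in> Q" unfolding nn using QI(4)[OF ZR[OF zis(7)] Q(2)] .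
  then have "\<theta> \<in> Q" using Q.prime[OF \<theta>R \<theta>R] \<theta>(2) by (simp add: power2_eq_square)
  then have "of_int n' * of_nat q \<in> ideal_mult ?R Q Q" using Q.square_mem \<theta>(2) nn by metis
  then have qQQ: "of_nat q \<in> ideal_mult ?R Q Q" using Q.cancel[OF Q(2) ZR[OF zis(7)] n'Q] by blast
  have "\<exists>g. g \<in> Q \<inter> ZI \<and> (\<forall>x. x \<in> Q \<inter> ZI \<longrightarrow> (\<exists>q\<in>ZI. x = q * g))"
  proof (rule ZI_principal[of "Q \<inter> ZI"])
    show "0 \<in> Q \<inter> ZI" using QI(2) zis by blast
  qed (use QI zis ZR in auto)
  then obtain \<pi> where \<pi>: "\<pi> \<in> Q" "\<pi> \<in> ZI" "\<And>x. x \<in> ZI \<Longrightarrow> x \<in> Q \<Longrightarrow> \<exists>q\<in>ZI. x = q * \<pi>" by blast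
  obtain e where e: "e \<in> ZI" "of_nat q = e * \<pi>" using \<pi>(3)[OF zis(8) Q(2)] by blast
  have \<pi>0: "\<pi> \<noteq> 0" using e(2) q(1) by (auto simp: prime_gt_0_nat)
  have gp: "gnorm \<pi> \<noteq> 1"
  proof
    assume "gnorm \<pi> = 1"
    then have "\<pi> * cnj \<pi> = 1" using gnorm_cnj[OF \<pi>(2)] by simp
    then show False using QI(5)[OF ZR[OF zis(11)[OF \<pi>(2)]] \<pi>(1)] Q.one by simp
  qed
  have "e \<notin> Q"
  \<comment> \<open>Otherwise \<pi>^2 divides q, and comparing norms gives \<pi> the norm q; then e
    is the conjugate of \<pi>, which \<open>cnj_not_mem\<close> keeps out of Q.\<close>
  proof
    assume "e \<in> Q"
    then obtain f where f: "f \<in> ZI" "e = f * \<pi>" using \<pi>(3) e by blast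
    have gq: "gnorm (of_nat q) = q * q"
    proof -
      have "(of_nat (gnorm (of_nat q)) :: complex) = of_nat (q * q)" using gnorm_cnj[OF zis(8)] by simp
      then show ?thesis unfolding of_nat_eq_iff .
    qed
    have "gnorm (of_nat q) = gnorm f * gnorm \<pi> * gnorm \<pi>"
      unfolding e(2) f(2) using gnorm_mult[OF zis(4)[OF f(1) \<pi>(2)] \<pi>(2)] gnorm_mult[OF f(1) \<pi>(2)] by simp
    then have gg: "q * q = gnorm f * gnorm \<pi> ^ 2" unfolding gq by (simp add: power2_eq_square)
    then have "gnorm \<pi> ^ 2 dvd q ^ 2" by (simp add: power2_eq_square)
    then have "gnorm \<pi> dvd q" by simp
    then have g\<pi>: "gnorm \<pi> = q" using gp q(1) prime_nat_iff by blast
    then have \<pi>q: "\<pi> * cnj \<pi> = of_nat q" using gnorm_cnj[OF \<pi>(2)] by simp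
    then have "\<pi> * cnj \<pi> = \<pi> * e" using e(2) by (simp add: mult.commute)
    then have "cnj \<pi> = e" using \<pi>0 by simp
    then show False using Q.cnj_not_mem[OF ZR q(1) Q(2) q(2) \<pi>(2) \<pi>q \<pi>(1)] \<open>e \<in> Q\<close> by blast
  qed
  then have \<pi>QQ: "\<pi> \<in> ideal_mult ?R Q Q" using Q.cancel[OF \<pi>(1) ZR[OF e(1)]] qQQ e(2) by simp
  have two: "2 \<notin> Q"
  proof
    assume "2 \<in> Q"
    then have "int q dvd 2" using intQ[of 2] by simp
    then have "q dvd 2" by presburger
    then show False using q(1,2) primes_dvd_imp_eq two_is_prime_nat by blast
  qed
  have "s \<notin> Q"
  proof
    assume "s \<in> Q"
    then have "s * s \<in> Q" using QI(4)[OF OR[OF sO]] by blast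
    then have "of_int (int D) \<in> Q" using s2 by (simp add: power2_eq_square)
    then have "int q dvd int D" using intQ by blast
    then show False using q(5) by presburger
  qed
  then show ?thesis using not_unramifiedI[OF K Q(1) \<pi>(2) \<pi>0 \<pi>(3) \<pi>QQ two] by blast
qed

text \<open>\<pi> divides D = s^2, so s lies in Q, and so does \<theta> since \<theta>^2 = r s. As r
  is prime to \<pi>, cancelling it from \<theta>^2 puts s itself into Q^2: Q is ramified over k, on
  top of the ramification of \<pi> in k.\<close>

lemma (in gquad) ramified_at_divisor_of_D:
  fixes p m :: nat
  assumes K: "nf_subfield K" "k \<subseteq> K" and \<theta>: "\<theta> \<in> K" "\<theta> ^ 2 = r * s" and r: "r \<in> ZI" "r / \<pi> \<notin> ZI"
    and p: "prime p" "odd p" and \<pi>: "\<pi> \<in> ZI" "\<pi> * cnj \<pi> = of_nat p" and D: "D = p * m" "\<not> p dvd m"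
  shows "\<not> unramified k K"
proof -
  let ?R = "ring_of_integers K"
  have R: "subring_C ?R" using ring_of_integers_subring[OF K(1)] .
  have OR: "x \<in> ?R" if "x \<in> Ok" for x using that K(2) O_iff ring_of_integers_iff by blast
  have ZR: "x \<in> ?R" if "x \<in> ZI" for x using that ZIO OR by blast
  have p0: "(of_nat p :: complex) \<noteq> 0" using p(1) by (simp add: prime_gt_0_nat)
  have \<pi>0: "\<pi> \<noteq> 0" using \<pi>(2) p0 by auto
  have gp: "gnorm \<pi> = p" using gnorm_cnj[OF \<pi>(1)] \<pi>(2) by simp
  have "\<pi> * x \<noteq> 1" if "x \<in> ?R" for x
  proof
    assume x: "\<pi> * x = 1"
    then have "x = 1 / \<pi>" using one_divide_unit by metis
    then have "x \<in> QI" using \<pi>(1) ZI_QI nfs(2,8)[OF QI_subfield] by blast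
    then have "x \<in> ZI" using that ring_of_integers_iff alg_int_QI by blast
    then have "p * gnorm x = gnorm 1" using gnorm_mult[OF \<pi>(1), of x] x gp by simp
    also have "gnorm 1 = 1" by (simp add: gnorm_def)
    finally show False using p(1) by simp
  qed
  then obtain Q where Q: "max_ideal ?R Q" "\<pi> \<in> Q"
    using max_ideal_exists[OF R ZR[OF \<pi>(1)]] by blast
  interpret Q: max_ideal ?R Q by (rule Q(1))
  note QI = nf_idealD[OF Q.Q] and QQ = nf_idealD[OF Q.QQ]
  have pQ: "of_nat p \<in> Q" using QI(5)[OF ZR[OF zis(11)[OF \<pi>(1)]] Q(2)] \<pi>(2) by simp
  have intQ: "int p dvd z" if "of_int z \<in> Q" for z using Q.int_mem[OF ZR p(1) pQ that] .
  have \<pi>Q: "\<exists>q\<in>ZI. x = q * \<pi>" if x: "x \<in> ZI" "x \<in> Q" for x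
  proof -
    obtain d u v where d: "d \<in> ZI" "u \<in> ZI" "v \<in> ZI" "d = u * x + v * \<pi>"
      and ex: "\<exists>f\<in>ZI. x = f * d" "\<exists>e\<in>ZI. \<pi> = e * d"
      by (rule ZI_gcd[OF x(1) \<pi>(1)])
    obtain f where f: "f \<in> ZI" "x = f * d" using ex by blast
    obtain e where e: "e \<in> ZI" "\<pi> = e * d" using ex by blast
    have dQ: "d \<in> Q" unfolding d(4) using QI(3)[OF QI(4)[OF ZR[OF d(2)] x(2)] QI(4)[OF ZR[OF d(3)] Q(2)]] .
    have "prime (gnorm e * gnorm d)" using gnorm_mult[OF e(1) d(1)] e(2) gp p(1) by simp
    moreover have "gnorm d \<noteq> 1"
    proof
      assume "gnorm d = 1"
      then have "d * cnj d = 1" using gnorm_cnj[OF d(1)] by simp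
      then show False using QI(5)[OF ZR[OF zis(11)[OF d(1)]] dQ] Q.one by simp
    qed
    ultimately have "gnorm e = 1" using prime_product by blast
    then have "e * cnj e = 1" using gnorm_cnj[OF e(1)] by simp
    then have "x = (f * cnj e) * \<pi>" unfolding f(2) e(2) by (simp add: algebra_simps)
    moreover have "f * cnj e \<in> ZI" using f(1) e(1) by (intro zis)
    ultimately show ?thesis by blast
  qed
  have rQ: "r \<notin> Q"
  proof
    assume "r \<in> Q"
    then obtain c where "c \<in> ZI" "r = c * \<pi>" using \<pi>Q r(1) by blast
    then show False using r(2) \<pi>0 by simp
  qed
  define e where "e = cnj \<pi> * of_nat m"
  have eZ: "e \<in> ZI" unfolding e_def using \<pi>(1) by (intro zis)
  have De: "of_nat D = \<pi> * e" unfolding e_def D using \<pi>(2) by (simp add: mult.assoc[symmetric])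
  have "of_nat m \<notin> Q"
  proof
    assume "of_nat m \<in> Q"
    then have "int p dvd int m" using intQ[of "int m"] by simp
    then show False using D(2) by presburger
  qed
  then have eQ: "e \<notin> Q" unfolding e_def
    using Q.prime[of "cnj \<pi>" "of_nat m"] Q.cnj_not_mem[OF ZR p(1) pQ p(2) \<pi> Q(2)] ZR zis(8) zis(11)[OF \<pi>(1)] by blast
  have sR: "s \<in> ?R" using sO OR by blast
  have "of_nat D \<in> Q" unfolding De using QI(5)[OF ZR[OF eZ] Q(2)] .
  then have sQ: "s \<in> Q" using Q.prime[OF sR sR] s2 by (simp add: power2_eq_square)
  have rsR: "r * s \<in> ?R" using subring_CD(4)[OF R ZR[OF r(1)] sR] .
  then have "algebraic_int (\<theta> ^ 2)" unfolding \<theta> using ring_of_integers_iff by blast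
  then have \<theta>R: "\<theta> \<in> ?R" using \<theta>(1) alg_int_sqrt ring_of_integers_iff by blast
  have "r * s \<in> Q" using QI(4)[OF ZR[OF r(1)] sQ] .
  then have "\<theta> \<in> Q" using Q.prime[OF \<theta>R \<theta>R] \<theta>(2) by (simp add: power2_eq_square)
  then have "r * s \<in> ideal_mult ?R Q Q" using Q.square_mem \<theta>(2) by metis
  then have sQQ: "s \<in> ideal_mult ?R Q Q" using Q.cancel[OF sQ ZR[OF r(1)] rQ] by blast
  have "e * \<pi> \<in> ideal_mult ?R Q Q" using Q.square_mem[OF sQ] s2 De by (simp add: mult.commute)
  then have \<pi>QQ: "\<pi> \<in> ideal_mult ?R Q Q" using Q.cancel[OF Q(2) ZR[OF eZ] eQ] by blast
  have two: "2 \<notin> Q"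
  proof
    assume "2 \<in> Q"
    then have "int p dvd 2" using intQ[of 2] by simp
    then have "p dvd 2" by presburger
    then show False using p primes_dvd_imp_eq two_is_prime_nat by blast
  qed
  show ?thesis using not_unramifiedI[OF K Q(1) \<pi>(1) \<pi>0 \<pi>Q \<pi>QQ two] sQQ eZ eQ De by blast
qed

section \<open>Unramified quadratic extensions that are abelian over \<open>\<rat>\<close>\<close>

text \<open>Kummer theory in degree 2: for y = u + v a the cross term 2 u v a of y^2 must vanish,
  and v = 0 would put y into F.\<close>

lemma adj_square_mem:
  assumes F: "nf_subfield F" and a: "a \<notin> F" "a ^ 2 \<in> F" and y: "y \<in> adj F a" "y ^ 2 \<in> F" "y \<notin> F"
  obtains v where "v \<in> F" "y = v * a"
proof -
  obtain u v where uv: "u \<in> F" "v \<in> F" "y = u + v * a" using y(1) by (rule adjE)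
  have "y ^ 2 = (u ^ 2 + v ^ 2 * a ^ 2) + (2 * u * v) * a" unfolding uv by (simp add: algebra_simps power2_eq_square)
  then have "(u ^ 2 + v ^ 2 * a ^ 2) + (2 * u * v) * a = y ^ 2 + 0 * a" by simp
  moreover have "u ^ 2 \<in> F" "v ^ 2 \<in> F" using nf_subfield_power[OF F] uv by blast+
  then have "u ^ 2 + v ^ 2 * a ^ 2 \<in> F" using nfs(3,4)[OF F] a(2) by blast
  moreover have "2 * u * v \<in> F" using nfs(4)[OF F] nf_subfield_numeral[OF F] uv by blast
  ultimately have "2 * u * v = 0" using adj_unique[OF F a(1)] y(2) nfs(1)[OF F] by blast
  then have "u = 0 \<or> v = 0" by simp
  moreover have "v \<noteq> 0" using uv y(3) by auto
  ultimately show ?thesis using that uv by auto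
qed

lemma adj_scale:
  assumes F: "nf_subfield F" and v: "v \<in> F" "v \<noteq> 0"
  shows "adj F (v * a) = adj F a"
proof
  show "adj F (v * a) \<subseteq> adj F a"
  proof
    fix y assume "y \<in> adj F (v * a)"
    then obtain p q where "p \<in> F" "q \<in> F" "y = p + q * (v * a)" by (rule adjE)
    then show "y \<in> adj F a" using adjI[of p F "q * v" a] nfs(4)[OF F _ v(1)] by (simp add: mult.assoc)
  qed
  show "adj F a \<subseteq> adj F (v * a)"
  proof
    fix y assume "y \<in> adj F a"
    then obtain p q where "p \<in> F" "q \<in> F" "y = p + q * a" by (rule adjE)
    then show "y \<in> adj F (v * a)" using adjI[of p F "q / v" "v * a"] nfs(8)[OF F _ v(1)] v(2) by simp
  qed
qed

lemma gaussian_prime_not_assoc_cnj: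
  assumes \<pi>: "\<pi> \<in> ZI" "\<pi> * cnj \<pi> = of_nat p" and p: "prime p" "odd p"
  shows "cnj \<pi> / \<pi> \<notin> ZI"
proof
  assume e: "cnj \<pi> / \<pi> \<in> ZI"
  have \<pi>0: "\<pi> \<noteq> 0" using \<pi>(2) p(1) by (auto simp: prime_gt_0_nat)
  have gp: "gnorm \<pi> = p" using gnorm_cnj[OF \<pi>(1)] \<pi>(2) by simp
  obtain a b where ab: "Re \<pi> = of_int a" "Im \<pi> = of_int b" using \<pi>(1) unfolding ZI_def by (auto elim!: Ints_cases)
  have dvd: "int p dvd z" if "of_int (2 * z) / \<pi> \<in> ZI" for z
  proof -
    define c where "c = of_int (2 * z) / \<pi>"
    have "of_int (2 * z) = c * \<pi>" unfolding c_def using \<pi>0 by simp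
    then have "(of_int (2 * z) * cnj (of_int (2 * z)) :: complex) = (c * cnj c) * (\<pi> * cnj \<pi>)" by simp
    also have "c * cnj c = of_nat (gnorm c)" using gnorm_cnj[of c] that unfolding c_def by simp
    finally have "(of_int ((2 * z) * (2 * z)) :: complex) = of_int (int (gnorm c) * int p)" using \<pi>(2) by simp
    then have "(2 * z) * (2 * z) = int (gnorm c) * int p" unfolding of_int_eq_iff .
    then have "int p dvd (2 * z) * (2 * z)" by simp
    then have "int p dvd 2 * z" using p(1) prime_dvd_multD[of "int p" "2 * z" "2 * z"] by simp
    moreover have "coprime (int p) 2" using p(2) by simp
    ultimately show ?thesis using coprime_dvd_mult_right_iff by blast
  qed
  have "of_int (2 * a) = \<pi> + cnj \<pi>" "of_int (2 * b) = \<i> * (cnj \<pi> - \<pi>)"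
    using ab by (auto simp: complex_eq_iff)
  moreover have "(\<pi> + cnj \<pi>) / \<pi> = 1 + cnj \<pi> / \<pi>" "\<i> * (cnj \<pi> - \<pi>) / \<pi> = \<i> * (cnj \<pi> / \<pi> - 1)"
    using \<pi>0 by (simp_all add: field_simps)
  ultimately have "of_int (2 * a) / \<pi> = 1 + cnj \<pi> / \<pi>" "of_int (2 * b) / \<pi> = \<i> * (cnj \<pi> / \<pi> - 1)"
    by metis+
  moreover have "1 + cnj \<pi> / \<pi> \<in> ZI" "\<i> * (cnj \<pi> / \<pi> - 1) \<in> ZI"
    using zis(3)[OF zis(2) e] zis(4)[OF zis(10) zis(6)[OF e zis(2)]] .
  ultimately have "int p dvd a" "int p dvd b" using dvd[of a] dvd[of b] by metis+
  moreover have "\<pi> * cnj \<pi> = of_int (a^2 + b^2)" using ab by (simp add: complex_eq_iff power2_eq_square)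
  then have "(of_int (a^2 + b^2) :: complex) = of_int (int p)" using \<pi>(2) by simp
  then have "a^2 + b^2 = int p" unfolding of_int_eq_iff .
  ultimately show False using prime_sum_squares_not_dvd[OF p(1)] by blast
qed

lemma field_autsI:
  assumes "nf_subfield K" "fhom K t" "t ` K = K" shows "t \<in> field_auts K"
proof -
  interpret fhom_on K t using assms by unfold_locales
  have "bij_betw t K K" unfolding bij_betw_def inj_on_def using inj assms(3) by blast
  then show ?thesis unfolding field_auts_def using add mult by auto
qed

lemma abelian_image: "abelian_over_Q K \<Longrightarrow> fhom K t \<Longrightarrow> t ` K = K"
  unfolding abelian_over_Q_def fhom_def by blast

lemma abelian_commute:
  "nf_subfield K \<Longrightarrow> abelian_over_Q K \<Longrightarrow> fhom K t \<Longrightarrow> fhom K u \<Longrightarrow> x \<in> K \<Longrightarrow> t (u x) = u (t x)"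
  using field_autsI[of K t] field_autsI[of K u] abelian_image[of K t] abelian_image[of K u]
  unfolding abelian_over_Q_def[of K] by simp

lemma fhom_extension:
  assumes "nf_subfield F" "fhom F s" "a ^ 2 \<in> F" "a \<notin> F" "b ^ 2 = s (a ^ 2)"
  shows "\<exists>t. fhom (adj F a) t \<and> (\<forall>x\<in>F. t x = s x) \<and> t a = b"
  by (rule fhom_extend[OF assms]) metis

locale abelian_quad = gquad +
  fixes K \<theta>0
  assumes real: "cnj s = s" and \<theta>0: "\<theta>0 \<notin> k" "\<theta>0 ^ 2 \<in> k" "K = adj k \<theta>0"
    and ab: "abelian_over_Q K" and unr: "unramified k K"
begin

lemma K: "nf_subfield K" unfolding \<theta>0(3) using adj_subfield[OF k \<theta>0(2)] .
lemma kK: "k \<subseteq> K" unfolding \<theta>0(3) using adj_base[OF k] .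

lemma cnj_k: assumes "x \<in> k" shows "cnj x \<in> k"
proof -
  obtain u v where "u \<in> QI" "v \<in> QI" "x = u + v * s" using assms by (rule adjE)
  then show ?thesis using adjI[OF QI_cnj QI_cnj, of u v s] real by simp
qed

lemma cnj_K: "x \<in> K \<Longrightarrow> cnj x \<in> K" using abelian_image[OF ab fhom_cnj] by blast

lemma fixed_QI: assumes "x \<in> k" "sg x = x" shows "x \<in> QI"
proof -
  have "x = (x + sg x) / 2" using assms(2) by simp
  then show ?thesis using tr_norm_QI(1)[OF assms(1)] nfs(8)[OF QI_subfield _ nf_subfield_numeral[OF QI_subfield]] by metis
qed

text \<open>Square roots generating K over k. The choice can be altered by any nonzero factor from
  k, and the proofs below exploit this freedom to normalise the square.\<close>

definition gen :: "complex \<Rightarrow> bool" where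
  "gen \<theta> \<longleftrightarrow> \<theta> \<notin> k \<and> \<theta> ^ 2 \<in> k \<and> K = adj k \<theta>"

lemma gen_mem: "gen \<theta> \<Longrightarrow> \<theta> \<in> K" unfolding gen_def using adj_gen[OF k] by blast

lemma gen_scale: assumes "gen \<theta>" "v \<in> k" "v \<noteq> 0" shows "gen (v * \<theta>)"
proof -
  have "v * \<theta> \<notin> k"
  proof
    assume "v * \<theta> \<in> k"
    then have "(v * \<theta>) / v \<in> k" using nfs(8)[OF k _ assms(2)] by blast
    then show False using assms unfolding gen_def by simp
  qed
  moreover have "(v * \<theta>) ^ 2 \<in> k"
    using assms nfs(4)[OF k] nf_subfield_power[OF k assms(2)] unfolding gen_def power_mult_distrib by blast
  ultimately show ?thesis using assms(1) adj_scale[OF k assms(2,3)] unfolding gen_def by simp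
qed

text \<open>Normality of \<open>K\<close> gives \<open>\<sigma>(\<theta>\<^sup>2) = \<rho>\<^sup>2 \<theta>\<^sup>2\<close> with \<open>\<rho> \<sigma>(\<rho>) = \<plusminus>1\<close>; by Hilbert 90 the two signs are
  the biquadratic and the cyclic case over \<open>\<rat>(\<i>)\<close>.\<close>

lemma generator_cases:
  obtains \<theta> where "gen \<theta>" "\<theta> ^ 2 \<in> QI" | \<theta> r where "gen \<theta>" "r \<in> QI" "\<theta> ^ 2 = r * s"
proof -
  have g0: "gen \<theta>0" unfolding gen_def using \<theta>0 by blast
  define \<delta> where "\<delta> = \<theta>0 ^ 2"
  have \<delta>: "\<delta> \<in> k" unfolding \<delta>_def using \<theta>0(2) .
  \<comment> \<open>Any square root of sg \<delta> serves: it is the image of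
    \<open>\<theta>0\<close> under an embedding extending \<open>sg\<close>, so normality puts it
    into K.\<close>
  define y where "y = csqrt (sg \<delta>)"
  have y2: "y ^ 2 = sg \<delta>" unfolding y_def by simp
  have "y ^ 2 = sg (\<theta>0 ^ 2)" using y2 unfolding \<delta>_def .
  then obtain t where t: "fhom K t" "t \<theta>0 = y"
    using fhom_extension[OF k sg_hom \<theta>0(2,1)] unfolding \<theta>0(3) by blast
  have yK: "y \<in> K" using abelian_image[OF ab t(1)] gen_mem[OF g0] t(2) by blast
  have "y \<notin> k"
  proof
    assume yk: "y \<in> k"
    have "sg y ^ 2 = sg (sg \<delta>)" using sg.power[OF yk, of 2] y2 by simp
    then have "sg y ^ 2 = \<theta>0 ^ 2" using sg_sg[OF \<delta>] \<delta>_def by simp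
    then have "\<theta>0 = sg y \<or> \<theta>0 = - sg y" by (auto simp: power2_eq_iff)
    then show False using \<theta>0(1) sg_in[OF yk] nfs(5)[OF k] by metis
  qed
  then obtain \<rho> where \<rho>: "\<rho> \<in> k" "y = \<rho> * \<theta>0"
    using adj_square_mem[OF k \<theta>0(1,2), of y] yK y2 sg_in[OF \<delta>] unfolding \<theta>0(3) by metis
  have sd: "sg \<delta> = \<rho> ^ 2 * \<delta>" using y2 unfolding \<rho>(2) \<delta>_def by (simp add: power_mult_distrib)
  have \<delta>0: "\<delta> \<noteq> 0" unfolding \<delta>_def using \<theta>0(1) nfs(1)[OF k] by auto
  have "\<delta> = sg (\<rho> ^ 2 * \<delta>)" using sd sg_sg[OF \<delta>] by simp
  also have "\<dots> = sg \<rho> ^ 2 * (\<rho> ^ 2 * \<delta>)"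
    using sg.mult[OF nf_subfield_power[OF k \<rho>(1)] \<delta>] sg.power[OF \<rho>(1)] sd by simp
  also have "\<dots> = (\<rho> * sg \<rho>) ^ 2 * \<delta>" by (simp add: power_mult_distrib)
  finally have "(\<rho> * sg \<rho>) ^ 2 * \<delta> = 1 * \<delta>" by simp
  then have "(\<rho> * sg \<rho>) ^ 2 = 1" using \<delta>0 by simp
  then consider "\<rho> * sg \<rho> = 1" | "\<rho> * sg \<rho> = -1" by (auto simp: power2_eq_1_iff)
  then show ?thesis
  proof cases
    case 1
    obtain x where x: "x \<in> k" "x \<noteq> 0" "\<rho> * sg x = x"
      by (rule quad_hilbert90[OF QI_subfield s2QI sQ sg_hom sg_sg sg_s \<rho>(1) 1])
    have "sg (x ^ 2 * \<delta>) = sg x ^ 2 * (\<rho> ^ 2 * \<delta>)"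
      using sg.mult[OF nf_subfield_power[OF k x(1)] \<delta>] sg.power[OF x(1)] sd by simp
    also have "\<dots> = (\<rho> * sg x) ^ 2 * \<delta>" by (simp add: power_mult_distrib)
    finally have "sg (x ^ 2 * \<delta>) = x ^ 2 * \<delta>" unfolding x(3) .
    then have "(x * \<theta>0) ^ 2 \<in> QI"
      using fixed_QI nfs(4)[OF k nf_subfield_power[OF k x(1)] \<delta>] unfolding \<delta>_def power_mult_distrib by blast
    then show ?thesis using that(1) gen_scale[OF g0 x(1,2)] by blast
  next
    case 2
    \<comment> \<open>Scaling \<rho> by \<i> turns its norm -1 into 1. The price is that x^2
      \<delta> changes sign under \<open>sg\<close>; dividing by s, which does the same, leaves a
      Gaussian number.\<close>
    have ik: "\<i> \<in> k" using QI_ii QIk by blast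
    have i\<rho>: "\<i> * \<rho> \<in> k" using nfs(4)[OF k ik \<rho>(1)] .
    have "sg (\<i> * \<rho>) = \<i> * sg \<rho>" using sg.mult[OF ik \<rho>(1)] sg_fix[OF QI_ii] by simp
    then have "(\<i> * \<rho>) * sg (\<i> * \<rho>) = \<i> * \<i> * (\<rho> * sg \<rho>)" by (simp add: mult_ac)
    then have i1: "(\<i> * \<rho>) * sg (\<i> * \<rho>) = 1" unfolding 2 by simp
    obtain x where x: "x \<in> k" "x \<noteq> 0" "\<i> * \<rho> * sg x = x"
      by (rule quad_hilbert90[OF QI_subfield s2QI sQ sg_hom sg_sg sg_s i\<rho> i1])
    define r where "r = x ^ 2 * \<delta> / s"
    have xd: "x ^ 2 * \<delta> \<in> k" using nfs(4)[OF k nf_subfield_power[OF k x(1)] \<delta>] .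
    have "sg (x ^ 2 * \<delta>) = sg x ^ 2 * (\<rho> ^ 2 * \<delta>)"
      using sg.mult[OF nf_subfield_power[OF k x(1)] \<delta>] sg.power[OF x(1)] sd by simp
    also have "\<dots> = - ((\<i> * \<rho> * sg x) ^ 2 * \<delta>)" by (simp add: power_mult_distrib)
    finally have "sg (x ^ 2 * \<delta>) = - (x ^ 2 * \<delta>)" unfolding x(3) .
    then have "sg r = r" unfolding r_def using sg.divide[OF xd sk] sg_s by simp
    moreover have "r \<in> k" unfolding r_def using nfs(8)[OF k xd sk] .
    ultimately have "r \<in> QI" using fixed_QI by blast
    moreover have "(x * \<theta>0) ^ 2 = r * s" unfolding r_def \<delta>_def using s0 by (simp add: power_mult_distrib)
    ultimately show ?thesis using that(2) gen_scale[OF g0 x(1,2)] by blast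
  qed
qed

lemma cnj_generator:
  assumes "gen \<theta>" obtains \<rho> where "\<rho> \<in> k" "cnj \<theta> = \<rho> * \<theta>"
proof -
  have g: "\<theta> \<notin> k" "\<theta> ^ 2 \<in> k" "K = adj k \<theta>" using assms unfolding gen_def by auto
  have "cnj \<theta> \<notin> k" using cnj_k[of "cnj \<theta>"] g(1) by auto
  moreover have "(cnj \<theta>) ^ 2 \<in> k" using cnj_k[OF g(2)] by simp
  moreover have "cnj \<theta> \<in> adj k \<theta>" using cnj_K[OF gen_mem[OF assms]] g(3) by simp
  ultimately show ?thesis using adj_square_mem[OF k g(1,2)] that by blast
qed

text \<open>The lift t of \<open>sg\<close> that fixes \<theta> commutes with complex conjugation,
  so cnj \<theta> = \<rho> \<theta> with \<rho> fixed by \<open>sg\<close>, that is, Gaussian.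
  Scaling \<theta> by a suitable Gaussian number makes it real, and its square becomes a positive
  rational.\<close>

lemma biquadratic_case:
  assumes g: "gen \<theta>" and r: "\<theta> ^ 2 \<in> QI"
  obtains n :: nat and y where "n > 0" "gen y" "y ^ 2 = of_nat n" "cnj y = y"
proof -
  have gk: "\<theta> \<notin> k" "\<theta> ^ 2 \<in> k" "K = adj k \<theta>" using g unfolding gen_def by auto
  have \<theta>K: "\<theta> \<in> K" using gen_mem[OF g] .
  obtain \<rho> where \<rho>: "\<rho> \<in> k" "cnj \<theta> = \<rho> * \<theta>" using cnj_generator[OF g] by blast
  have \<rho>K: "\<rho> \<in> K" using \<rho> kK by blast
  have \<theta>0': "\<theta> \<noteq> 0" using gk nfs(1)[OF k] by auto
  have "\<theta> ^ 2 = sg (\<theta> ^ 2)" using sg_fix[OF r] by simp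
  then obtain t where t: "fhom K t" "\<And>x. x \<in> k \<Longrightarrow> t x = sg x" "t \<theta> = \<theta>"
    using fhom_extension[OF k sg_hom gk(2,1)] unfolding gk(3) by blast
  interpret t: fhom_on K t using K t(1) by unfold_locales
  have "cnj (t \<theta>) = t (cnj \<theta>)" using abelian_commute[OF K ab fhom_cnj t(1) \<theta>K] .
  then have "\<rho> * \<theta> = sg \<rho> * \<theta>" using t \<rho> t.mult[OF \<rho>K \<theta>K] by simp
  then have \<rho>Q: "\<rho> \<in> QI" using fixed_QI[OF \<rho>(1)] \<theta>0' by simp
  have "\<theta> = cnj (cnj \<theta>)" by simp
  also have "\<dots> = (\<rho> * cnj \<rho>) * \<theta>" using \<rho>(2) by (simp add: mult_ac)
  finally have \<rho>1: "\<rho> * cnj \<rho> = 1" using \<theta>0' by simp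
  \<comment> \<open>Hilbert 90 for complex conjugation on the Gaussian field, with \<i> in the
    exceptional case \<rho> = -1.\<close>
  obtain x where x: "x \<in> QI" "x \<noteq> 0" "\<rho> * cnj x = x"
  proof (cases "\<rho> = -1")
    case True
    then show ?thesis using that[of \<i>] QI_ii by simp
  next
    case False
    have "1 + \<rho> \<noteq> 0" using False by (simp add: add_eq_0_iff)
    moreover have "\<rho> * cnj (1 + \<rho>) = 1 + \<rho>" using \<rho>1 by (simp add: algebra_simps)
    ultimately show ?thesis using that[of "1 + \<rho>"] nfs(2,3)[OF QI_subfield] \<rho>Q by blast
  qed
  define y where "y = x * \<theta>"
  have xk: "x \<in> k" using x QIk by blast
  have gy: "gen y" unfolding y_def using gen_scale[OF g xk x(2)] .
  have "cnj y = (\<rho> * cnj x) * \<theta>" unfolding y_def using \<rho>(2) by simp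
  then have cy: "cnj y = y" unfolding x(3) y_def .
  have y0: "y \<noteq> 0" unfolding y_def using x \<theta>0' by simp
  have yr: "y = of_real (Re y)" using cy by (simp add: complex_eq_iff)
  have "y ^ 2 \<in> QI" unfolding y_def power_mult_distrib using nfs(4)[OF QI_subfield nf_subfield_power[OF QI_subfield x(1)] r] .
  moreover have "y ^ 2 = of_real (Re y ^ 2)" by (subst yr) simp
  ultimately have "Re y ^ 2 \<in> \<rat>" unfolding QI_def by simp
  then obtain a b where ab: "b > 0" "Re y ^ 2 = of_int a / of_int b" by (auto elim!: Rats_cases')
  define n where "n = nat (a * b)"
  have "Re y \<noteq> 0" using y0 yr by auto
  then have "(of_int a :: real) / of_int b > 0" unfolding ab(2)[symmetric] by simp
  then have a0: "a > 0" using ab(1) by (simp add: zero_less_divide_iff)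
  have "(of_int b * y) ^ 2 = of_real ((of_int b * Re y) ^ 2)" by (subst yr) simp
  also have "(of_int b * Re y) ^ 2 = real n" unfolding power_mult_distrib ab(2) n_def
    using ab(1) a0 by (simp add: power2_eq_square)
  finally have "(of_int b * y) ^ 2 = of_nat n" by simp
  moreover have "gen (of_int b * y)" using gen_scale[OF gy nf_subfield_of_int[OF k, of b]] ab(1) by simp
  moreover have "n > 0" unfolding n_def using a0 ab(1) by simp
  moreover have "cnj (of_int b * y) = of_int b * y" using cy by simp
  ultimately show ?thesis using that by blast
qed

text \<open>Here a lift of \<open>sg\<close> sends \<theta> to \<i> \<theta>. Commuting with complex
  conjugation, it forces cnj \<theta> = \<rho> \<theta> with sg \<rho> = - \<rho>, so \<rho> = q s
  with q Gaussian. Squaring gives cnj r = q^2 D r, hence |r|^2 D = (q D r)^2, and a Gaussian number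
  with positive square is rational.\<close>

lemma cyclic_case_norm:
  assumes g: "gen \<theta>" and r: "r \<in> QI" "\<theta> ^ 2 = r * s"
  shows "\<exists>f\<in>\<rat>. (cmod r) ^ 2 * real D = f ^ 2"
proof -
  have gk: "\<theta> \<notin> k" "\<theta> ^ 2 \<in> k" "K = adj k \<theta>" using g unfolding gen_def by auto
  have \<theta>K: "\<theta> \<in> K" using gen_mem[OF g] .
  obtain \<rho> where \<rho>: "\<rho> \<in> k" "cnj \<theta> = \<rho> * \<theta>" using cnj_generator[OF g] by blast
  have \<rho>K: "\<rho> \<in> K" and iK: "\<i> \<in> K" using \<rho> kK QI_ii QIk by blast+
  have \<theta>0': "\<theta> \<noteq> 0" using gk nfs(1)[OF k] by auto
  have r0: "r \<noteq> 0" using \<theta>0' r(2) by auto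
  have rk: "r \<in> k" using r QIk by blast
  have "(\<i> * \<theta>) ^ 2 = sg (\<theta> ^ 2)" using r sg.mult[OF rk sk] sg_fix[OF r(1)] sg_s by (simp add: power_mult_distrib)
  then obtain t where t: "fhom K t" "\<And>x. x \<in> k \<Longrightarrow> t x = sg x" "t \<theta> = \<i> * \<theta>"
    using fhom_extension[OF k sg_hom gk(2,1)] unfolding gk(3) by blast
  interpret t: fhom_on K t using K t(1) by unfold_locales
  have "cnj (t \<theta>) = t (cnj \<theta>)" using abelian_commute[OF K ab fhom_cnj t(1) \<theta>K] .
  then have ct: "- \<i> * (\<rho> * \<theta>) = sg \<rho> * (\<i> * \<theta>)" using t \<rho> t.mult[OF \<rho>K \<theta>K] by simp
  have i\<theta>: "\<i> * \<theta> \<noteq> 0" using \<theta>0' by simp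
  from ct have "(\<i> * \<theta>) * sg \<rho> = (\<i> * \<theta>) * (- \<rho>)" by (simp add: mult_ac)
  then have sr: "sg \<rho> = - \<rho>" unfolding mult_left_cancel[OF i\<theta>] .
  define q where "q = \<rho> / s"
  have "sg q = q" unfolding q_def using sg.divide[OF \<rho>(1) sk] sr sg_s by simp
  then have qQ: "q \<in> QI" using fixed_QI nfs(8)[OF k \<rho>(1) sk] unfolding q_def by blast
  have \<rho>q: "\<rho> = q * s" unfolding q_def using s0 by simp
  have "cnj r * s = (cnj \<theta>) ^ 2" using arg_cong[OF r(2), of cnj] real by simp
  also have "\<dots> = (q ^ 2 * of_nat D * r) * s" unfolding \<rho>(2) \<rho>q s2[symmetric] power_mult_distrib r(2) by (simp add: mult_ac)
  finally have cr: "cnj r = q ^ 2 * of_nat D * r" using s0 by simp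
  define z where "z = q * of_nat D * r"
  have zQ: "z \<in> QI" unfolding z_def using nfs(4)[OF QI_subfield nfs(4)[OF QI_subfield qQ nf_subfield_of_nat[OF QI_subfield]] r(1)] .
  have "z ^ 2 = (r * cnj r) * of_nat D" unfolding z_def cr by (simp add: power2_eq_square)
  also have "\<dots> = of_real ((cmod r) ^ 2 * real D)" using complex_norm_square[of r] by simp
  finally have z2: "z ^ 2 = of_real ((cmod r) ^ 2 * real D)" .
  then have "Im (z ^ 2) = 0" "Re (z ^ 2) = (cmod r) ^ 2 * real D" by simp_all
  then have z3: "Re z * Im z = 0" "Re z ^ 2 - Im z ^ 2 = (cmod r) ^ 2 * real D" by (auto simp: power2_eq_square)
  have pos: "(cmod r) ^ 2 * real D > 0" using r0 D0 by simp
  have "Im z = 0"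
  proof (rule ccontr)
    assume "Im z \<noteq> 0"
    then have "Re z = 0" using z3(1) by simp
    then have "- (Im z ^ 2) > 0" using z3(2) pos by simp
    then show False using zero_le_power2[of "Im z"] by linarith
  qed
  then have "(cmod r) ^ 2 * real D = Re z ^ 2" using z3(2) by simp
  moreover have "Re z \<in> \<rat>" using zQ unfolding QI_def by simp
  ultimately show ?thesis by blast
qed

text \<open>Take a generator with \<eta>^2 = a s and a of least Gaussian norm. Unramifiedness makes
  both primes over p divide a, minimality makes them divide it only once, so a = p e with the norm
  of e prime to p. Then |a|^2 D contains p to an odd power and cannot be a rational square.\<close>

lemma cyclic_case_impossible:
  fixes p m :: nat
  assumes p: "prime p" "p mod 4 = 1" and D: "D = p * m" "\<not> p dvd m"
    and g: "gen \<theta>" and r: "r \<in> QI" "\<theta> ^ 2 = r * s"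
  shows False
proof -
  define P where "P = (\<lambda>r. r \<in> ZI \<and> (\<exists>\<theta>. gen \<theta> \<and> \<theta> ^ 2 = r * s))"
  obtain c where c: "c \<in> ZI" "c \<noteq> 0" "c * r \<in> Ok" using denominator r QIk by blast
  have "c * r \<in> QI" using nfs(4)[OF QI_subfield _ r(1)] c(1) ZI_QI by blast
  then have crZ: "c * r \<in> ZI" using O_QI c(3) by blast
  have "P (c * (c * r))" unfolding P_def
  proof (intro conjI exI[of _ "c * \<theta>"])
    show "c * (c * r) \<in> ZI" using zis(4)[OF c(1) crZ] .
    show "gen (c * \<theta>)" using gen_scale[OF g ZIk[OF c(1)] c(2)] .
    show "(c * \<theta>) ^ 2 = c * (c * r) * s" using r(2) by (simp add: power_mult_distrib power2_eq_square)
  qed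
  then obtain a where a: "P a" "\<And>b. P b \<Longrightarrow> gnorm a \<le> gnorm b"
    using ex_has_least_nat[of P _ gnorm] by blast
  obtain \<eta> where \<eta>: "gen \<eta>" "\<eta> ^ 2 = a * s" and aZ: "a \<in> ZI" using a(1) unfolding P_def by blast
  have a0: "a \<noteq> 0" using \<eta> nfs(1)[OF k] unfolding gen_def by auto
  \<comment> \<open>Only the splitting of p into conjugate Gaussian primes is wanted from the
    unit-square lemma, so it is applied to the field of all complex numbers.\<close>
  have U: "nf_subfield UNIV" by (simp add: nf_subfield_def)
  obtain \<pi> where \<pi>: "\<pi> \<in> ZI" "\<pi> * cnj \<pi> = of_nat p"
    using unit_square_gaussian_prime[OF p U] by blast
  have oddp: "odd p" using p(2) by presburger
  have \<pi>': "cnj \<pi> \<in> ZI" "cnj \<pi> * cnj (cnj \<pi>) = of_nat p" using \<pi> zis(11) by (auto simp: mult.commute)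
  have pr: "prime (gnorm \<pi>)" "prime (gnorm (cnj \<pi>))" using prime_gnorm_if \<pi> \<pi>' p(1) by blast+
  have p0: "(of_nat p :: complex) \<noteq> 0" using p(1) by (simp add: prime_gt_0_nat)
  have \<pi>0: "\<pi> \<noteq> 0" using \<pi>(2) p0 by auto
  have gp: "gnorm \<pi> = p" "gnorm (cnj \<pi>) = p" using gnorm_cnj[OF \<pi>(1)] \<pi>(2) gnorm_cnj[OF \<pi>'(1)] \<pi>'(2) by simp_all
  have div1: "a / \<pi> \<in> ZI" and div2: "a / cnj \<pi> \<in> ZI"
    using ramified_at_divisor_of_D[OF K kK gen_mem[OF \<eta>(1)] \<eta>(2) aZ _ p(1) oddp \<pi> D]
      ramified_at_divisor_of_D[OF K kK gen_mem[OF \<eta>(1)] \<eta>(2) aZ _ p(1) oddp \<pi>' D] unr by blast+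
  \<comment> \<open>A square factor x^2 of a could be absorbed by passing to \<eta> / x, which would
    lower the norm.\<close>
  have sqf: "a / x ^ 2 \<notin> ZI" if x: "x \<in> ZI" "gnorm x = p" for x
  proof
    assume az: "a / x ^ 2 \<in> ZI"
    have x0: "x \<noteq> 0" using x gnorm_0[of x] p(1) by (auto simp: prime_gt_0_nat)
    have "P (a / x ^ 2)" unfolding P_def
    proof (intro conjI exI[of _ "(1 / x) * \<eta>"] az)
      show "gen ((1 / x) * \<eta>)" using gen_scale[OF \<eta>(1) nfs(8)[OF k nfs(2)[OF k] ZIk[OF x(1)]]] x0 by simp
      show "(1 / x * \<eta>) ^ 2 = a / x ^ 2 * s" using \<eta>(2) by (simp add: power_divide power_mult_distrib)
    qed
    then have le: "gnorm a \<le> gnorm (a / x ^ 2)" using a(2) by blast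
    have "gnorm a = gnorm ((a / x ^ 2) * (x * x))" using x0 by (simp add: power2_eq_square)
    also have "\<dots> = gnorm (a / x ^ 2) * (p * p)"
      using gnorm_mult[OF az zis(4)[OF x(1) x(1)]] gnorm_mult[OF x(1) x(1)] x(2) by simp
    finally have e: "gnorm a = gnorm (a / x ^ 2) * (p * p)" .
    have "gnorm a > 0" using gnorm_0[OF aZ] a0 by simp
    then have c0: "gnorm (a / x ^ 2) > 0" unfolding e by simp
    moreover have "p * p > 1" using prime_gt_1_nat[OF p(1)] less_1_mult by blast
    ultimately have "gnorm (a / x ^ 2) * 1 < gnorm (a / x ^ 2) * (p * p)" by (intro mult_strict_left_mono)
    then have "gnorm (a / x ^ 2) < gnorm a" unfolding e[symmetric] by simp
    then show False using le by simp
  qed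
  define b where "b = a / \<pi>"
  have "\<pi> * b / cnj \<pi> \<in> ZI" using div2 \<pi>0 unfolding b_def by simp
  moreover have "\<pi> / cnj \<pi> \<notin> ZI" using gaussian_prime_not_assoc_cnj[OF \<pi>' p(1) oddp] by simp
  ultimately have bc: "b / cnj \<pi> \<in> ZI"
    using prime_gnorm_dvd[OF \<pi>'(1) pr(2) \<pi>(1), of b] div1 unfolding b_def by blast
  define e where "e = b / cnj \<pi>"
  have eZ: "e \<in> ZI" unfolding e_def by (rule bc)
  have ae: "a = of_nat p * e" unfolding e_def b_def \<pi>(2)[symmetric] using \<pi>0 by simp
  have e1: "e / \<pi> \<notin> ZI"
  proof
    assume h: "e / \<pi> \<in> ZI"
    have "a / \<pi> ^ 2 = cnj \<pi> * (e / \<pi>)" unfolding ae \<pi>(2)[symmetric] using \<pi>0 by (simp add: power2_eq_square)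
    then show False using sqf[OF \<pi>(1) gp(1)] zis(4)[OF \<pi>'(1) h] by simp
  qed
  have e2: "cnj e / \<pi> \<notin> ZI"
  proof
    assume "cnj e / \<pi> \<in> ZI"
    then have h: "e / cnj \<pi> \<in> ZI" using zis(11)[of "cnj e / \<pi>"] by simp
    have "a / (cnj \<pi>) ^ 2 = \<pi> * (e / cnj \<pi>)" unfolding ae \<pi>(2)[symmetric] using \<pi>0 by (simp add: power2_eq_square)
    then show False using sqf[OF \<pi>'(1) gp(2)] zis(4)[OF \<pi>(1) h] by simp
  qed
  have np: "\<not> p dvd gnorm e"
  proof
    assume "p dvd gnorm e"
    then obtain l where "gnorm e = p * l" by blast
    then have "e * cnj e = \<pi> * cnj \<pi> * of_nat l" using gnorm_cnj[OF eZ] \<pi>(2) by simp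
    then have "e * cnj e / \<pi> = cnj \<pi> * of_nat l" using \<pi>0 by simp
    moreover have "cnj \<pi> * of_nat l \<in> ZI" using zis(4)[OF \<pi>'(1) zis(8)] .
    ultimately show False using prime_gnorm_dvd[OF \<pi>(1) pr(1) eZ zis(11)[OF eZ]] e1 e2 by simp
  qed
  have "a \<in> QI" using aZ ZI_QI by blast
  then obtain f where f: "f \<in> \<rat>" "(cmod a) ^ 2 * real D = f ^ 2" using cyclic_case_norm[OF \<eta>(1) _ \<eta>(2)] by blast
  have "(cmod a) ^ 2 = real p ^ 2 * real (gnorm e)" unfolding ae gnorm[OF eZ] by (simp add: norm_mult power_mult_distrib)
  then have "real p ^ 2 * real (gnorm e * D) = f ^ 2" using f(2) by simp
  then have "real (gnorm e * D) = (f / real p) ^ 2" using p(1) by (simp add: field_simps prime_gt_0_nat)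
  then have "sqrt (real (gnorm e * D)) = \<bar>f / real p\<bar>" by (metis real_sqrt_abs)
  then have "sqrt (real (gnorm e * D)) \<in> \<rat>" using f(1) by simp
  then obtain l where l: "gnorm e * D = l ^ 2" using sqrt_rat_imp_square by blast
  then have "p dvd l ^ 2" unfolding D by (metis dvd_mult dvd_triv_left)
  then have "p dvd l" using p(1) prime_dvd_power by blast
  then obtain j where "l = p * j" by blast
  then have "p * (gnorm e * m) = p * (p * j ^ 2)" using l unfolding D by (simp add: power2_eq_square mult_ac)
  then have "gnorm e * m = p * j ^ 2" using p(1) by (simp add: prime_gt_0_nat)
  then have "p dvd gnorm e * m" by simp
  then show False using np D(2) p(1) prime_dvd_mult_iff by blast
qed

text \<open>The least admissible n is squarefree, and its primes divide D, since any other would be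
  odd and ramify in K. So n divides 2 p1 p2, and an even n is exchanged for D / n; divisors of p1 p2
  are 1 mod 4.\<close>

lemma biquadratic_generator:
  fixes p1 p2 :: nat
  assumes D: "D = 2 * p1 * p2" and p: "prime p1" "prime p2" "p1 mod 4 = 1" "p2 mod 4 = 1"
    and g: "gen \<theta>" "\<theta> ^ 2 \<in> QI"
  obtains m :: nat and y where "gen y" "y ^ 2 = of_nat m" "cnj y = y" "m mod 4 = 1"
proof -
  define P where "P = (\<lambda>n::nat. n > 0 \<and> (\<exists>y. gen y \<and> y ^ 2 = of_nat n \<and> cnj y = y))"
  obtain n0 y0 where "n0 > 0" "gen y0" "y0 ^ 2 = of_nat n0" "cnj y0 = y0" using biquadratic_case[OF g] by blast
  then have "P n0" unfolding P_def by blast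
  define n where "n = (LEAST n. P n)"
  have n: "P n" "\<And>j. P j \<Longrightarrow> n \<le> j" unfolding n_def using \<open>P n0\<close> by (auto intro: LeastI Least_le)
  obtain y where y: "gen y" "y ^ 2 = of_nat n" "cnj y = y" and n0: "n > 0" using n(1) unfolding P_def by blast
  have sqf: "\<not> q ^ 2 dvd n" if q: "prime q" for q
  proof
    assume "q ^ 2 dvd n"
    then obtain j where j: "n = q ^ 2 * j" by blast
    have q0: "q > 1" using prime_gt_1_nat[OF q] .
    then have qc: "(of_nat q :: complex) \<noteq> 0" by simp
    have "P j" unfolding P_def
    proof (intro conjI exI[of _ "1 / of_nat q * y"])
      show "j > 0" using j n0 by (cases j) auto
      show "gen (1 / of_nat q * y)"
        using gen_scale[OF y(1) nfs(8)[OF k nfs(2)[OF k] nf_subfield_of_nat[OF k, of q]]] qc by simp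
      show "(1 / of_nat q * y) ^ 2 = of_nat j" using y(2) j qc by (simp add: power_divide power_mult_distrib)
      show "cnj (1 / of_nat q * y) = 1 / of_nat q * y" using y(3) by simp
    qed
    then have "n \<le> j" using n(2) by blast
    moreover have "j < n"
    proof -
      have "q ^ 2 > 1" using one_less_power[OF q0, of 2] by simp
      moreover have "j > 0" using j n0 by (cases j) auto
      ultimately show ?thesis unfolding j by simp
    qed
    ultimately show False by simp
  qed
  have dvdD: "q dvd D" if q: "prime q" "q dvd n" for q
  proof (rule ccontr)
    assume nd: "\<not> q dvd D"
    have "odd q"
    proof
      assume "even q"
      then have "q = 2" using primes_dvd_imp_eq[OF two_is_prime_nat q(1)] by simp
      then show False using nd D by simp
    qed
    moreover have "int q dvd int n" "\<not> int q ^ 2 dvd int n" using q sqf[OF q(1)]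
      by (auto simp flip: of_nat_power)
    moreover have "y ^ 2 = of_int (int n)" using y(2) by simp
    ultimately show False using ramified_at_integer[OF K kK gen_mem[OF y(1)], of "int n" q] q(1) nd unr by blast
  qed
  have nD: "n dvd D"
  proof (rule multiplicity_le_imp_dvd)
    fix q :: nat assume q: "prime q"
    show "multiplicity q n \<le> multiplicity q D"
    proof (cases "q dvd n")
      case True
      have "multiplicity q n < 2" using sqf[OF q] multiplicity_dvd'[of 2 q n] by (meson not_le)
      moreover have "multiplicity q D \<ge> 1" using dvdD[OF q True] D0 q
        prime_multiplicity_gt_zero_iff[of q D] by (simp add: Suc_le_eq)
      ultimately show ?thesis by simp
    next
      case False
      then show ?thesis by (simp add: not_dvd_imp_multiplicity_0)
    qed
  qed (use n0 in auto)
  have odd12: "odd (p1 * p2)" using p by (simp, presburger)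
  have mod4: "m mod 4 = 1" if m: "m dvd p1 * p2" for m
  proof -
    have d2: "l mod 4 = 1" if "l dvd p2" for l
      using that p(2,4) by (auto simp: prime_nat_iff)
    show ?thesis
    proof (cases "p1 dvd m")
      case True
      then obtain l where l: "m = p1 * l" by blast
      then have "l dvd p2" using m p(1) by (simp add: prime_gt_0_nat)
      then have "l mod 4 = 1" using d2 by blast
      then show ?thesis unfolding l using p(3) by (metis mod_mult_left_eq mult_1)
    next
      case False
      then have "coprime m p1" using p(1) by (metis coprime_commute prime_imp_coprime)
      then have "m dvd p2" using m by (simp add: coprime_dvd_mult_right_iff)
      then show ?thesis using d2 by blast
    qed
  qed
  show ?thesis
  proof (cases "even n")
    case False
    then have "coprime n 2" by simp
    then have "n dvd p1 * p2" using nD unfolding D mult.assoc by (simp add: coprime_dvd_mult_right_iff)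
    then show ?thesis using that[OF y] mod4 by blast
  next
    case True
    then obtain l where l: "n = 2 * l" by blast
    then have "l dvd p1 * p2" using nD unfolding D by (simp add: mult.assoc)
    then obtain m where m: "p1 * p2 = l * m" by blast
    have nm: "D = n * m" unfolding D l using m by (simp add: mult.assoc)
    have yk: "y \<noteq> 0" using y(2) n0 by auto
    have nc: "(of_nat n :: complex) \<noteq> 0" using n0 by simp
    \<comment> \<open>s / y is a multiple of y by an element of k, hence again a generator, and its
      square D / n is odd.\<close>
    have "s / y = (s / of_nat n) * y" using y(2) yk nc by (simp add: field_simps power2_eq_square)
    moreover have "gen ((s / of_nat n) * y)"
      using gen_scale[OF y(1) nfs(8)[OF k sk nf_subfield_of_nat[OF k, of n]]] s0 nc by simp
    ultimately have "gen (s / y)" by simp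
    moreover have "(s / y) ^ 2 = of_nat m" unfolding power_divide s2 y(2) nm using nc by simp
    moreover have "cnj (s / y) = s / y" using real y(3) by simp
    moreover have "m mod 4 = 1" using mod4[of m] m by simp
    ultimately show ?thesis using that by blast
  qed
qed

text \<open>The hypothesis lists two ways to deal with a norm \<plusminus>\<i>: a unit z of k with
  such a norm corrects a, while a real square root of some m that is 1 mod 4 shows that this norm
  does not occur.\<close>

lemma capitulation_kernel_subset:
  assumes unit: "(\<exists>z\<in>Ok. 1 / z \<in> Ok \<and> z * sg z \<in> {\<i>, -\<i>}) \<or>
    (\<exists>y. \<exists>m::nat. gen y \<and> y ^ 2 = of_nat m \<and> cnj y = y \<and> m mod 4 = 1)"
  shows "capitulation_kernel Ok (ring_of_integers K) \<subseteq> Am_s k QI"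
proof
  let ?R = "ring_of_integers K"
  have R: "subring_C ?R" "Ok \<subseteq> ?R"
    using ring_of_integers_subring[OF K] kK by (auto simp: ring_of_integers_iff)
  fix X assume X: "X \<in> capitulation_kernel Ok ?R"
  then obtain I where I: "I \<in> nz_ideals Ok" "X = ideal_class Ok I"
    unfolding capitulation_kernel_def by (auto simp: class_group_def)
  then have I': "nf_ideal Ok I" "I \<noteq> {0}" by (auto simp: nz_ideals_def)
  obtain \<beta> where \<beta>: "\<beta> \<in> ?R" "\<beta> \<noteq> 0" "ideal_gen ?R I = (\<lambda>x. \<beta> * x) ` ?R"
    using X capitulation_kernel_iff[OF O_ring R I(1)] I(2) unfolding becomes_principal_def by blast
  have \<beta>K: "\<beta> \<in> K" using \<beta>(1) ring_of_integers_iff by blast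
  obtain g where g: "g \<in> ZI" "g \<noteq> 0" "g \<in> ideal_mult Ok I (sg ` I)"
    "\<And>x y. x \<in> I \<Longrightarrow> y \<in> I \<Longrightarrow> x * sg y / g \<in> Ok"
    using ideal_norm[OF I'] by blast
  \<comment> \<open>The first alternative names no generator, so \<open>\<theta>0\<close> serves as
    w there; the conjugation tau of K over k is then built from w in both cases.\<close>
  have "gen \<theta>0" unfolding gen_def using \<theta>0 by blast
  then obtain w where w: "gen w" and unit': "(\<exists>z\<in>Ok. 1 / z \<in> Ok \<and> z * sg z \<in> {\<i>, -\<i>}) \<or>
    (\<exists>m::nat. w ^ 2 = of_nat m \<and> cnj w = w \<and> m mod 4 = 1)" using unit by blast
  have wk: "w \<notin> k" "w ^ 2 \<in> k" "K = adj k w" using w unfolding gen_def by auto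
  obtain tau where tau: "fhom K tau" "\<And>x. x \<in> k \<Longrightarrow> tau x = x"
      "\<And>u v. u \<in> k \<Longrightarrow> v \<in> k \<Longrightarrow> tau (u + v * w) = u - v * w" "\<And>x. x \<in> K \<Longrightarrow> tau x \<in> K"
    by (rule quad_conj[OF k wk(2,1)]) (unfold wk(3), metis)
  have nk: "x * tau x \<in> k" if xK: "x \<in> K" for x
  proof -
    obtain u v where x: "u \<in> k" "v \<in> k" "x = u + v * w" using xK unfolding wk(3) by (rule adjE)
    have "x * tau x = u * u - v * v * w ^ 2" unfolding x(3) tau(3)[OF x(1,2)]
      by (simp add: algebra_simps power2_eq_square)
    then show ?thesis using nfs(7)[OF k nfs(4)[OF k x(1,1)] nfs(4)[OF k nfs(4)[OF k x(2,2)] wk(2)]] by simp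
  qed
  note cap = capitulating_ideal[OF I' g K kK tau(1,4,2) nk \<beta>]
  define a where "a = \<beta> * tau \<beta> / g"
  have ak: "a \<in> k" unfolding a_def using nfs(8)[OF k nk[OF \<beta>K] ZIk[OF g(1)]] .
  have aI: "(\<lambda>x. a * sg x) ` I = I" unfolding a_def using cap(1) .
  have an: "a * sg a \<in> {1, -1, \<i>, -\<i>}" using twisted_invariant_norm[OF I' ak aI] .
  have "ideal_class Ok I \<in> strongly_ambiguous_classes k QI"
  proof (cases "a * sg a \<in> {1, -1}")
    case True
    then show ?thesis using strongly_ambiguousI'[OF I' ak aI] by blast
  next
    case False
    then have ani: "a * sg a = \<i> \<or> a * sg a = -\<i>" using an by blast
    from unit' show ?thesis
    proof
      assume "\<exists>z\<in>Ok. 1 / z \<in> Ok \<and> z * sg z \<in> {\<i>, -\<i>}"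
      then obtain z where z: "z \<in> Ok" "1 / z \<in> Ok" "z * sg z \<in> {\<i>, -\<i>}" by blast
      have z0: "z \<noteq> 0" using z(3) by auto
      have zk: "z \<in> k" using z(1) O_iff by blast
      have "(\<lambda>x. z * a * sg x) ` I = (\<lambda>x. z * x) ` (\<lambda>x. a * sg x) ` I" by (simp add: image_image mult.assoc)
      also have "\<dots> = (\<lambda>x. z * x) ` I" unfolding aI ..
      also have "\<dots> = I"
      proof
        show "(\<lambda>x. z * x) ` I \<subseteq> I" using nf_idealD(4)[OF I'(1) z(1)] by blast
        show "I \<subseteq> (\<lambda>x. z * x) ` I"
        proof
          fix x assume "x \<in> I"
          then have "1 / z * x \<in> I" using nf_idealD(4)[OF I'(1) z(2)] by blast
          then show "x \<in> (\<lambda>x. z * x) ` I" using z0 by (intro image_eqI[of _ _ "1 / z * x"]) auto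
        qed
      qed
      finally have zI: "(\<lambda>x. z * a * sg x) ` I = I" .
      have zz: "(z * a) * sg (z * a) = (z * sg z) * (a * sg a)" using sg.mult[OF zk ak] by (simp add: mult_ac)
      have "z * sg z = \<i> \<or> z * sg z = -\<i>" using z(3) by blast
      then have "(z * a) * sg (z * a) \<in> {1, -1}" unfolding zz using ani
        by (elim disjE) (simp_all only:, simp_all)
      then show ?thesis using strongly_ambiguousI'[OF I' nfs(4)[OF k zk ak] zI] by blast
    next
      assume "\<exists>m::nat. w ^ 2 = of_nat m \<and> cnj w = w \<and> m mod 4 = 1"
      then obtain m :: nat where m: "w ^ 2 = of_nat m" "cnj w = w" "m mod 4 = 1" by blast
      have wQ: "w \<notin> QI" "w ^ 2 \<in> QI" using wk(1) QIk m(1) nf_subfield_of_nat[OF QI_subfield] by auto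
      obtain sL where sL: "fhom (adj QI w) sL" "\<And>x. x \<in> QI \<Longrightarrow> sL x = x" "sL w = - w"
          "\<And>u v. u \<in> QI \<Longrightarrow> v \<in> QI \<Longrightarrow> sL (u + v * w) = u - v * w"
          "\<And>x. x \<in> adj QI w \<Longrightarrow> sL x \<in> adj QI w" "\<And>x. x \<in> adj QI w \<Longrightarrow> sL (sL x) = x"
        by (rule quad_conj[OF QI_subfield wQ(2,1)]) metis
      interpret L: gquad m w sL
        by unfold_locales (use m(1) wQ sL in auto)
      \<comment> \<open>The lift of \<open>sg\<close> that fixes w: the corresponding norm of
        \<beta> lands in the field generated by \<i> and w, where \<open>no_relative_norm_ii\<close>
        applies.\<close>
      have "w ^ 2 = sg (w ^ 2)" using sg_fix[OF wQ(2)] by simp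
      then obtain s1 where s1: "fhom K s1" "\<And>x. x \<in> k \<Longrightarrow> s1 x = sg x" "s1 w = w"
        using fhom_extension[OF k sg_hom wk(2,1)] unfolding wk(3) by blast
      interpret s1: fhom_on K s1 using K s1(1) by unfold_locales
      have wK: "w \<in> K" using gen_mem[OF w] .
      have s1x: "s1 (u + v * w) = sg u + sg v * w" if uv: "u \<in> k" "v \<in> k" for u v
      proof -
        have "u \<in> K" "v \<in> K" using uv kK by blast+
        then show ?thesis using s1.add[OF _ nfs(4)[OF K _ wK]] s1.mult[OF _ wK] s1(2,3) uv by simp
      qed
      have s1K: "s1 x \<in> K" if xK: "x \<in> K" for x
      proof -
        obtain u v where x: "u \<in> k" "v \<in> k" "x = u + v * w" using xK unfolding wk(3) by (rule adjE)
        show ?thesis unfolding x(3) s1x[OF x(1,2)] using adjI[OF sg_in[OF x(1)] sg_in[OF x(2)], of w] wk(3) by simp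
      qed
      have comm: "tau (s1 x) = s1 (tau x)" if xK: "x \<in> K" for x
      proof -
        obtain u v where x: "u \<in> k" "v \<in> k" "x = u + v * w" using xK unfolding wk(3) by (rule adjE)
        have "tau (s1 x) = sg u - sg v * w" unfolding x(3) s1x[OF x(1,2)] using tau(3) sg_in x by blast
        moreover have "tau x = u + (- v) * w" unfolding x(3) tau(3)[OF x(1,2)] by simp
        then have "s1 (tau x) = sg u - sg v * w" using s1x[OF x(1) nfs(5)[OF k x(2)]] sg.minus[OF x(2)] by simp
        ultimately show ?thesis by simp
      qed
      define v where "v = \<beta> * s1 \<beta> / g"
      have vi: "algebraic_int v" and vn: "v * tau v = a * sg a" unfolding v_def a_def
        using capitulation_relative_norm[OF I'(1) g(1,2) K kK tau(1,4,2) nk s1(1) s1K s1(2) comm \<beta>K \<beta>(3) cap(2)] by blast+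
      obtain b c where bc: "b \<in> k" "c \<in> k" "\<beta> = b + c * w" using \<beta>K unfolding wk(3) by (rule adjE)
      \<comment> \<open>The coefficients are built from two norms and one trace of k over the
        Gaussian field, hence are Gaussian.\<close>
      have "\<beta> * s1 \<beta> = (b * sg b + (c * sg c) * of_nat m) + (b * sg c + sg (b * sg c)) * w"
        unfolding bc(3) s1x[OF bc(1,2)] m(1)[symmetric]
        using sg.mult[OF bc(1) sg_in[OF bc(2)]] sg_sg[OF bc(2)] by (simp add: algebra_simps power2_eq_square)
      moreover have "b * sg b + (c * sg c) * of_nat m \<in> QI"
        using nfs(3)[OF QI_subfield tr_norm_QI(2)[OF bc(1)] nfs(4)[OF QI_subfield tr_norm_QI(2)[OF bc(2)] nf_subfield_of_nat[OF QI_subfield]]] .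
      moreover have "b * sg c + sg (b * sg c) \<in> QI" using tr_norm_QI(1)[OF nfs(4)[OF k bc(1) sg_in[OF bc(2)]]] .
      ultimately have "\<beta> * s1 \<beta> \<in> adj QI w" using adjI by metis
      then have vL: "v \<in> adj QI w" unfolding v_def using nfs(8)[OF L.k _ L.ZIk[OF g(1)]] by blast
      then obtain p q where pq: "p \<in> QI" "q \<in> QI" "v = p + q * w" by (rule adjE)
      have "tau v = sL v" unfolding pq(3) using sL(4)[OF pq(1,2)] tau(3) pq QIk by auto
      then have "v * sL v = a * sg a" using vn by simp
      then show ?thesis using L.no_relative_norm_ii[OF m(2,3) vL vi] ani by blast
    qed
  qed
  then show "X \<in> Am_s k QI" unfolding Am_s_def I(2) by (rule generate.incl)
qed

end

theorem mainTheorem1: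
  fixes p1 p2 :: nat and K k kstar Qi :: "complex set"
  assumes "prime p1" and "prime p2" and "p1 mod 4 = 1" and "p2 mod 4 = 1"
  defines "k \<equiv> gen_field {complex_of_real (sqrt (2 * real p1 * real p2)), \<i>}"
      and "Qi \<equiv> gen_field {\<i>}"
      and "kstar \<equiv> gen_field {complex_of_real (sqrt 2), complex_of_real (sqrt (real p1)),
                                complex_of_real (sqrt (real p2)), \<i>}"
  assumes "quadratic_ext k K" and "unramified k K" and "abelian_over_Q K"
  shows "capitulation_kernel (ring_of_integers k) (ring_of_integers K) \<subseteq> Am_s k Qi
     \<and> Am_s k Qi \<subseteq> capitulation_kernel (ring_of_integers k) (ring_of_integers kstar)"
proof -
  define D where "D = 2 * p1 * p2"
  define s where "s = complex_of_real (sqrt (2 * real p1 * real p2))"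
  have odd: "odd p1" "odd p2" using assms(3,4) by presburger+
  have "s ^ 2 = of_real ((sqrt (2 * real p1 * real p2)) ^ 2)" unfolding s_def by (simp only: of_real_power)
  also have "(sqrt (2 * real p1 * real p2)) ^ 2 = real D" unfolding D_def by simp
  finally have s2: "s ^ 2 = of_nat D" by simp
  then have s2Q: "s ^ 2 \<in> QI" using nf_subfield_of_nat[OF QI_subfield] by simp
  have sQ: "s \<notin> QI"
  proof
    assume "s \<in> QI"
    then have "sqrt (real D) \<in> \<rat>" unfolding s_def QI_def D_def by simp
    then obtain l where l: "D = l ^ 2" using sqrt_rat_imp_square by blast
    have "even l" using l unfolding D_def by (metis dvd_triv_left even_power mult.assoc)
    then obtain j where "l = 2 * j" by blast
    then have "2 * (p1 * p2) = 2 * (2 * j ^ 2)" using l unfolding D_def by (simp add: power2_eq_square)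
    then have "p1 * p2 = 2 * j ^ 2" by simp
    then have "even (p1 * p2)" by simp
    then show False using odd by simp
  qed
  have kk: "k = adj QI s" unfolding k_def s_def[symmetric] using gen_field_sqrt_ii[OF s2Q] .
  have QQ: "Qi = QI" unfolding Qi_def by (rule gen_field_ii)
  have kf: "nf_subfield k" unfolding kk using adj_subfield[OF QI_subfield s2Q] .
  obtain sg where sg: "fhom k sg" "\<And>x. x \<in> QI \<Longrightarrow> sg x = x" "sg s = - s"
      "\<And>x. x \<in> k \<Longrightarrow> sg x \<in> k" "\<And>x. x \<in> k \<Longrightarrow> sg (sg x) = x"
    by (rule quad_conj[OF QI_subfield s2Q sQ]) (unfold kk, metis)
  interpret gquad D s sg
    by unfold_locales (use s2 sQ sg kk in auto)
  obtain \<alpha> where \<alpha>: "nf_subfield K" "k \<subseteq> K" "\<alpha> \<in> K" "\<alpha> \<notin> k" "K = {a + b * \<alpha> | a b. a \<in> k \<and> b \<in> k}"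
    using assms(8) unfolding quadratic_ext_def by blast
  obtain \<theta> where \<theta>: "\<theta> \<notin> k" "\<theta> ^ 2 \<in> k" "K = adj k \<theta>"
    by (rule quad_ext_complete_square[OF kf \<alpha>])
  interpret abelian_quad D s sg K \<theta>
    by unfold_locales (use \<theta> assms(9,10) kk s_def in auto)
  have gens: "(\<exists>z\<in>Ok. 1 / z \<in> Ok \<and> z * sg z \<in> {\<i>, -\<i>}) \<or>
    (\<exists>y. \<exists>m::nat. gen y \<and> y ^ 2 = of_nat m \<and> cnj y = y \<and> m mod 4 = 1)"
  proof (cases "p1 = p2")
    case True
    \<comment> \<open>For equal primes s = p1 sqrt 2, so z is a primitive 8th root of unity; it
      changes sign under \<open>sg\<close>, and its norm is - z^2 = - \<i>.\<close>
    define z where "z = (1 + \<i>) * of_nat p1 / s"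
    have p0: "(of_nat p1 :: complex) \<noteq> 0" using assms(1) by (simp add: prime_gt_0_nat)
    have zQ: "(1 + \<i>) * of_nat p1 \<in> QI" using QI_subfield QI_ii by (auto intro!: nfs)
    have zk: "z \<in> adj QI s" unfolding z_def using nfs(8)[OF local.k _ sk] zQ QIk by blast
    have "z ^ 2 = (1 + \<i>) ^ 2 * of_nat p1 ^ 2 / of_nat D" unfolding z_def power_divide power_mult_distrib s2 ..
    also have "\<dots> = \<i>" unfolding D_def True[symmetric] using p0 by (simp add: power2_eq_square field_simps)
    finally have z2: "z ^ 2 = \<i>" .
    have "(1 / z) ^ 2 = - \<i>" unfolding power_divide z2 by simp
    then have "algebraic_int (1 / z)" using alg_int_sqrt[of "1 / z"] by simp
    moreover have "1 / z \<in> adj QI s" using nfs(8)[OF local.k nfs(2)[OF local.k] zk] .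
    moreover have "algebraic_int z" using alg_int_sqrt[of z] z2 by simp
    moreover have "sg z = - z"
    proof -
      have "sg z = sg ((1 + \<i>) * of_nat p1) / sg s" unfolding z_def using sg.divide[OF _ sk] zQ QIk by blast
      then show ?thesis using sg_fix[OF zQ] sg_s unfolding z_def by simp
    qed
    then have "z * sg z = - \<i>" using z2 by (simp add: power2_eq_square)
    ultimately show ?thesis using zk O_iff by blast
  next
    case False
    show ?thesis
    proof (rule generator_cases)
      fix y assume "gen y" "y ^ 2 \<in> QI"
      then show ?thesis using biquadratic_generator[OF D_def assms(1-4)] by metis
    next
      fix y r assume y: "gen y" "r \<in> QI" "y ^ 2 = r * s"
      \<comment> \<open>Distinctness of the two primes enters here: p1 divides D exactly
        once.\<close>
      have "D = p1 * (2 * p2)" unfolding D_def by simp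
      moreover have "\<not> p1 dvd 2 * p2"
      proof
        assume "p1 dvd 2 * p2"
        then have "p1 dvd 2 \<or> p1 dvd p2" using assms(1) prime_dvd_mult_iff by blast
        then have "p1 = 2 \<or> p1 = p2" using assms(1,2) primes_dvd_imp_eq two_is_prime_nat by blast
        then show False using False odd by auto
      qed
      ultimately show ?thesis using cyclic_case_impossible[OF assms(1,3) _ _ y] by blast
    qed
  qed
  have S: "nf_subfield kstar" unfolding kstar_def by (rule gen_field_subfield)
  have Sg: "complex_of_real (sqrt 2) \<in> kstar" "complex_of_real (sqrt (real p1)) \<in> kstar"
    "complex_of_real (sqrt (real p2)) \<in> kstar" "\<i> \<in> kstar"
    unfolding kstar_def by (rule subsetD[OF gen_field_base]; simp)+
  have "s = complex_of_real (sqrt 2) * complex_of_real (sqrt (real p1)) * complex_of_real (sqrt (real p2))"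
    unfolding s_def by (simp add: real_sqrt_mult)
  then have "s \<in> kstar" using nfs(4)[OF S nfs(4)[OF S Sg(1,2)] Sg(3)] by simp
  moreover have "QI \<subseteq> kstar" unfolding gen_field_ii[symmetric] gen_field_def[of "{\<i>}"] using S Sg(4) by blast
  ultimately have "k \<subseteq> kstar" unfolding kk using adj_subset[OF S] by blast
  then have "Am_s k QI \<subseteq> capitulation_kernel (ring_of_integers k) (ring_of_integers kstar)"
    using Am_s_subset_capitulation_kernel[OF S] ambiguous_ideal_becomes_principal[OF D_def assms(1-4) S _ Sg]
    unfolding kk by blast
  then show ?thesis using capitulation_kernel_subset[OF gens] unfolding QQ kk by blast
qed

end
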